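(* The category $\mathbf{MdTop}_\Delta$ of multipointed $d$-spaces is concrete topological and fibre-small over the category of sets, i.e. the functor from $\mathbf{MdTop}_\Delta$ to $\mathbf{Set}$ sending $X=(|X|,X^0,\mathbb{P}^{top}X)$ to the underlying set of the space $|X|$ is topological and fibre-small. Moreover, the category $\mathbf{MdTop}_\Delta$ is locally presentable.
   Context: A topological space $X$ is $\Delta$-generated if it carries the final topology with respect to all continuous maps $\Delta^n\to X$, $n\ge 0$, from the standard topological simplices. A multipointed $d$-space is a triple $X=(|X|,X^0,\mathbb{P}^{top}X)$ where $|X|$ is a $\Delta$-generated space, $X^0$ is a subset of $|X|$, and $\mathbb{P}^{top}X$ is the disjoint union of sets $\mathbb{P}^{top}_{\alpha,\beta}X$, $(\alpha,\beta)\in X^0\times X^0$, where $\mathbb{P}^{top}_{\alpha,\beta}X$ is a set of continuous paths $\phi:[0,1]\to|X|$ with $\phi(0)=\alpha$ and $\phi(1)=\beta$; these are required to be closed under concatenation $\phi_1*_{1/2}\phi_2$ (equal to $\phi_1(2t)$ for $t\le1/2$ and $\phi_2(2t-1)$ for $t\ge1/2$, when $\phi_1(1)=\phi_2(0)$) and under strictly increasing reparametrization: $\phi\circ\psi\in\mathbb{P}^{top}_{\alpha,\beta}X$ for every $\phi\in\mathbb{P}^{top}_{\alpha,\beta}X$ and every strictly increasing continuous $\psi:[0,1]\to[0,1]$ with $\psi(0)=0$, $\psi(1)=1$. A morphism $f:X\to Y$ is a continuous map $|f|:|X|\to|Y|$ with $|f|(X^0)\subset Y^0$ such that $|f|\circ\phi\in\mathbb{P}^{top}Y$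 for every $\phi\in\mathbb{P}^{top}X$. A functor $U:\mathcal{A}\to\mathcal{X}$ is topological (in the sense of Adámek–Herrlich–Strecker) if every $U$-structured source $(E\to U(A_i))_{i\in I}$ (with $I$ a possibly large class) has a unique $U$-initial lift; equivalently, every $U$-structured sink has a unique $U$-final lift. It is fibre-small if for each object $E$ of $\mathcal{X}$ the fibre of $U$ over $E$ is a set. *)

theory Defs
  imports "HOL-Homology.Simplices"
begin

unbundle cardinal_syntax

section \<open>Size\<close>

text \<open>
  HOL has no type of all sets. A type \<^typ>\<open>'v\<close> of strongly inaccessible cardinality plays the
  role of the class of all sets: a set (over any type) is small, i.e. an honest set, if it has
  fewer elements than \<^typ>\<open>'v\<close>, and sets that are not small are proper classes. Every small set is
  in bijection with a subset of \<^typ>\<open>'v\<close>. The argument \<open>U\<close> of type \<^typ>\<open>'v itself\<close>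
  below names the universe.
\<close>

definition strongly_inaccessible :: "'a rel \<Rightarrow> bool" where
  "strongly_inaccessible r \<longleftrightarrow>
     Card_order r \<and> natLeq <o r \<and> regularCard r \<and>
     (\<forall>A \<subseteq> Field r. |A| <o r \<longrightarrow> |Pow A| <o r)"

definition small :: "'v itself \<Rightarrow> 'a set \<Rightarrow> bool" where
  "small U A \<longleftrightarrow> |A| <o |UNIV :: 'v set|"

section \<open>Categories and functors\<close>

text \<open>
  Hom-sets of different pairs of objects may overlap; composition and functors therefore take
  the objects as arguments. \<open>Cmp C X Y Z g f\<close> is the composite of \<open>f : X \<rightarrow> Y\<close> and
  \<open>g : Y \<rightarrow> Z\<close>.
\<close>

record ('o, 'm) cat =
  Ob :: "'o set"
  Hom :: "'o \<Rightarrow> 'o \<Rightarrow> 'm set"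
  Cmp :: "'o \<Rightarrow> 'o \<Rightarrow> 'o \<Rightarrow> 'm \<Rightarrow> 'm \<Rightarrow> 'm"
  Idn :: "'o \<Rightarrow> 'm"

locale category =
  fixes C :: "('o, 'm) cat"
  assumes Idn_in_Hom: "X \<in> Ob C \<Longrightarrow> Idn C X \<in> Hom C X X"
    and Cmp_in_Hom:
      "\<lbrakk>X \<in> Ob C; Y \<in> Ob C; Z \<in> Ob C; f \<in> Hom C X Y; g \<in> Hom C Y Z\<rbrakk>
        \<Longrightarrow> Cmp C X Y Z g f \<in> Hom C X Z"
    and Cmp_Idn_right:
      "\<lbrakk>X \<in> Ob C; Y \<in> Ob C; f \<in> Hom C X Y\<rbrakk> \<Longrightarrow> Cmp C X X Y f (Idn C X) = f"
    and Cmp_Idn_left: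
      "\<lbrakk>X \<in> Ob C; Y \<in> Ob C; f \<in> Hom C X Y\<rbrakk> \<Longrightarrow> Cmp C X Y Y (Idn C Y) f = f"
    and Cmp_assoc:
      "\<lbrakk>W \<in> Ob C; X \<in> Ob C; Y \<in> Ob C; Z \<in> Ob C;
        f \<in> Hom C W X; g \<in> Hom C X Y; h \<in> Hom C Y Z\<rbrakk>
        \<Longrightarrow> Cmp C W X Z (Cmp C X Y Z h g) f = Cmp C W Y Z h (Cmp C W X Y g f)"

record ('o, 'm, 'p, 'n) functr =
  OMap :: "'o \<Rightarrow> 'p"
  HMap :: "'o \<Rightarrow> 'o \<Rightarrow> 'm \<Rightarrow> 'n"

locale cat_functor = source: category C + target: category D
  for C :: "('o, 'm) cat" and D :: "('p, 'n) cat" +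
  fixes F :: "('o, 'm, 'p, 'n) functr"
  assumes OMap_in_Ob: "X \<in> Ob C \<Longrightarrow> OMap F X \<in> Ob D"
    and HMap_in_Hom:
      "\<lbrakk>X \<in> Ob C; Y \<in> Ob C; f \<in> Hom C X Y\<rbrakk> \<Longrightarrow> HMap F X Y f \<in> Hom D (OMap F X) (OMap F Y)"
    and HMap_Idn: "X \<in> Ob C \<Longrightarrow> HMap F X X (Idn C X) = Idn D (OMap F X)"
    and HMap_Cmp:
      "\<lbrakk>X \<in> Ob C; Y \<in> Ob C; Z \<in> Ob C; f \<in> Hom C X Y; g \<in> Hom C Y Z\<rbrakk>
        \<Longrightarrow> HMap F X Z (Cmp C X Y Z g f)
            = Cmp D (OMap F X) (OMap F Y) (OMap F Z) (HMap F Y Z g) (HMap F X Y f)"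

definition functor_comp ::
  "('p, 'n, 'q, 'k) functr \<Rightarrow> ('o, 'm, 'p, 'n) functr \<Rightarrow> ('o, 'm, 'q, 'k) functr" where
  "functor_comp G F =
     \<lparr>OMap = (\<lambda>X. OMap G (OMap F X)),
      HMap = (\<lambda>X Y f. HMap G (OMap F X) (OMap F Y) (HMap F X Y f))\<rparr>"

definition faithful :: "('o, 'm) cat \<Rightarrow> ('o, 'm, 'p, 'n) functr \<Rightarrow> bool" where
  "faithful C F \<longleftrightarrow> (\<forall>X \<in> Ob C. \<forall>Y \<in> Ob C. inj_on (HMap F X Y) (Hom C X Y))"

text \<open>
  The category of small sets with elements in \<^typ>\<open>'a\<close>. It is the category of all sets
  (up to equivalence) as soon as \<^typ>\<open>'a\<close> has at least as many elements as the universe.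
\<close>

definition set_cat :: "'v itself \<Rightarrow> ('a set, 'a \<Rightarrow> 'a) cat" where
  "set_cat U =
     \<lparr>Ob = {A. small U A},
      Hom = (\<lambda>A B. A \<rightarrow>\<^sub>E B),
      Cmp = (\<lambda>A B C g f. compose A g f),
      Idn = (\<lambda>A. \<lambda>x\<in>A. x)\<rparr>"

section \<open>Topological functors\<close>

text \<open>
  A source with domain \<open>X\<close> consists of objects \<open>A i\<close> and morphisms \<open>g i : X \<rightarrow> A i\<close>,
  where \<open>i\<close> ranges over \<open>I\<close>; no restriction is put on the size of \<open>I\<close>.
\<close>

definition structured_source ::
  "('o, 'm) cat \<Rightarrow> ('p, 'n) cat \<Rightarrow> ('o, 'm, 'p, 'n) functr
    \<Rightarrow> 'p \<Rightarrow> 'i set \<Rightarrow> ('i \<Rightarrow> 'o) \<Rightarrow> ('i \<Rightarrow> 'n) \<Rightarrow> bool" where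
  "structured_source C D F E I A f \<longleftrightarrow>
     E \<in> Ob D \<and> (\<forall>i\<in>I. A i \<in> Ob C \<and> f i \<in> Hom D E (OMap F (A i)))"

definition source_lift ::
  "('o, 'm) cat \<Rightarrow> ('o, 'm, 'p, 'n) functr
    \<Rightarrow> 'p \<Rightarrow> 'i set \<Rightarrow> ('i \<Rightarrow> 'o) \<Rightarrow> ('i \<Rightarrow> 'n) \<Rightarrow> 'o \<Rightarrow> ('i \<Rightarrow> 'm) \<Rightarrow> bool" where
  "source_lift C F E I A f X g \<longleftrightarrow>
     X \<in> Ob C \<and> OMap F X = E \<and>
     (\<forall>i\<in>I. g i \<in> Hom C X (A i) \<and> HMap F X (A i) (g i) = f i)"

definition initial_source ::
  "('o, 'm) cat \<Rightarrow> ('p, 'n) cat \<Rightarrow> ('o, 'm, 'p, 'n) functr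
    \<Rightarrow> 'i set \<Rightarrow> ('i \<Rightarrow> 'o) \<Rightarrow> 'o \<Rightarrow> ('i \<Rightarrow> 'm) \<Rightarrow> bool" where
  "initial_source C D F I A X g \<longleftrightarrow>
     (\<forall>Z \<in> Ob C. \<forall>h. \<forall>k \<in> Hom D (OMap F Z) (OMap F X).
        (\<forall>i\<in>I. h i \<in> Hom C Z (A i) \<and>
           HMap F Z (A i) (h i)
             = Cmp D (OMap F Z) (OMap F X) (OMap F (A i)) (HMap F X (A i) (g i)) k)
        \<longrightarrow> (\<exists>!l. l \<in> Hom C Z X \<and> HMap F Z X l = k \<and>
               (\<forall>i\<in>I. Cmp C Z X (A i) (g i) l = h i)))"

text \<open>
  The first argument fixes the type of the indices of the sources. Families are compared on
  their index set \<open>I\<close> only.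
\<close>

definition topological ::
  "'i itself \<Rightarrow> ('o, 'm) cat \<Rightarrow> ('p, 'n) cat \<Rightarrow> ('o, 'm, 'p, 'n) functr \<Rightarrow> bool" where
  "topological T C D F \<longleftrightarrow>
     cat_functor C D F \<and>
     (\<forall>E (I :: 'i set) A f. structured_source C D F E I A f \<longrightarrow>
        (\<exists>X g. source_lift C F E I A f X g \<and> initial_source C D F I A X g \<and>
           (\<forall>X' g'. source_lift C F E I A f X' g' \<and> initial_source C D F I A X' g'
              \<longrightarrow> X' = X \<and> (\<forall>i\<in>I. g' i = g i))))"

definition concrete_over ::
  "('o, 'm) cat \<Rightarrow> ('p, 'n) cat \<Rightarrow> ('o, 'm, 'p, 'n) functr \<Rightarrow> bool" where
  "concrete_over C D F \<longleftrightarrow> cat_functor C D F \<and> faithful C F"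

definition fibre_small ::
  "'v itself \<Rightarrow> ('o, 'm) cat \<Rightarrow> ('p, 'n) cat \<Rightarrow> ('o, 'm, 'p, 'n) functr \<Rightarrow> bool" where
  "fibre_small U C D F \<longleftrightarrow> (\<forall>E \<in> Ob D. small U {X \<in> Ob C. OMap F X = E})"

section \<open>Locally presentable categories\<close>

definition locally_small :: "'v itself \<Rightarrow> ('o, 'm) cat \<Rightarrow> bool" where
  "locally_small U C \<longleftrightarrow> (\<forall>X \<in> Ob C. \<forall>Y \<in> Ob C. small U (Hom C X Y))"

definition small_category :: "'v itself \<Rightarrow> ('o, 'm) cat \<Rightarrow> bool" where
  "small_category U C \<longleftrightarrow> category C \<and> small U (Ob C) \<and> locally_small U C"

definition is_cocone ::
  "('j, 'k) cat \<Rightarrow> ('o, 'm) cat \<Rightarrow> ('j, 'k, 'o, 'm) functr \<Rightarrow> 'o \<Rightarrow> ('j \<Rightarrow> 'm) \<Rightarrow> bool" where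
  "is_cocone J C D X c \<longleftrightarrow>
     X \<in> Ob C \<and> (\<forall>j \<in> Ob J. c j \<in> Hom C (OMap D j) X) \<and>
     (\<forall>i \<in> Ob J. \<forall>j \<in> Ob J. \<forall>f \<in> Hom J i j.
        Cmp C (OMap D i) (OMap D j) X (c j) (HMap D i j f) = c i)"

definition is_colimit ::
  "('j, 'k) cat \<Rightarrow> ('o, 'm) cat \<Rightarrow> ('j, 'k, 'o, 'm) functr \<Rightarrow> 'o \<Rightarrow> ('j \<Rightarrow> 'm) \<Rightarrow> bool" where
  "is_colimit J C D X c \<longleftrightarrow>
     is_cocone J C D X c \<and>
     (\<forall>Y d. is_cocone J C D Y d \<longrightarrow>
        (\<exists>!h. h \<in> Hom C X Y \<and> (\<forall>j \<in> Ob J. Cmp C (OMap D j) X Y h (c j) = d j)))"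

text \<open>Up to isomorphism, every small category has its objects and morphisms in \<^typ>\<open>'v\<close>.\<close>

definition cocomplete :: "'v itself \<Rightarrow> ('o, 'm) cat \<Rightarrow> bool" where
  "cocomplete U C \<longleftrightarrow>
     (\<forall>(J :: ('v, 'v) cat) D. small_category U J \<and> cat_functor J C D
        \<longrightarrow> (\<exists>X c. is_colimit J C D X c))"

definition regular_cardinal :: "'v itself \<Rightarrow> 'v rel \<Rightarrow> bool" where
  "regular_cardinal U r \<longleftrightarrow>
     Card_order r \<and> infinite (Field r) \<and> regularCard r \<and> small U (Field r)"

definition directed_poset :: "'v itself \<Rightarrow> 'v rel \<Rightarrow> 'v set \<Rightarrow> 'v rel \<Rightarrow> bool" where
  "directed_poset U r I R \<longleftrightarrow>
     small U I \<and> partial_order_on I R \<and>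
     (\<forall>S \<subseteq> I. |S| <o r \<longrightarrow> (\<exists>u\<in>I. \<forall>s\<in>S. (s, u) \<in> R))"

definition poset_cat :: "'i set \<Rightarrow> 'i rel \<Rightarrow> ('i, unit) cat" where
  "poset_cat I R =
     \<lparr>Ob = I,
      Hom = (\<lambda>i j. if (i, j) \<in> R then {()} else {}),
      Cmp = (\<lambda>i j k g f. ()),
      Idn = (\<lambda>i. ())\<rparr>"

text \<open>
  The functor hom(K,-) to the category of sets. Morphisms are embedded into \<^typ>\<open>'v + 'm\<close> because
  this type, unlike \<^typ>\<open>'m\<close> alone, always contains a copy of every small set.
\<close>

definition hom_functor ::
  "'v itself \<Rightarrow> ('o, 'm) cat \<Rightarrow> 'o
    \<Rightarrow> ('o, 'm, ('v + 'm) set, 'v + 'm \<Rightarrow> 'v + 'm) functr" where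
  "hom_functor U C K =
     \<lparr>OMap = (\<lambda>X. Inr ` Hom C K X),
      HMap = (\<lambda>X Y g. \<lambda>h \<in> Inr ` Hom C K X. Inr (Cmp C K X Y g (projr h)))\<rparr>"

definition presentable :: "'v itself \<Rightarrow> 'v rel \<Rightarrow> ('o, 'm) cat \<Rightarrow> 'o \<Rightarrow> bool" where
  "presentable U r C K \<longleftrightarrow>
     K \<in> Ob C \<and>
     (\<forall>I R D X c.
        directed_poset U r I R \<and> cat_functor (poset_cat I R) C D \<and>
        is_colimit (poset_cat I R) C D X c
        \<longrightarrow> is_colimit (poset_cat I R) (set_cat U)
              (functor_comp (hom_functor U C K) D)
              (OMap (hom_functor U C K) X)
              (\<lambda>i. HMap (hom_functor U C K) (OMap D i) X (c i)))"

definition locally_presentable :: "'v itself \<Rightarrow> ('o, 'm) cat \<Rightarrow> bool" where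
  "locally_presentable U C \<longleftrightarrow>
     category C \<and> locally_small U C \<and> cocomplete U C \<and>
     (\<exists>r. regular_cardinal U r \<and>
        (\<exists>G. small U G \<and> (\<forall>K\<in>G. presentable U r C K) \<and>
           (\<forall>X \<in> Ob C. \<exists>I R D c.
              directed_poset U r I R \<and> cat_functor (poset_cat I R) C D \<and>
              (\<forall>i\<in>I. OMap D i \<in> G) \<and> is_colimit (poset_cat I R) C D X c)))"

section \<open>Multipointed d-spaces\<close>

abbreviation simplex_top :: "nat \<Rightarrow> (nat \<Rightarrow> real) topology" where
  "simplex_top n \<equiv> subtopology (powertop_real UNIV) (standard_simplex n)"

definition delta_generated :: "'a topology \<Rightarrow> bool" where
  "delta_generated X \<longleftrightarrow>
     (\<forall>V \<subseteq> topspace X.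
        openin X V \<longleftrightarrow>
          (\<forall>n \<sigma>. continuous_map (simplex_top n) X \<sigma>
             \<longrightarrow> openin (simplex_top n) {x \<in> standard_simplex n. \<sigma> x \<in> V}))"

text \<open>
  Since a path determines its endpoints, the disjoint union of the sets of paths from \<open>\<alpha>\<close> to \<open>\<beta>\<close>
  is just a set \<open>dpaths\<close> of paths whose endpoints are in \<open>states\<close>. Paths and morphisms are
  represented by functions that are undefined outside their domain, so that equality of
  functions is equality of maps.
\<close>

record 'v mdspace =
  space :: "'v topology"
  states :: "'v set"
  dpaths :: "(real \<Rightarrow> 'v) set"

definition path_concat :: "(real \<Rightarrow> 'a) \<Rightarrow> (real \<Rightarrow> 'a) \<Rightarrow> real \<Rightarrow> 'a" where
  "path_concat \<phi>1 \<phi>2 = (\<lambda>t\<in>{0..1}. if t \<le> 1/2 then \<phi>1 (2 * t) else \<phi>2 (2 * t - 1))"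

definition multipointed_dspace :: "'v mdspace \<Rightarrow> bool" where
  "multipointed_dspace X \<longleftrightarrow>
     delta_generated (space X) \<and>
     states X \<subseteq> topspace (space X) \<and>
     (\<forall>\<phi> \<in> dpaths X. \<phi> \<in> extensional {0..1} \<and> pathin (space X) \<phi> \<and>
        \<phi> 0 \<in> states X \<and> \<phi> 1 \<in> states X) \<and>
     (\<forall>\<phi>1 \<in> dpaths X. \<forall>\<phi>2 \<in> dpaths X. \<phi>1 1 = \<phi>2 0 \<longrightarrow> path_concat \<phi>1 \<phi>2 \<in> dpaths X) \<and>
     (\<forall>\<phi> \<in> dpaths X. \<forall>\<psi> :: real \<Rightarrow> real.
        \<psi> \<in> {0..1} \<rightarrow> {0..1} \<and> continuous_on {0..1} \<psi> \<and> strict_mono_on {0..1} \<psi> \<and>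
        \<psi> 0 = 0 \<and> \<psi> 1 = 1
        \<longrightarrow> compose {0..1} \<phi> \<psi> \<in> dpaths X)"

definition mdspace_hom :: "'v mdspace \<Rightarrow> 'v mdspace \<Rightarrow> ('v \<Rightarrow> 'v) set" where
  "mdspace_hom X Y =
     {f \<in> extensional (topspace (space X)).
        continuous_map (space X) (space Y) f \<and> f ` states X \<subseteq> states Y \<and>
        (\<forall>\<phi> \<in> dpaths X. compose {0..1} f \<phi> \<in> dpaths Y)}"

definition MdTop :: "'v itself \<Rightarrow> ('v mdspace, 'v \<Rightarrow> 'v) cat" where
  "MdTop U =
     \<lparr>Ob = {X. multipointed_dspace X \<and> small U (topspace (space X))},
      Hom = mdspace_hom,
      Cmp = (\<lambda>X Y Z g f. compose (topspace (space X)) g f),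
      Idn = (\<lambda>X. \<lambda>x \<in> topspace (space X). x)\<rparr>"

definition underlying_set :: "('v mdspace, 'v \<Rightarrow> 'v, 'v set, 'v \<Rightarrow> 'v) functr" where
  "underlying_set = \<lparr>OMap = (\<lambda>X. topspace (space X)), HMap = (\<lambda>X Y f. f)\<rparr>"

end

theory Submission
  imports Defs
begin

text \<open>
  A source of maps into multipointed d-spaces has an initial lift: the topology is final for those
  maps from simplices whose composites with the source are continuous, and states and paths are
  pulled back.

  Dually, a colimit is the colimit of the underlying sets with the final topology, the images of the
  states, and the closure of the images of the paths. For local presentability take \<open>\<lambda>\<close> to be the
  successor of \<open>2\<close> to the power of the continuum. In a \<open>\<lambda>\<close>-directed colimit the images of the paths
  are already closed, and a map from a simplex to the colimit is continuous only if it is continuous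
  at some stage: a simplex has fewer than \<open>\<lambda>\<close> subsets, so otherwise one non-open subset would be the
  preimage of an open set at every stage, and then also of an open set of the colimit. An object with
  fewer than \<open>\<lambda>\<close> points has fewer than \<open>\<lambda>\<close> states, paths and simplices, hence it is
  \<open>\<lambda>\<close>-presentable. Finally, paths and simplices have fewer than \<open>\<lambda>\<close> points, so every object is the
  \<open>\<lambda>\<close>-directed colimit of its subobjects with fewer than \<open>\<lambda>\<close> points.
\<close>

section \<open>Final topologies and simplices\<close>

text \<open>Lifting the points of a simplex to one stage only needs directedness for sets of
  continuum size; the obstacle is continuity. A stage can have far more open sets than the cardinal,
  so they cannot be treated one at a time. Continuity sees them only through their preimages, which
  are subsets of the simplex, and of these there are at most \<open>2\<close> to the power of the
  continuum. This power, \<open>kappa\<close>, fixes the cardinal. It satisfies \<open>kappa\<close>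
  to the continuum \<open>= kappa\<close>, which bounds the simplices and paths of a space with
  \<open>kappa\<close> points, and its successor is regular. \<Delta>-generation enters a second
  time when the open set of the colimit is built: its openness at a stage is tested on simplices,
  whose points are again few, so membership of all of them is decided at one later stage. Since the
  universe is a type, quotients and families of subsets have to be moved back into it by
  injections.\<close>

definition final_topology ::
  "'a set \<Rightarrow> 'i set \<Rightarrow> ('i \<Rightarrow> 'b topology) \<Rightarrow> ('i \<Rightarrow> 'b \<Rightarrow> 'a) \<Rightarrow> 'a topology" where
  "final_topology E I T f =
     topology (\<lambda>V. V \<subseteq> E \<and> (\<forall>i\<in>I. openin (T i) {x \<in> topspace (T i). f i x \<in> V}))"

lemma openin_final_topology:
  "openin (final_topology E I T f) V \<longleftrightarrow>
     V \<subseteq> E \<and> (\<forall>i\<in>I. openin (T i) {x \<in> topspace (T i). f i x \<in> V})"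
proof -
  have inter: "openin (T i) {x \<in> topspace (T i). f i x \<in> V \<inter> W}"
    if "openin (T i) {x \<in> topspace (T i). f i x \<in> V}"
      "openin (T i) {x \<in> topspace (T i). f i x \<in> W}" for i V W
  proof -
    have "{x \<in> topspace (T i). f i x \<in> V \<inter> W}
        = {x \<in> topspace (T i). f i x \<in> V} \<inter> {x \<in> topspace (T i). f i x \<in> W}"
      by auto
    then show ?thesis
      using that by (simp add: openin_Int)
  qed
  have union: "openin (T i) {x \<in> topspace (T i). f i x \<in> \<Union>K}"
    if "\<And>V. V \<in> K \<Longrightarrow> openin (T i) {x \<in> topspace (T i). f i x \<in> V}" for i K
  proof -
    have "{x \<in> topspace (T i). f i x \<in> \<Union>K} = (\<Union>V\<in>K. {x \<in> topspace (T i). f i x \<in> V})"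
      by auto
    then show ?thesis
      using that by (metis (no_types, lifting) imageE openin_Union)
  qed
  have "istopology (\<lambda>V. V \<subseteq> E \<and> (\<forall>i\<in>I. openin (T i) {x \<in> topspace (T i). f i x \<in> V}))"
    unfolding istopology_def
    by (intro conjI allI impI ballI Sup_least inter union) auto
  then show ?thesis
    unfolding final_topology_def by simp
qed

lemma topspace_final_topology:
  assumes "\<And>i. i \<in> I \<Longrightarrow> f i \<in> topspace (T i) \<rightarrow> E"
  shows "topspace (final_topology E I T f) = E"
proof
  show "topspace (final_topology E I T f) \<subseteq> E"
    by (meson openin_final_topology openin_topspace)
  have "{x \<in> topspace (T i). f i x \<in> E} = topspace (T i)" if "i \<in> I" for i
    using assms[OF that] by auto
  then have "openin (final_topology E I T f) E"
    by (simp add: openin_final_topology)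
  then show "E \<subseteq> topspace (final_topology E I T f)"
    by (rule openin_subset)
qed

lemma continuous_map_into_final_topology:
  assumes "\<And>i. i \<in> I \<Longrightarrow> f i \<in> topspace (T i) \<rightarrow> E" "i \<in> I"
  shows "continuous_map (T i) (final_topology E I T f) (f i)"
  using assms
  by (auto simp: continuous_map_def topspace_final_topology openin_final_topology)

lemma continuous_map_from_final_topology:
  assumes "\<And>i. i \<in> I \<Longrightarrow> f i \<in> topspace (T i) \<rightarrow> E" "g \<in> E \<rightarrow> topspace Y"
    "\<And>i. i \<in> I \<Longrightarrow> continuous_map (T i) Y (\<lambda>x. g (f i x))"
  shows "continuous_map (final_topology E I T f) Y g"
  unfolding continuous_map_def
proof (intro conjI allI impI)
  have top: "topspace (final_topology E I T f) = E"
    by (rule topspace_final_topology) (use assms in auto)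
  show "g \<in> topspace (final_topology E I T f) \<rightarrow> topspace Y"
    using assms top by simp
  fix V
  assume V: "openin Y V"
  have "openin (T i) {x \<in> topspace (T i). f i x \<in> {x \<in> E. g x \<in> V}}" if i: "i \<in> I" for i
  proof -
    have "{x \<in> topspace (T i). f i x \<in> {x \<in> E. g x \<in> V}} = {x \<in> topspace (T i). g (f i x) \<in> V}"
      using assms(1)[OF i] by auto
    then show ?thesis
      using assms(3)[OF i] V unfolding continuous_map_def by auto
  qed
  then show "openin (final_topology E I T f) {x \<in> topspace (final_topology E I T f). g x \<in> V}"
    unfolding top openin_final_topology by blast
qed

lemma topspace_simplex_top [simp]: "topspace (simplex_top n) = standard_simplex n"
  by simp

section \<open>Testing openness and continuity on simplices\<close>

lemma delta_generated_openI:
  assumes "delta_generated X" "V \<subseteq> topspace X"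
    "\<And>n \<sigma>. continuous_map (simplex_top n) X \<sigma>
       \<Longrightarrow> openin (simplex_top n) {x \<in> standard_simplex n. \<sigma> x \<in> V}"
  shows "openin X V"
  using assms unfolding delta_generated_def by blast

lemma delta_generatedI:
  assumes "\<And>V. \<lbrakk>V \<subseteq> topspace X; \<And>n \<sigma>. continuous_map (simplex_top n) X \<sigma>
       \<Longrightarrow> openin (simplex_top n) {x \<in> standard_simplex n. \<sigma> x \<in> V}\<rbrakk> \<Longrightarrow> openin X V"
  shows "delta_generated X"
  unfolding delta_generated_def
proof (intro allI impI iffI)
  fix V n \<sigma>
  assume "openin X V" "continuous_map (simplex_top n) X \<sigma>"
  then show "openin (simplex_top n) {x \<in> standard_simplex n. \<sigma> x \<in> V}"
    using openin_continuous_map_preimage[of "simplex_top n" X \<sigma> V] by simp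
qed (use assms in blast)

text \<open>The identity is one of the test maps.\<close>

lemma delta_generated_simplex_top: "delta_generated (simplex_top n)"
proof (rule delta_generatedI)
  fix V
  assume V: "V \<subseteq> topspace (simplex_top n)"
    and op: "\<And>m \<sigma>. continuous_map (simplex_top m) (simplex_top n) \<sigma>
       \<Longrightarrow> openin (simplex_top m) {x \<in> standard_simplex m. \<sigma> x \<in> V}"
  have "openin (simplex_top n) {x \<in> standard_simplex n. x \<in> V}"
    using op[OF continuous_map_id] by simp
  moreover have "{x \<in> standard_simplex n. x \<in> V} = V"
    using V by auto
  ultimately show "openin (simplex_top n) V"
    by simp
qed

text \<open>Among the simplices of the final topology are those that factor through some
  \<open>f i\<close>, and these alone detect openness in the \<Delta>-generated space
  \<open>T i\<close>.\<close>

lemma delta_generated_final_topology: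
  assumes "\<And>i. i \<in> I \<Longrightarrow> f i \<in> topspace (T i) \<rightarrow> E" "\<And>i. i \<in> I \<Longrightarrow> delta_generated (T i)"
  shows "delta_generated (final_topology E I T f)"
proof (rule delta_generatedI)
  have top: "topspace (final_topology E I T f) = E"
    by (rule topspace_final_topology) (use assms in auto)
  fix V
  assume V: "V \<subseteq> topspace (final_topology E I T f)"
    and op: "\<And>n \<sigma>. continuous_map (simplex_top n) (final_topology E I T f) \<sigma>
       \<Longrightarrow> openin (simplex_top n) {x \<in> standard_simplex n. \<sigma> x \<in> V}"
  have "openin (T i) {x \<in> topspace (T i). f i x \<in> V}" if i: "i \<in> I" for i
  proof (rule delta_generated_openI[OF assms(2)[OF i]])
    fix n \<sigma>
    assume \<sigma>: "continuous_map (simplex_top n) (T i) \<sigma>"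
    have "continuous_map (simplex_top n) (final_topology E I T f) (f i \<circ> \<sigma>)"
      by (rule continuous_map_compose[OF \<sigma>])
        (rule continuous_map_into_final_topology, use assms i in auto)
    from op[OF this]
    have "openin (simplex_top n) {x \<in> standard_simplex n. f i (\<sigma> x) \<in> V}"
      by simp
    moreover have "{x \<in> standard_simplex n. \<sigma> x \<in> {x \<in> topspace (T i). f i x \<in> V}}
        = {x \<in> standard_simplex n. f i (\<sigma> x) \<in> V}"
      using continuous_map_funspace[OF \<sigma>] by auto
    ultimately show
      "openin (simplex_top n) {x \<in> standard_simplex n. \<sigma> x \<in> {x \<in> topspace (T i). f i x \<in> V}}"
      by simp
  qed auto
  then show "openin (final_topology E I T f) V"
    using V unfolding top openin_final_topology by blast
qed

text \<open>This splits continuity into one condition per simplex. Counting these conditions is what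
  later bounds the size of a presentable object.\<close>

lemma continuous_map_from_delta_generated:
  assumes "delta_generated X" "g \<in> topspace X \<rightarrow> topspace Y"
    "\<And>n \<sigma>. continuous_map (simplex_top n) X \<sigma> \<Longrightarrow> continuous_map (simplex_top n) Y (\<lambda>x. g (\<sigma> x))"
  shows "continuous_map X Y g"
  unfolding continuous_map_def
proof (intro conjI allI impI)
  fix V
  assume V: "openin Y V"
  show "openin X {x \<in> topspace X. g x \<in> V}"
  proof (rule delta_generated_openI[OF assms(1)])
    fix n \<sigma>
    assume \<sigma>: "continuous_map (simplex_top n) X \<sigma>"
    have "openin (simplex_top n) {x \<in> standard_simplex n. g (\<sigma> x) \<in> V}"
      using openin_continuous_map_preimage[OF assms(3)[OF \<sigma>] V] by simp
    moreover have "{x \<in> standard_simplex n. \<sigma> x \<in> {x \<in> topspace X. g x \<in> V}}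
        = {x \<in> standard_simplex n. g (\<sigma> x) \<in> V}"
      using continuous_map_funspace[OF \<sigma>] by auto
    ultimately show "openin (simplex_top n) {x \<in> standard_simplex n. \<sigma> x \<in> {x \<in> topspace X. g x \<in> V}}"
      by simp
  qed auto
qed (use assms in auto)

lemma continuous_map_simplex_1_to_interval:
  "continuous_map (simplex_top 1) (top_of_set {0..1}) (\<lambda>x. x 1)"
proof -
  have "continuous_map (powertop_real UNIV) euclideanreal (\<lambda>x. x (1::nat))"
    by (rule continuous_map_product_projection) simp
  then show ?thesis
    by (auto simp: continuous_map_in_subtopology continuous_map_from_subtopology standard_simplex_def)
qed

lemma continuous_map_interval_to_simplex_1:
  "continuous_map (top_of_set {0..1}) (simplex_top 1)
     (\<lambda>t i. if i = 0 then 1 - t else if i = 1 then t else 0)"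
proof -
  have "continuous_map (top_of_set {0..1::real}) euclideanreal
      (\<lambda>t. if i = 0 then 1 - t else if i = 1 then t else 0)" for i :: nat
    by (cases "i = 0"; cases "i = 1") (auto intro!: continuous_intros)
  then show ?thesis
    by (auto simp: continuous_map_in_subtopology continuous_map_componentwise standard_simplex_def)
qed

text \<open>Coordinate 1 is a homeomorphism from the 1-simplex to the interval. Paths can therefore
  be treated by statements about simplices.\<close>

lemma pathin_iff_simplex:
  "pathin X \<phi> \<longleftrightarrow> continuous_map (simplex_top 1) X (\<lambda>x. \<phi> (x 1))"
proof
  assume "pathin X \<phi>"
  from continuous_map_compose[OF continuous_map_simplex_1_to_interval this[unfolded pathin_def]]
  show "continuous_map (simplex_top 1) X (\<lambda>x. \<phi> (x 1))"
    by (simp add: o_def)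
next
  assume "continuous_map (simplex_top 1) X (\<lambda>x. \<phi> (x 1))"
  from continuous_map_compose[OF continuous_map_interval_to_simplex_1 this]
  show "pathin X \<phi>"
    by (simp add: o_def pathin_def)
qed

section \<open>Multipointed d-spaces\<close>

definition reparam :: "(real \<Rightarrow> real) \<Rightarrow> bool" where
  "reparam \<psi> \<longleftrightarrow> \<psi> \<in> {0..1} \<rightarrow> {0..1} \<and> continuous_on {0..1} \<psi> \<and> strict_mono_on {0..1} \<psi> \<and>
     \<psi> 0 = 0 \<and> \<psi> 1 = 1"

text \<open>The conditions on a path that involve only the topology and the states. They survive
  concatenation, reparametrization and images, so a set of paths may be generated freely from paths
  satisfying them.\<close>

definition state_path :: "'a topology \<Rightarrow> 'a set \<Rightarrow> (real \<Rightarrow> 'a) \<Rightarrow> bool" where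
  "state_path X S \<phi> \<longleftrightarrow> \<phi> \<in> extensional {0..1} \<and> pathin X \<phi> \<and> \<phi> 0 \<in> S \<and> \<phi> 1 \<in> S"

lemma multipointed_dspace_iff:
  "multipointed_dspace X \<longleftrightarrow>
     delta_generated (space X) \<and> states X \<subseteq> topspace (space X) \<and>
     (\<forall>\<phi> \<in> dpaths X. state_path (space X) (states X) \<phi>) \<and>
     (\<forall>\<phi>1 \<in> dpaths X. \<forall>\<phi>2 \<in> dpaths X. \<phi>1 1 = \<phi>2 0 \<longrightarrow> path_concat \<phi>1 \<phi>2 \<in> dpaths X) \<and>
     (\<forall>\<phi> \<in> dpaths X. \<forall>\<psi>. reparam \<psi> \<longrightarrow> compose {0..1} \<phi> \<psi> \<in> dpaths X)"
  unfolding multipointed_dspace_def state_path_def reparam_def by blast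

text \<open>The two closed halves of the interval meet only at 1/2, where the pieces take the values
  \<open>\<phi>1 1\<close> and \<open>\<phi>2 0\<close>.\<close>

lemma state_path_concat:
  assumes "state_path X S \<phi>1" "state_path X S \<phi>2" "\<phi>1 1 = \<phi>2 0"
  shows "state_path X S (path_concat \<phi>1 \<phi>2)"
proof -
  let ?I = "top_of_set {0..1::real}"
  have \<phi>: "continuous_map ?I X \<phi>1" "continuous_map ?I X \<phi>2"
    using assms(1,2) by (simp_all add: state_path_def pathin_def)
  have halves: "subtopology ?I {t \<in> topspace ?I. t \<le> 1/2} = top_of_set {0..1/2}"
    "subtopology ?I {t \<in> topspace ?I. 1/2 \<le> t} = top_of_set {1/2..1}"
    by (auto simp: subtopology_subtopology intro!: arg_cong[where f = "subtopology euclideanreal"])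
  have "continuous_map (top_of_set {0..1/2}) ?I (\<lambda>t. 2 * t)"
    by (simp add: continuous_map_in_subtopology image_subset_iff continuous_on_mult_left)
  from continuous_map_compose[OF this \<phi>(1)]
  have left: "continuous_map (top_of_set {0..1/2}) X (\<lambda>t. \<phi>1 (2 * t))"
    by (simp only: o_def)
  have "continuous_map (top_of_set {1/2..1}) ?I (\<lambda>t. 2 * t - 1)"
    by (simp add: continuous_map_in_subtopology image_subset_iff continuous_on_mult_left continuous_on_diff)
  from continuous_map_compose[OF this \<phi>(2)]
  have right: "continuous_map (top_of_set {1/2..1}) X (\<lambda>t. \<phi>2 (2 * t - 1))"
    by (simp only: o_def)
  have "continuous_map ?I X (\<lambda>t. if t \<le> 1/2 then \<phi>1 (2 * t) else \<phi>2 (2 * t - 1))"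
  proof (rule continuous_map_cases_le)
    show "\<phi>1 (2 * t) = \<phi>2 (2 * t - 1)" if "t = 1/2" for t
      using assms(3) unfolding that by simp
  qed (simp_all only: halves left right, simp_all)
  then have "continuous_map ?I X (path_concat \<phi>1 \<phi>2)"
    by (rule continuous_map_eq) (auto simp: path_concat_def)
  then show ?thesis
    using assms by (auto simp: state_path_def pathin_def path_concat_def)
qed

lemma state_path_reparam:
  assumes "state_path X S \<phi>" "reparam \<psi>"
  shows "state_path X S (compose {0..1} \<phi> \<psi>)"
proof -
  have "continuous_map (top_of_set {0..1}) (top_of_set {0..1}) \<psi>"
    using assms by (simp add: reparam_def continuous_map_in_subtopology image_subset_iff_funcset)
  then have "continuous_map (top_of_set {0..1}) X (\<phi> \<circ> \<psi>)"
    by (rule continuous_map_compose) (use assms in \<open>simp add: state_path_def pathin_def\<close>)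
  then have "continuous_map (top_of_set {0..1}) X (compose {0..1} \<phi> \<psi>)"
    by (rule continuous_map_eq) (auto simp: compose_def)
  then show ?thesis
    using assms by (auto simp: state_path_def pathin_def compose_def reparam_def)
qed

lemma state_path_image:
  assumes "state_path X S \<phi>" "continuous_map X Y f" "f ` S \<subseteq> S'"
  shows "state_path Y S' (compose {0..1} f \<phi>)"
proof -
  have "continuous_map (top_of_set {0..1}) Y (f \<circ> \<phi>)"
    using assms by (auto simp: state_path_def pathin_def intro: continuous_map_compose)
  then have "continuous_map (top_of_set {0..1}) Y (compose {0..1} f \<phi>)"
    by (rule continuous_map_eq) (auto simp: compose_def)
  then show ?thesis
    using assms by (auto simp: state_path_def pathin_def compose_def)
qed

lemma state_path_in_topspace:
  assumes "state_path X S \<phi>"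
  shows "\<phi> \<in> {0..1} \<rightarrow> topspace X"
  using assms continuous_map_funspace[of "top_of_set {0..1}" X \<phi>]
  by (auto simp: state_path_def pathin_def)

lemma compose_path_concat:
  "compose {0..1} f (path_concat \<phi>1 \<phi>2) = path_concat (compose {0..1} f \<phi>1) (compose {0..1} f \<phi>2)"
  by (rule ext) (auto simp: compose_def path_concat_def restrict_def)

lemma compose_reparam:
  assumes "reparam \<psi>"
  shows "compose {0..1} f (compose {0..1} \<phi> \<psi>) = compose {0..1} (compose {0..1} f \<phi>) \<psi>"
  using assms unfolding reparam_def by (intro ext) (auto simp: compose_def restrict_def Pi_iff)

lemma compose_compose:
  assumes "\<phi> \<in> S \<rightarrow> T"
  shows "compose S g (compose S f \<phi>) = compose S (compose T g f) \<phi>"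
  using assms by (auto simp: compose_def restrict_def fun_eq_iff)

lemma compose_eqI:
  assumes "\<And>x. x \<in> S \<Longrightarrow> g (f x) = g' (f' x)"
  shows "compose S g f = compose S g' f'"
  using assms by (auto simp: compose_def restrict_def fun_eq_iff)

lemma mdspace_homI:
  assumes "f \<in> extensional (topspace (space X))" "continuous_map (space X) (space Y) f"
    "f ` states X \<subseteq> states Y" "\<And>\<phi>. \<phi> \<in> dpaths X \<Longrightarrow> compose {0..1} f \<phi> \<in> dpaths Y"
  shows "f \<in> mdspace_hom X Y"
  using assms by (simp add: mdspace_hom_def)

lemma mdspace_homD:
  assumes "f \<in> mdspace_hom X Y"
  shows "f \<in> extensional (topspace (space X))" "continuous_map (space X) (space Y) f"
    "\<And>x. x \<in> states X \<Longrightarrow> f x \<in> states Y" "\<And>\<phi>. \<phi> \<in> dpaths X \<Longrightarrow> compose {0..1} f \<phi> \<in> dpaths Y"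
    "f \<in> topspace (space X) \<rightarrow>\<^sub>E topspace (space Y)"
    "\<And>x. x \<in> topspace (space X) \<Longrightarrow> f x \<in> topspace (space Y)"
  using assms continuous_map_funspace[of "space X" "space Y" f]
  by (auto simp: mdspace_hom_def PiE_def)

lemma multipointed_dspaceD:
  assumes "multipointed_dspace X"
  shows "delta_generated (space X)" "states X \<subseteq> topspace (space X)"
    "\<And>\<phi>. \<phi> \<in> dpaths X \<Longrightarrow> state_path (space X) (states X) \<phi>"
    "\<And>\<phi>1 \<phi>2. \<lbrakk>\<phi>1 \<in> dpaths X; \<phi>2 \<in> dpaths X; \<phi>1 1 = \<phi>2 0\<rbrakk> \<Longrightarrow> path_concat \<phi>1 \<phi>2 \<in> dpaths X"
    "\<And>\<phi> \<psi>. \<lbrakk>\<phi> \<in> dpaths X; reparam \<psi>\<rbrakk> \<Longrightarrow> compose {0..1} \<phi> \<psi> \<in> dpaths X"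
    "\<And>\<phi>. \<phi> \<in> dpaths X \<Longrightarrow> \<phi> \<in> {0..1} \<rightarrow> topspace (space X)"
  using assms by (auto simp: multipointed_dspace_iff state_path_in_topspace[unfolded Pi_iff, simplified])

lemma mdspace_hom_compose:
  assumes X: "multipointed_dspace X" and f: "f \<in> mdspace_hom X Y" and g: "g \<in> mdspace_hom Y Z"
  shows "compose (topspace (space X)) g f \<in> mdspace_hom X Z"
proof (rule mdspace_homI)
  show "continuous_map (space X) (space Z) (compose (topspace (space X)) g f)"
    by (rule continuous_map_eq[OF continuous_map_compose[OF mdspace_homD(2)[OF f] mdspace_homD(2)[OF g]]])
      (simp add: compose_def)
  show "compose (topspace (space X)) g f ` states X \<subseteq> states Z"
    using mdspace_homD(3)[OF f] mdspace_homD(3)[OF g] multipointed_dspaceD(2)[OF X]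
    by (auto simp: compose_def)
  fix \<phi>
  assume \<phi>: "\<phi> \<in> dpaths X"
  have "compose {0..1} (compose (topspace (space X)) g f) \<phi> = compose {0..1} g (compose {0..1} f \<phi>)"
    by (rule compose_compose[OF multipointed_dspaceD(6)[OF X \<phi>], symmetric])
  then show "compose {0..1} (compose (topspace (space X)) g f) \<phi> \<in> dpaths Z"
    using \<phi> by (simp add: mdspace_homD(4)[OF f] mdspace_homD(4)[OF g])
qed simp

lemma compose_restrict_path:
  assumes "\<phi> \<in> extensional {0..1}" "\<phi> \<in> {0..1} \<rightarrow> S" "\<And>x. x \<in> S \<Longrightarrow> f x = x"
  shows "compose {0..1} f \<phi> = \<phi>"
  using assms by (auto simp: compose_def restrict_def extensional_def fun_eq_iff Pi_iff)

lemma mdspace_hom_id: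
  assumes "multipointed_dspace X"
  shows "(\<lambda>x \<in> topspace (space X). x) \<in> mdspace_hom X X"
proof (rule mdspace_homI)
  show "continuous_map (space X) (space X) (\<lambda>x \<in> topspace (space X). x)"
    by (rule continuous_map_eq[OF continuous_map_id]) simp
  fix \<phi>
  assume \<phi>: "\<phi> \<in> dpaths X"
  have "compose {0..1} (\<lambda>x \<in> topspace (space X). x) \<phi> = \<phi>"
    by (rule compose_restrict_path[where S = "topspace (space X)"])
      (use multipointed_dspaceD(3,6)[OF assms \<phi>] in \<open>auto simp: state_path_def\<close>)
  then show "compose {0..1} (\<lambda>x \<in> topspace (space X). x) \<phi> \<in> dpaths X"
    using \<phi> by simp
qed (use multipointed_dspaceD(2)[OF assms] in auto)

subsection \<open>Initial structures\<close>

text \<open>The maps are not normalised outside the simplex: different representatives of one map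
  impose the same condition on open sets.\<close>

definition initial_simplices ::
  "'a set \<Rightarrow> 'i set \<Rightarrow> ('i \<Rightarrow> 'a mdspace) \<Rightarrow> ('i \<Rightarrow> 'a \<Rightarrow> 'a) \<Rightarrow> (nat \<times> ((nat \<Rightarrow> real) \<Rightarrow> 'a)) set"
where
  "initial_simplices E I A f =
     {(n, \<sigma>). \<sigma> \<in> standard_simplex n \<rightarrow> E \<and>
        (\<forall>i\<in>I. continuous_map (simplex_top n) (space (A i)) (\<lambda>x. f i (\<sigma> x)))}"

text \<open>
  The \<open>\<Delta>\<close>-generated initial topology is described at once as a final topology. It is finer than the
  initial topology, but has the same continuous maps from simplices.
\<close>

definition initial_mdspace ::
  "'a set \<Rightarrow> 'i set \<Rightarrow> ('i \<Rightarrow> 'a mdspace) \<Rightarrow> ('i \<Rightarrow> 'a \<Rightarrow> 'a) \<Rightarrow> 'a mdspace" where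
  "initial_mdspace E I A f =
     (let T = final_topology E (initial_simplices E I A f) (\<lambda>(n, \<sigma>). simplex_top n) snd;
          S = {x \<in> E. \<forall>i\<in>I. f i x \<in> states (A i)}
      in \<lparr>space = T, states = S,
          dpaths = {\<phi>. state_path T S \<phi> \<and> (\<forall>i\<in>I. compose {0..1} (f i) \<phi> \<in> dpaths (A i))}\<rparr>)"

lemma states_initial_mdspace:
  "states (initial_mdspace E I A f) = {x \<in> E. \<forall>i\<in>I. f i x \<in> states (A i)}"
  by (simp add: initial_mdspace_def Let_def)

lemma dpaths_initial_mdspace:
  "dpaths (initial_mdspace E I A f) =
     {\<phi>. state_path (space (initial_mdspace E I A f)) (states (initial_mdspace E I A f)) \<phi> \<and>
        (\<forall>i\<in>I. compose {0..1} (f i) \<phi> \<in> dpaths (A i))}"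
  by (simp add: initial_mdspace_def Let_def)

lemma space_initial_mdspace:
  "space (initial_mdspace E I A f) =
     final_topology E (initial_simplices E I A f) (\<lambda>(n, \<sigma>). simplex_top n) snd"
  by (simp add: initial_mdspace_def Let_def)

lemma initial_simplices_funcset:
  "s \<in> initial_simplices E I A f \<Longrightarrow> snd s \<in> topspace (case s of (n, \<sigma>) \<Rightarrow> simplex_top n) \<rightarrow> E"
  by (auto simp: initial_simplices_def)

lemma topspace_initial_mdspace [simp]: "topspace (space (initial_mdspace E I A f)) = E"
  unfolding space_initial_mdspace by (rule topspace_final_topology, rule initial_simplices_funcset)

context
  fixes E :: "'a set" and I :: "'i set" and A :: "'i \<Rightarrow> 'a mdspace" and f :: "'i \<Rightarrow> 'a \<Rightarrow> 'a"
  assumes A: "\<And>i. i \<in> I \<Longrightarrow> multipointed_dspace (A i)"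
    and f: "\<And>i. i \<in> I \<Longrightarrow> f i \<in> E \<rightarrow>\<^sub>E topspace (space (A i))"
begin

lemma delta_generated_initial: "delta_generated (space (initial_mdspace E I A f))"
  unfolding space_initial_mdspace
proof (rule delta_generated_final_topology, erule initial_simplices_funcset)
  fix s :: "nat \<times> ((nat \<Rightarrow> real) \<Rightarrow> 'a)"
  show "delta_generated (case s of (n, \<sigma>) \<Rightarrow> simplex_top n)"
    by (cases s) (simp add: delta_generated_simplex_top)
qed

lemma continuous_map_from_initial:
  assumes "i \<in> I"
  shows "continuous_map (space (initial_mdspace E I A f)) (space (A i)) (f i)"
  unfolding space_initial_mdspace
  by (rule continuous_map_from_final_topology, erule initial_simplices_funcset)
    (use f assms in \<open>auto simp: initial_simplices_def\<close>)

lemma continuous_map_simplex_initial: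
  assumes "\<sigma> \<in> standard_simplex n \<rightarrow> E"
    "\<And>i. i \<in> I \<Longrightarrow> continuous_map (simplex_top n) (space (A i)) (\<lambda>x. f i (\<sigma> x))"
  shows "continuous_map (simplex_top n) (space (initial_mdspace E I A f)) \<sigma>"
proof -
  have "(n, \<sigma>) \<in> initial_simplices E I A f"
    using assms by (simp add: initial_simplices_def)
  then have "continuous_map (case (n, \<sigma>) of (n, \<sigma>) \<Rightarrow> simplex_top n)
      (space (initial_mdspace E I A f)) (snd (n, \<sigma>))"
    unfolding space_initial_mdspace
    by (intro continuous_map_into_final_topology initial_simplices_funcset)
  then show ?thesis
    by simp
qed

lemma multipointed_initial: "multipointed_dspace (initial_mdspace E I A f)"
  unfolding multipointed_dspace_iff
proof (intro conjI ballI impI allI delta_generated_initial)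
  show "states (initial_mdspace E I A f) \<subseteq> topspace (space (initial_mdspace E I A f))"
    by (auto simp: states_initial_mdspace)
  fix \<phi>
  assume \<phi>: "\<phi> \<in> dpaths (initial_mdspace E I A f)"
  then show "state_path (space (initial_mdspace E I A f)) (states (initial_mdspace E I A f)) \<phi>"
    by (simp add: dpaths_initial_mdspace)
  show "compose {0..1} \<phi> \<psi> \<in> dpaths (initial_mdspace E I A f)" if "reparam \<psi>" for \<psi>
    using \<phi> that A
    by (auto simp: dpaths_initial_mdspace state_path_reparam compose_reparam multipointed_dspaceD(5))
next
  fix \<phi>1 \<phi>2
  assume *: "\<phi>1 \<in> dpaths (initial_mdspace E I A f)" "\<phi>2 \<in> dpaths (initial_mdspace E I A f)"
    "\<phi>1 1 = \<phi>2 0"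
  have "path_concat (compose {0..1} (f i) \<phi>1) (compose {0..1} (f i) \<phi>2) \<in> dpaths (A i)"
    if "i \<in> I" for i
    by (rule multipointed_dspaceD(4)[OF A[OF that]])
      (use * that in \<open>auto simp: dpaths_initial_mdspace compose_def\<close>)
  then show "path_concat \<phi>1 \<phi>2 \<in> dpaths (initial_mdspace E I A f)"
    using * by (auto simp: dpaths_initial_mdspace state_path_concat compose_path_concat)
qed

lemma initial_mdspace_hom:
  assumes "i \<in> I"
  shows "f i \<in> mdspace_hom (initial_mdspace E I A f) (A i)"
  by (rule mdspace_homI)
    (use assms f[OF assms] continuous_map_from_initial[OF assms] in
      \<open>auto simp: PiE_def states_initial_mdspace dpaths_initial_mdspace\<close>)

text \<open>Since \<open>Z\<close> is \<Delta>-generated, continuity of \<open>k\<close> is tested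
  on simplices of \<open>Z\<close>, and \<open>k\<close> sends each of them to a simplex that
  defines the topology of the target. States and paths are pulled back by definition.\<close>

lemma hom_into_initial_mdspace:
  assumes Z: "multipointed_dspace Z" and k: "k \<in> topspace (space Z) \<rightarrow>\<^sub>E E"
    and fk: "\<And>i. i \<in> I \<Longrightarrow> compose (topspace (space Z)) (f i) k \<in> mdspace_hom Z (A i)"
  shows "k \<in> mdspace_hom Z (initial_mdspace E I A f)"
proof (rule mdspace_homI)
  have comp: "continuous_map (space Z) (space (A i)) (\<lambda>x. f i (k x))" if "i \<in> I" for i
    by (rule continuous_map_eq[OF mdspace_homD(2)[OF fk[OF that]]]) (simp add: compose_def)
  show cont: "continuous_map (space Z) (space (initial_mdspace E I A f)) k"
  proof (rule continuous_map_from_delta_generated[OF multipointed_dspaceD(1)[OF Z]])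
    fix n \<sigma>
    assume \<sigma>: "continuous_map (simplex_top n) (space Z) \<sigma>"
    show "continuous_map (simplex_top n) (space (initial_mdspace E I A f)) (\<lambda>x. k (\<sigma> x))"
    proof (rule continuous_map_simplex_initial)
      show "(\<lambda>x. k (\<sigma> x)) \<in> standard_simplex n \<rightarrow> E"
        using continuous_map_funspace[OF \<sigma>] k by (auto simp: Pi_iff)
      show "continuous_map (simplex_top n) (space (A i)) (\<lambda>x. f i (k (\<sigma> x)))" if "i \<in> I" for i
        using continuous_map_compose[OF \<sigma> comp[OF that]] by (simp add: o_def)
    qed
  qed (use k in auto)
  show st: "k ` states Z \<subseteq> states (initial_mdspace E I A f)"
  proof -
    have "f i (k x) \<in> states (A i)" if "i \<in> I" "x \<in> states Z" for i x
      using mdspace_homD(3)[OF fk[OF that(1)] that(2)] multipointed_dspaceD(2)[OF Z] that(2)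
      by (auto simp: compose_def)
    then show ?thesis
      using k multipointed_dspaceD(2)[OF Z] by (auto simp: states_initial_mdspace)
  qed
  fix \<phi>
  assume \<phi>: "\<phi> \<in> dpaths Z"
  have "compose {0..1} (f i) (compose {0..1} k \<phi>) \<in> dpaths (A i)" if "i \<in> I" for i
    using mdspace_homD(4)[OF fk[OF that] \<phi>]
    unfolding compose_compose[OF multipointed_dspaceD(6)[OF Z \<phi>]] .
  then show "compose {0..1} k \<phi> \<in> dpaths (initial_mdspace E I A f)"
    using state_path_image[OF multipointed_dspaceD(3)[OF Z \<phi>] cont st]
    by (simp add: dpaths_initial_mdspace)
qed (use k in \<open>simp add: PiE_def\<close>)

end

subsection \<open>Final structures\<close>

text \<open>Images of paths from different objects, or of non-composable paths of one object, may
  become composable in the target, so the images have to be closed up.\<close>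

inductive_set path_closure :: "(real \<Rightarrow> 'a) set \<Rightarrow> (real \<Rightarrow> 'a) set" for P where
  base: "\<phi> \<in> P \<Longrightarrow> \<phi> \<in> path_closure P"
| concat: "\<lbrakk>\<phi>1 \<in> path_closure P; \<phi>2 \<in> path_closure P; \<phi>1 1 = \<phi>2 0\<rbrakk>
    \<Longrightarrow> path_concat \<phi>1 \<phi>2 \<in> path_closure P"
| reparam: "\<lbrakk>\<phi> \<in> path_closure P; reparam \<psi>\<rbrakk> \<Longrightarrow> compose {0..1} \<phi> \<psi> \<in> path_closure P"

definition image_dpaths ::
  "'j set \<Rightarrow> ('j \<Rightarrow> 'a mdspace) \<Rightarrow> ('j \<Rightarrow> 'a \<Rightarrow> 'a) \<Rightarrow> (real \<Rightarrow> 'a) set" where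
  "image_dpaths J A c = (\<Union>j\<in>J. compose {0..1} (c j) ` dpaths (A j))"

definition final_mdspace ::
  "'a set \<Rightarrow> 'j set \<Rightarrow> ('j \<Rightarrow> 'a mdspace) \<Rightarrow> ('j \<Rightarrow> 'a \<Rightarrow> 'a) \<Rightarrow> 'a mdspace" where
  "final_mdspace E J A c =
     \<lparr>space = final_topology E J (\<lambda>j. space (A j)) c,
      states = (\<Union>j\<in>J. c j ` states (A j)),
      dpaths = path_closure (image_dpaths J A c)\<rparr>"

context
  fixes E :: "'a set" and J :: "'j set" and A :: "'j \<Rightarrow> 'a mdspace" and c :: "'j \<Rightarrow> 'a \<Rightarrow> 'a"
  assumes A: "\<And>j. j \<in> J \<Longrightarrow> multipointed_dspace (A j)"
    and c: "\<And>j. j \<in> J \<Longrightarrow> c j \<in> topspace (space (A j)) \<rightarrow>\<^sub>E E"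
begin

lemma final_leg_funcset: "j \<in> J \<Longrightarrow> c j \<in> topspace (space (A j)) \<rightarrow> E"
  using c by auto

lemma topspace_final_mdspace: "topspace (space (final_mdspace E J A c)) = E"
  by (simp add: final_mdspace_def topspace_final_topology final_leg_funcset)

lemma continuous_map_into_final:
  "j \<in> J \<Longrightarrow> continuous_map (space (A j)) (space (final_mdspace E J A c)) (c j)"
  using continuous_map_into_final_topology[of J c "\<lambda>j. space (A j)" E j]
  by (simp add: final_mdspace_def final_leg_funcset)

lemma multipointed_final: "multipointed_dspace (final_mdspace E J A c)"
  unfolding multipointed_dspace_iff
proof (intro conjI ballI impI allI)
  show "delta_generated (space (final_mdspace E J A c))"
    by (simp add: final_mdspace_def)
      (intro delta_generated_final_topology final_leg_funcset multipointed_dspaceD(1) A)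
  show "states (final_mdspace E J A c) \<subseteq> topspace (space (final_mdspace E J A c))"
    unfolding topspace_final_mdspace
  proof
    fix y
    assume "y \<in> states (final_mdspace E J A c)"
    then obtain j x where j: "j \<in> J" "x \<in> states (A j)" "y = c j x"
      by (auto simp: final_mdspace_def)
    then show "y \<in> E"
      using funcset_mem[OF final_leg_funcset] multipointed_dspaceD(2)[OF A] by blast
  qed
  show "state_path (space (final_mdspace E J A c)) (states (final_mdspace E J A c)) \<phi>"
    if "\<phi> \<in> dpaths (final_mdspace E J A c)" for \<phi>
  proof -
    from that have "\<phi> \<in> path_closure (image_dpaths J A c)"
      by (simp add: final_mdspace_def)
    then show ?thesis
    proof induction
      case (base \<phi>)
      then obtain j \<phi>' where j: "j \<in> J" "\<phi>' \<in> dpaths (A j)" "\<phi> = compose {0..1} (c j) \<phi>'"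
        by (auto simp: image_dpaths_def)
      have "c j ` states (A j) \<subseteq> states (final_mdspace E J A c)"
        using j(1) by (auto simp: final_mdspace_def)
      then show ?case
        unfolding j(3) by (intro state_path_image[OF multipointed_dspaceD(3)[OF A] continuous_map_into_final] j)
    qed (simp_all add: state_path_concat state_path_reparam)
  qed
qed (simp_all add: final_mdspace_def path_closure.concat path_closure.reparam)

lemma final_mdspace_hom:
  assumes "j \<in> J"
  shows "c j \<in> mdspace_hom (A j) (final_mdspace E J A c)"
  by (rule mdspace_homI[OF _ continuous_map_into_final[OF assms]])
    (use assms c[OF assms] in
      \<open>auto simp: PiE_def final_mdspace_def image_dpaths_def intro: path_closure.base\<close>)

text \<open>Paths are handled by induction on their generation: the hypothesis on \<open>g\<close>
  covers the images, and \<open>Y\<close> is itself closed under concatenation and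
  reparametrization.\<close>

lemma hom_from_final_mdspace:
  assumes Y: "multipointed_dspace Y" and g: "g \<in> E \<rightarrow>\<^sub>E topspace (space Y)"
    and gc: "\<And>j. j \<in> J \<Longrightarrow> compose (topspace (space (A j))) g (c j) \<in> mdspace_hom (A j) Y"
  shows "g \<in> mdspace_hom (final_mdspace E J A c) Y"
proof (rule mdspace_homI)
  show "g \<in> extensional (topspace (space (final_mdspace E J A c)))"
    using g by (simp add: topspace_final_mdspace PiE_def)
  have "continuous_map (space (A j)) (space Y) (\<lambda>x. g (c j x))" if "j \<in> J" for j
    by (rule continuous_map_eq[OF mdspace_homD(2)[OF gc[OF that]]]) (simp add: compose_def)
  then show "continuous_map (space (final_mdspace E J A c)) (space Y) g"
    using g funcset_mem[OF final_leg_funcset]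
    by (auto simp: final_mdspace_def intro!: continuous_map_from_final_topology)
  have "g (c j x) \<in> states Y" if "j \<in> J" "x \<in> states (A j)" for j x
    using mdspace_homD(3)[OF gc[OF that(1)] that(2)] multipointed_dspaceD(2)[OF A[OF that(1)]] that(2)
    by (auto simp: compose_def split: if_splits)
  then show "g ` states (final_mdspace E J A c) \<subseteq> states Y"
    by (auto simp: final_mdspace_def)
  fix \<phi>
  assume "\<phi> \<in> dpaths (final_mdspace E J A c)"
  then have "\<phi> \<in> path_closure (image_dpaths J A c)"
    by (simp add: final_mdspace_def)
  then show "compose {0..1} g \<phi> \<in> dpaths Y"
  proof induction
    case (base \<phi>)
    then obtain j \<phi>' where j: "j \<in> J" "\<phi>' \<in> dpaths (A j)" "\<phi> = compose {0..1} (c j) \<phi>'"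
      by (auto simp: image_dpaths_def)
    then show ?case
      using mdspace_homD(4)[OF gc[OF j(1)] j(2)]
      unfolding j(3) compose_compose[OF multipointed_dspaceD(6)[OF A[OF j(1)] j(2)]] by blast
  next
    case (concat \<phi>1 \<phi>2)
    then show ?case
      unfolding compose_path_concat
      by (intro multipointed_dspaceD(4)[OF Y]) (simp_all add: compose_eq)
  next
    case (reparam \<phi> \<psi>)
    then show ?case
      using multipointed_dspaceD(5)[OF Y] by (simp add: compose_reparam)
  qed
qed

end

section \<open>Cardinalities\<close>

lemma card_of_ordLeqI_inj: "\<lbrakk>inj_on f A; f ` A \<subseteq> B\<rbrakk> \<Longrightarrow> |A| \<le>o |B|"
  by (rule iffD1[OF card_of_ordLeq]) blast

lemma card_of_ordLeqE_inj:
  assumes "|A| \<le>o |B|"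
  obtains f where "inj_on f A" "f ` A \<subseteq> B"
  using iffD2[OF card_of_ordLeq assms] by blast

lemma card_of_Pow_mono:
  assumes "|A| \<le>o |B|"
  shows "|Pow A| \<le>o |Pow B|"
proof -
  obtain f where "inj_on f A" "f ` A \<subseteq> B"
    using card_of_ordLeqE_inj[OF assms] .
  then have "inj_on ((`) f) (Pow A)" "(`) f ` Pow A \<subseteq> Pow B"
    using inj_on_image_Pow[of f A] by blast+
  then show ?thesis
    by (rule card_of_ordLeqI_inj)
qed

text \<open>A function that is undefined outside \<open>A\<close> is determined by its graph over
  \<open>A\<close>.\<close>

lemma card_of_PiE_ordLeq_Pow_Times: "|A \<rightarrow>\<^sub>E B| \<le>o |Pow (A \<times> B)|"
proof (rule card_of_ordLeqI_inj)
  show "inj_on (\<lambda>f. (\<lambda>x. (x, f x)) ` A) (A \<rightarrow>\<^sub>E B)"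
  proof (rule inj_onI)
    fix f g
    assume *: "f \<in> A \<rightarrow>\<^sub>E B" "g \<in> A \<rightarrow>\<^sub>E B" "(\<lambda>x. (x, f x)) ` A = (\<lambda>x. (x, g x)) ` A"
    show "f = g"
    proof (rule PiE_ext[OF *(1,2)])
      fix x
      assume "x \<in> A"
      then have "(x, f x) \<in> (\<lambda>x. (x, g x)) ` A"
        using *(3) by blast
      then show "f x = g x"
        by auto
    qed
  qed
  show "(\<lambda>f. (\<lambda>x. (x, f x)) ` A) ` (A \<rightarrow>\<^sub>E B) \<subseteq> Pow (A \<times> B)"
    by (rule image_subsetI) (auto dest: PiE_mem)
qed

section \<open>Closure properties of small sets\<close>

locale universe =
  fixes U :: "'v itself"
  assumes inaccessible: "strongly_inaccessible |UNIV :: 'v set|"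
begin

lemma small_ordLeq: "\<lbrakk>small U B; |A| \<le>o |B|\<rbrakk> \<Longrightarrow> small U A"
  unfolding small_def by (rule ordLeq_ordLess_trans)

lemma small_subset: "\<lbrakk>small U B; A \<subseteq> B\<rbrakk> \<Longrightarrow> small U A"
  by (rule small_ordLeq[OF _ card_of_mono1])

lemma small_image: "small U A \<Longrightarrow> small U (f ` A)"
  by (rule small_ordLeq[OF _ card_of_image])

text \<open>Regularity of the universe, in the form of stability, keeps small unions of small sets
  small.\<close>

lemma small_UN:
  assumes "small U I" "\<And>i. i \<in> I \<Longrightarrow> small U (A i)"
  shows "small U (\<Union>i\<in>I. A i)"
proof -
  have "natLeq \<le>o |UNIV :: 'v set|"
    using inaccessible by (simp add: strongly_inaccessible_def ordLess_imp_ordLeq)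
  then have "infinite (UNIV :: 'v set)"
    using infinite_iff_natLeq_ordLeq[of "UNIV :: 'v set"] by simp
  moreover have "regularCard |UNIV :: 'v set|"
    using inaccessible by (simp add: strongly_inaccessible_def)
  ultimately have "stable |UNIV :: 'v set|"
    by (intro regularCard_stable) (simp_all add: card_of_Card_order Field_card_of)
  from card_of_UNION_ordLess_infinite[OF this] assms show ?thesis
    unfolding small_def by blast
qed

lemma small_Sigma:
  assumes "small U A" "\<And>x. x \<in> A \<Longrightarrow> small U (B x)"
  shows "small U (Sigma A B)"
proof -
  have "Sigma A B = (\<Union>x\<in>A. Pair x ` B x)"
    by auto
  then show ?thesis
    by (simp only:) (intro small_UN small_image assms)
qed

lemma small_embedding:
  assumes "small U A"
  obtains f :: "'a \<Rightarrow> 'v" where "inj_on f (A :: 'a set)"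
proof -
  have "|A| \<le>o |UNIV :: 'v set|"
    using assms unfolding small_def by (rule ordLess_imp_ordLeq)
  then show ?thesis
    using that by (rule card_of_ordLeqE_inj)
qed

text \<open>Inaccessibility speaks about subsets of \<open>'v\<close>, so a set over another type is
  injected into \<open>'v\<close> before its power set is taken.\<close>

lemma small_Pow:
  assumes "small U A"
  shows "small U (Pow A)"
proof -
  obtain f :: "'a \<Rightarrow> 'v" where f: "inj_on f A"
    using small_embedding[OF assms] .
  have "small U (Pow (f ` A))"
    using small_image[OF assms, of f] inaccessible
    by (simp add: strongly_inaccessible_def small_def Field_card_of)
  moreover have "|A| \<le>o |f ` A|"
    using f by (rule card_of_ordLeqI_inj) simp
  ultimately show ?thesis
    using small_ordLeq[OF _ card_of_Pow_mono] by blast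
qed

lemma small_PiE:
  assumes "small U A" "small U B"
  shows "small U (A \<rightarrow>\<^sub>E B)"
  by (rule small_ordLeq[OF small_Pow[OF small_Sigma] card_of_PiE_ordLeq_Pow_Times]) (use assms in auto)

lemma small_nat: "small U (UNIV :: nat set)"
proof -
  have "natLeq <o |UNIV :: 'v set|"
    using inaccessible by (simp add: strongly_inaccessible_def)
  then show ?thesis
    unfolding small_def by (rule ordIso_ordLess_trans[OF card_of_nat])
qed

text \<open>Dedekind cuts: a real is determined by the rationals below it, and \<open>to_nat\<close>
  turns this set of rationals into a set of natural numbers.\<close>

lemma small_real: "small U (UNIV :: real set)"
proof (rule small_ordLeq)
  show "small U (Pow (UNIV :: nat set))"
    using small_nat by (rule small_Pow)
  have less: "to_nat ` {q. real_of_rat q < r} \<noteq> to_nat ` {q. real_of_rat q < s}" if rs: "r < s" for r s :: real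
  proof -
    obtain q where "r < real_of_rat q" "real_of_rat q < s"
      using of_rat_dense[OF rs] by blast
    then have "q \<notin> {q. real_of_rat q < r}" "q \<in> {q. real_of_rat q < s}"
      by simp_all
    then have "{q. real_of_rat q < r} \<noteq> {q. real_of_rat q < s}"
      by blast
    then show ?thesis
      by (simp add: inj_image_eq_iff[OF inj_to_nat])
  qed
  have "inj (\<lambda>r :: real. to_nat ` {q. real_of_rat q < r})"
    by (rule linorder_injI) (rule less)
  then show "|UNIV :: real set| \<le>o |Pow (UNIV :: nat set)|"
    by (rule card_of_ordLeqI_inj) simp
qed

lemma small_nat_real: "small U (UNIV :: (nat \<Rightarrow> real) set)"
  using small_PiE[OF small_nat small_real] by simp

end

subsection \<open>The cardinal of presentability\<close>

text \<open>
  Simplices and intervals have at most as many points as \<^typ>\<open>nat \<Rightarrow> real\<close>. Hence a set with at most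
  as many elements as \<^typ>\<open>(nat \<Rightarrow> real) set\<close> has no more maps from a simplex into it, and no
  more than that many subsets of a simplex have to be considered.
\<close>

abbreviation kappa :: "(nat \<Rightarrow> real) set rel" where
  "kappa \<equiv> |UNIV :: (nat \<Rightarrow> real) set set|"

text \<open>Phrased with \<open>kappa\<close> rather than its successor, so that counting does not
  involve the universe; \<open>ordLess_pres_card\<close> connects the two.\<close>

definition few :: "'a set \<Rightarrow> bool" where
  "few A \<longleftrightarrow> |A| \<le>o kappa"

text \<open>The successor of \<open>kappa\<close> is a relation over a fixed type of sets, whereas
  local presentability asks for a cardinal on \<open>'v\<close>. Hence a copy of it inside
  \<open>'v\<close> is chosen.\<close>

definition pres_card :: "'v itself \<Rightarrow> 'v rel" where
  "pres_card U = |SOME B :: 'v set. |B| =o cardSuc kappa|"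

lemma few_ordLeq: "\<lbrakk>few B; |A| \<le>o |B|\<rbrakk> \<Longrightarrow> few A"
  unfolding few_def by (rule ordLeq_transitive)

lemma few_subset: "\<lbrakk>few B; A \<subseteq> B\<rbrakk> \<Longrightarrow> few A"
  by (rule few_ordLeq[OF _ card_of_mono1])

lemma few_image: "few A \<Longrightarrow> few (f ` A)"
  by (rule few_ordLeq[OF _ card_of_image])

lemma infinite_kappa: "infinite (UNIV :: (nat \<Rightarrow> real) set set)"
proof -
  have "infinite (UNIV :: (nat \<Rightarrow> real) set)"
    by (simp add: finite_UNIV_fun infinite_UNIV_char_0)
  then show ?thesis
    by (simp add: Finite_Set.finite_set)
qed

lemma few_UN: "\<lbrakk>few I; \<And>i. i \<in> I \<Longrightarrow> few (A i)\<rbrakk> \<Longrightarrow> few (\<Union>i\<in>I. A i)"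
  unfolding few_def by (rule card_of_UNION_ordLeq_infinite[OF infinite_kappa]) simp_all

lemma few_Sigma:
  assumes "few A" "\<And>x. x \<in> A \<Longrightarrow> few (B x)"
  shows "few (Sigma A B)"
proof -
  have "Sigma A B = (\<Union>x\<in>A. Pair x ` B x)"
    by auto
  then show ?thesis
    by (simp only:) (intro few_UN few_image assms)
qed

lemma few_Un: "\<lbrakk>few A; few B\<rbrakk> \<Longrightarrow> few (A \<union> B)"
  unfolding few_def
  by (rule Un_Cinfinite_bound) (simp_all add: cinfinite_def Field_card_of infinite_kappa card_of_Card_order)

lemma few_Pow_nat_real: "few (UNIV :: (nat \<Rightarrow> real) set set)"
  by (simp add: few_def card_of_refl ordIso_imp_ordLeq)

lemma few_nat_real: "few (A :: (nat \<Rightarrow> real) set)"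
  by (rule few_ordLeq[OF few_Pow_nat_real], rule card_of_ordLeqI_inj[of "\<lambda>x. {x}"]) auto

lemma few_nat: "few (UNIV :: nat set)"
  by (rule few_ordLeq[OF few_nat_real[of UNIV]], rule card_of_ordLeqI_inj[of "\<lambda>n k. real n"])
    (auto simp: inj_on_def fun_eq_iff)

lemma few_finite:
  assumes "finite A"
  shows "few A"
proof -
  obtain f :: "_ \<Rightarrow> nat" where "inj_on f A"
    using finite_imp_inj_to_nat_seg[OF assms] by auto
  from card_of_ordLeqI_inj[OF this subset_UNIV] show ?thesis
    by (rule few_ordLeq[OF few_nat])
qed

lemma continuum_real: "|A :: real set| \<le>o |UNIV :: (nat \<Rightarrow> real) set|"
  by (rule card_of_ordLeqI_inj[of "\<lambda>x k. x"]) (auto simp: inj_on_def fun_eq_iff)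

lemma continuum_few: "|A| \<le>o |UNIV :: (nat \<Rightarrow> real) set| \<Longrightarrow> few A"
  by (rule few_ordLeq[OF few_nat_real[of UNIV]])

text \<open>With c the continuum, (2^c)^c = 2^(c * c) = 2^c.\<close>

lemma few_PiE:
  fixes A :: "'a set" and B :: "'b set"
  assumes "|A| \<le>o |UNIV :: (nat \<Rightarrow> real) set|" "few B"
  shows "few (A \<rightarrow>\<^sub>E B)"
proof -
  obtain a :: "'a \<Rightarrow> nat \<Rightarrow> real" where a: "inj_on a A"
    using card_of_ordLeqE_inj[OF assms(1)] .
  obtain b :: "'b \<Rightarrow> (nat \<Rightarrow> real) set" where b: "inj_on b B"
    using card_of_ordLeqE_inj[OF assms(2)[unfolded few_def]] .
  have "infinite (UNIV :: (nat \<Rightarrow> real) set)"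
    by (simp add: finite_UNIV_fun infinite_UNIV_char_0)
  then have "|(UNIV :: (nat \<Rightarrow> real) set) \<times> (UNIV :: (nat \<Rightarrow> real) set)| \<le>o |UNIV :: (nat \<Rightarrow> real) set|"
    by (rule ordIso_imp_ordLeq[OF card_of_Times_same_infinite])
  from card_of_Pow_mono[OF this] have "few (UNIV :: ((nat \<Rightarrow> real) \<times> (nat \<Rightarrow> real)) set set)"
    by (simp add: few_def)
  moreover have "|A \<rightarrow>\<^sub>E B| \<le>o |UNIV :: ((nat \<Rightarrow> real) \<times> (nat \<Rightarrow> real)) set set|"
  proof (rule card_of_ordLeqI_inj)
    \<comment> \<open>A function is coded by a subset of a product of two continua: its section over
      the code \<open>a x\<close> is the set \<open>b (f x)\<close>, as \<open>sect\<close>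
      records.\<close>
    let ?g = "\<lambda>f. Sigma (a ` A) (\<lambda>t. b (f (inv_into A a t)))"
    have sect: "{y. (a x, y) \<in> ?g f} = b (f x)" if "x \<in> A" for f x
      using that a by auto
    show "inj_on ?g (A \<rightarrow>\<^sub>E B)"
    proof (rule inj_onI)
      fix f g
      assume *: "f \<in> A \<rightarrow>\<^sub>E B" "g \<in> A \<rightarrow>\<^sub>E B" "?g f = ?g g"
      show "f = g"
      proof (rule PiE_ext[OF *(1,2)])
        fix x
        assume x: "x \<in> A"
        have "b (f x) = b (g x)"
          using sect[OF x, of f] sect[OF x, of g] *(3) by simp
        then show "f x = g x"
          using b x * by (auto dest: inj_onD)
      qed
    qed
  qed simp
  ultimately show ?thesis
    by (rule few_ordLeq)
qed

context universe
begin

text \<open>The successor of \<open>kappa\<close> is at most the power set of \<open>kappa\<close>,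
  which is obtained from a small set by two power set steps. So it is small and has a copy in
  \<open>'v\<close>.\<close>

lemma pres_card_eq: "\<exists>B :: 'v set. pres_card U = |B| \<and> |B| =o cardSuc kappa"
proof -
  have "cardSuc kappa \<le>o |Pow (UNIV :: (nat \<Rightarrow> real) set set)|"
    by (intro cardSuc_least card_of_Card_order card_of_Pow)
  also have small: "|Pow (UNIV :: (nat \<Rightarrow> real) set set)| <o |UNIV :: 'v set|"
    using small_Pow[OF small_Pow[OF small_nat_real]] by (simp add: small_def)
  finally have *: "cardSuc kappa <o |UNIV :: 'v set|" .
  have "|Field (cardSuc kappa)| \<le>o |UNIV :: 'v set|"
    using ordIso_ordLeq_trans[OF card_of_Field_ordIso[OF cardSuc_Card_order] ordLess_imp_ordLeq[OF *]]
    by (simp add: card_of_Card_order)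
  then obtain B :: "'v set" where "|Field (cardSuc kappa)| =o |B|"
    using internalize_card_of_ordLeq2[of "Field (cardSuc kappa)" "UNIV :: 'v set"] by blast
  then have "|B| =o cardSuc kappa"
    by (rule ordIso_transitive[OF ordIso_symmetric
          card_of_Field_ordIso[OF cardSuc_Card_order[OF card_of_Card_order]]])
  then have "\<exists>B :: 'v set. |B| =o cardSuc kappa"
    by blast
  from someI_ex[OF this] show ?thesis
    unfolding pres_card_def by blast
qed

lemma ordLess_pres_card: "|A| <o pres_card U \<longleftrightarrow> few A"
proof -
  obtain B :: "'v set" where B: "pres_card U = |B|" "|B| =o cardSuc kappa"
    using pres_card_eq by blast
  have "|A| <o |B| \<longleftrightarrow> |A| <o cardSuc kappa"
    using ordLess_ordIso_trans[OF _ B(2)] ordLess_ordIso_trans[OF _ ordIso_symmetric[OF B(2)]]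
    by (rule iffI)
  then show ?thesis
    unfolding few_def B(1) by (simp add: cardSuc_ordLess_ordLeq card_of_Card_order)
qed

text \<open>Infinite successor cardinals are regular, and regularity passes to the isomorphic copy
  \<open>B\<close>.\<close>

lemma regular_cardinal_pres_card: "regular_cardinal U (pres_card U)"
proof -
  obtain B :: "'v set" where B: "pres_card U = |B|" "|B| =o cardSuc kappa"
    using pres_card_eq by blast
  have inf: "infinite (Field kappa)"
    unfolding Field_card_of by (rule infinite_kappa)
  have inf': "Cinfinite (cardSuc kappa)"
    by (intro Cinfinite_cardSuc conjI card_of_Card_order) (unfold cinfinite_def, rule inf)
  have infB: "Cinfinite |B|"
    using Cinfinite_cong[OF ordIso_symmetric[OF B(2)] inf'] .
  have "regularCard |B|"
    by (rule regularCard_ordIso[OF ordIso_symmetric[OF B(2)] inf'])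
      (rule infinite_cardSuc_regularCard[OF inf card_of_Card_order])
  moreover have "small U B"
  proof -
    have "cardSuc kappa \<le>o |Pow (UNIV :: (nat \<Rightarrow> real) set set)|"
      by (intro cardSuc_least card_of_Card_order card_of_Pow)
    then have "|B| \<le>o |Pow (UNIV :: (nat \<Rightarrow> real) set set)|"
      by (rule ordIso_ordLeq_trans[OF B(2)])
    moreover have "small U (Pow (UNIV :: (nat \<Rightarrow> real) set set))"
      using small_Pow[OF small_Pow[OF small_nat_real]] by simp
    ultimately show ?thesis
      by (rule small_ordLeq[rotated])
  qed
  ultimately show ?thesis
    using infB by (simp add: regular_cardinal_def B(1) cinfinite_def Field_card_of)
qed

text \<open>Gives every space with few points room inside one fixed small set; the codes of the
  small subobjects come from here.\<close>

lemma few_embedding: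
  assumes "few A"
  obtains f where "inj_on f A" "f ` A \<subseteq> Field (pres_card U)"
proof -
  obtain B :: "'v set" where B: "pres_card U = |B|"
    using pres_card_eq by blast
  have "|A| \<le>o |B|"
    using iffD2[OF ordLess_pres_card assms] unfolding B by (rule ordLess_imp_ordLeq)
  then obtain f where "inj_on f A" "f ` A \<subseteq> B"
    by (rule card_of_ordLeqE_inj)
  then show ?thesis
    by (intro that) (simp_all add: B Field_card_of)
qed

lemma few_small: "few A \<Longrightarrow> small U A"
  using small_ordLeq[OF small_Pow[OF small_nat_real]] by (simp add: few_def)

end

section \<open>The category of multipointed d-spaces over the category of sets\<close>

lemma MdTop_simps [simp]:
  "X \<in> Ob (MdTop U) \<longleftrightarrow> multipointed_dspace X \<and> small U (topspace (space X))"
  "Hom (MdTop U) = mdspace_hom"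
  "Cmp (MdTop U) X Y Z g f = compose (topspace (space X)) g f"
  "Idn (MdTop U) X = (\<lambda>x \<in> topspace (space X). x)"
  by (simp_all add: MdTop_def)

lemma set_cat_simps [simp]:
  "A \<in> Ob (set_cat U) \<longleftrightarrow> small U A"
  "Hom (set_cat U) A B = A \<rightarrow>\<^sub>E B"
  "Cmp (set_cat U) A B C g f = compose A g f"
  "Idn (set_cat U) A = (\<lambda>x\<in>A. x)"
  by (simp_all add: set_cat_def)

lemma underlying_set_simps [simp]:
  "OMap underlying_set X = topspace (space X)"
  "HMap underlying_set X Y f = f"
  by (simp_all add: underlying_set_def)

lemma compose_assoc_PiE:
  assumes "f \<in> A \<rightarrow>\<^sub>E B"
  shows "compose A (compose B h g) f = compose A h (compose A g f)"
  using assms by (intro ext) (auto simp: compose_def restrict_def PiE_iff)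

lemma compose_id_right:
  assumes "f \<in> A \<rightarrow>\<^sub>E B"
  shows "compose A f (\<lambda>x\<in>A. x) = f"
  using assms by (intro ext) (auto simp: compose_def restrict_def PiE_iff extensional_def)

lemma compose_id_left:
  assumes "f \<in> A \<rightarrow>\<^sub>E B"
  shows "compose A (\<lambda>x\<in>B. x) f = f"
  using assms by (intro ext) (auto simp: compose_def restrict_def PiE_iff extensional_def)

lemma compose_PiE:
  assumes "f \<in> A \<rightarrow>\<^sub>E B" "g \<in> B \<rightarrow>\<^sub>E C"
  shows "compose A g f \<in> A \<rightarrow>\<^sub>E C"
  using assms by (auto simp: compose_def PiE_iff)

lemma category_set_cat: "category (set_cat U)"
proof
  show "Cmp (set_cat U) W X Z (Cmp (set_cat U) X Y Z h g) f
      = Cmp (set_cat U) W Y Z h (Cmp (set_cat U) W X Y g f)"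
    if "f \<in> Hom (set_cat U) W X" for W X Y Z f g h
    using that by (simp add: compose_assoc_PiE)
qed (simp_all add: compose_id_left compose_id_right compose_PiE)

lemma category_MdTop: "category (MdTop U)"
proof
  show "Cmp (MdTop U) W X Z (Cmp (MdTop U) X Y Z h g) f
      = Cmp (MdTop U) W Y Z h (Cmp (MdTop U) W X Y g f)"
    if "f \<in> Hom (MdTop U) W X" for W X Y Z f g h
    using that mdspace_homD(5)[of f W X] by (simp add: compose_assoc_PiE)
next
  show "Cmp (MdTop U) X X Y f (Idn (MdTop U) X) = f" if "f \<in> Hom (MdTop U) X Y" for X Y f
    using that by (simp add: compose_id_right[OF mdspace_homD(5)])
  show "Cmp (MdTop U) X Y Y (Idn (MdTop U) Y) f = f" if "f \<in> Hom (MdTop U) X Y" for X Y f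
    using that by (simp add: compose_id_left[OF mdspace_homD(5)])
qed (simp_all add: mdspace_hom_id mdspace_hom_compose)

lemma cat_functor_underlying_set: "cat_functor (MdTop U) (set_cat U) underlying_set"
  by (intro cat_functor.intro category_MdTop category_set_cat cat_functor_axioms.intro)
    (simp_all add: mdspace_homD(5))

lemma concrete_over_MdTop: "concrete_over (MdTop U) (set_cat U) underlying_set"
  by (simp add: concrete_over_def cat_functor_underlying_set faithful_def inj_on_def)

text \<open>An identity map that is a morphism both ways gives mutual inclusion of open sets, states
  and paths. Uniqueness of initial lifts demands equality, not merely isomorphism, and this lemma
  supplies it.\<close>

lemma mdspace_hom_id_imp_eq:
  assumes X: "multipointed_dspace X" and Y: "multipointed_dspace Y"
    and top: "topspace (space X) = E" "topspace (space Y) = E"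
    and XY: "(\<lambda>x\<in>E. x) \<in> mdspace_hom X Y" and YX: "(\<lambda>x\<in>E. x) \<in> mdspace_hom Y X"
  shows "X = Y"
proof -
  have sub: "(\<forall>V. openin (space X') V \<longrightarrow> openin (space Y') V) \<and> states Y' \<subseteq> states X' \<and> dpaths Y' \<subseteq> dpaths X'"
    if "multipointed_dspace Y'" "topspace (space X') = E" "topspace (space Y') = E"
      "(\<lambda>x\<in>E. x) \<in> mdspace_hom Y' X'" for X' Y'
  proof (intro conjI allI impI subsetI)
    fix V
    assume V: "openin (space X') V"
    then have "openin (space Y') {x \<in> topspace (space Y'). (\<lambda>x\<in>E. x) x \<in> V}"
      using mdspace_homD(2)[OF that(4)] by (rule openin_continuous_map_preimage[rotated])
    moreover have "{x \<in> topspace (space Y'). (\<lambda>x\<in>E. x) x \<in> V} = V"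
      using openin_subset[OF V] that by auto
    ultimately show "openin (space Y') V"
      by simp
  next
    fix x
    assume "x \<in> states Y'"
    then show "x \<in> states X'"
      using mdspace_homD(3)[OF that(4), of x] multipointed_dspaceD(2)[OF that(1)] that(3) by auto
  next
    fix \<phi>
    assume \<phi>: "\<phi> \<in> dpaths Y'"
    have "compose {0..1} (\<lambda>x\<in>E. x) \<phi> = \<phi>"
      by (rule compose_restrict_path[where S = E])
        (use multipointed_dspaceD(3,6)[OF that(1) \<phi>] that(3) in \<open>auto simp: state_path_def\<close>)
    then show "\<phi> \<in> dpaths X'"
      using mdspace_homD(4)[OF that(4) \<phi>] by simp
  qed
  from sub[OF X top(2,1) XY] sub[OF Y top YX] show ?thesis
    by (intro mdspace.equality) (auto simp: topology_eq)
qed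

text \<open>The lift has \<open>E\<close> as its set of points, hence is small whatever the size of
  \<open>I\<close>. The lifted morphisms are the \<open>f i\<close> themselves, because the functor
  leaves maps unchanged.\<close>

lemma topological_MdTop:
  fixes U :: "'v itself"
  shows "topological TYPE('i) (MdTop U) (set_cat U) underlying_set"
  unfolding topological_def
proof (intro conjI cat_functor_underlying_set allI impI)
  fix E and I :: "'i set" and A :: "'i \<Rightarrow> 'v mdspace" and f
  assume "structured_source (MdTop U) (set_cat U) underlying_set E I A f"
  then have E: "small U E" and A: "\<And>i. i \<in> I \<Longrightarrow> multipointed_dspace (A i)"
    and f: "\<And>i. i \<in> I \<Longrightarrow> f i \<in> E \<rightarrow>\<^sub>E topspace (space (A i))"
    by (simp_all add: structured_source_def)
  let ?X = "initial_mdspace E I A f"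
  have X: "multipointed_dspace ?X"
    by (rule multipointed_initial) (use A f in auto)
  have f_hom: "f i \<in> mdspace_hom ?X (A i)" if "i \<in> I" for i
    by (rule initial_mdspace_hom) (use A f that in auto)
  have lift: "source_lift (MdTop U) underlying_set E I A f ?X f"
    using X f_hom E by (simp add: source_lift_def)
  have init: "initial_source (MdTop U) (set_cat U) underlying_set I A ?X f"
    unfolding initial_source_def
  proof (intro ballI allI impI)
    fix Z h k
    assume Z: "Z \<in> Ob (MdTop U)"
      and k: "k \<in> Hom (set_cat U) (OMap underlying_set Z) (OMap underlying_set ?X)"
      and h: "\<forall>i\<in>I. h i \<in> Hom (MdTop U) Z (A i) \<and> HMap underlying_set Z (A i) (h i) =
        Cmp (set_cat U) (OMap underlying_set Z) (OMap underlying_set ?X)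
          (OMap underlying_set (A i)) (HMap underlying_set ?X (A i) (f i)) k"
    then have "k \<in> mdspace_hom Z ?X"
      by (intro hom_into_initial_mdspace) (use A f in auto)
    then show "\<exists>!l. l \<in> Hom (MdTop U) Z ?X \<and> HMap underlying_set Z ?X l = k \<and>
        (\<forall>i\<in>I. Cmp (MdTop U) Z ?X (A i) (f i) l = h i)"
      using h by (intro ex1I[of _ k]) auto
  qed
  have unique: "X' = ?X \<and> (\<forall>i\<in>I. g' i = f i)"
    if lift': "source_lift (MdTop U) underlying_set E I A f X' g'"
      and init': "initial_source (MdTop U) (set_cat U) underlying_set I A X' g'" for X' g'
  proof -
    have X': "multipointed_dspace X'" "small U (topspace (space X'))" "topspace (space X') = E"
      "\<And>i. i \<in> I \<Longrightarrow> f i \<in> mdspace_hom X' (A i)" "\<And>i. i \<in> I \<Longrightarrow> g' i = f i"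
      using lift' by (auto simp: source_lift_def)
    have comp: "compose E (f i) (\<lambda>x\<in>E. x) = f i" if "i \<in> I" for i
      by (rule compose_id_right[OF f[OF that]])
    have "(\<lambda>x\<in>E. x) \<in> mdspace_hom X' ?X"
      by (rule hom_into_initial_mdspace) (use A f in \<open>auto simp: X' comp\<close>)
    \<comment> \<open>Here initiality of \<open>X'\<close> is applied to the identity of
      \<open>E\<close>; the morphism it returns is that same map.\<close>
    moreover have "(\<lambda>x\<in>E. x) \<in> mdspace_hom ?X X'"
    proof -
      have "?X \<in> Ob (MdTop U)"
        "(\<lambda>x\<in>E. x) \<in> Hom (set_cat U) (OMap underlying_set ?X) (OMap underlying_set X')"
        using X E X' by simp_all
      moreover have "\<forall>i\<in>I. f i \<in> Hom (MdTop U) ?X (A i) \<and> HMap underlying_set ?X (A i) (f i) =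
          Cmp (set_cat U) (OMap underlying_set ?X) (OMap underlying_set X')
            (OMap underlying_set (A i)) (HMap underlying_set X' (A i) (g' i)) (\<lambda>x\<in>E. x)"
        using f_hom by (simp add: X' comp)
      ultimately have "\<exists>!l. l \<in> Hom (MdTop U) ?X X' \<and> HMap underlying_set ?X X' l = (\<lambda>x\<in>E. x) \<and>
          (\<forall>i\<in>I. Cmp (MdTop U) ?X X' (A i) (g' i) l = f i)"
        using init'[unfolded initial_source_def, rule_format, of ?X "\<lambda>x\<in>E. x" f] by blast
      then show ?thesis
        by auto
    qed
    ultimately have "X' = ?X"
      using X by (intro mdspace_hom_id_imp_eq[of X' ?X E]) (simp_all add: X')
    then show ?thesis
      using X' by simp
  qed
  show "\<exists>X g. source_lift (MdTop U) underlying_set E I A f X g \<and>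
      initial_source (MdTop U) (set_cat U) underlying_set I A X g \<and>
      (\<forall>X' g'. source_lift (MdTop U) underlying_set E I A f X' g' \<and>
         initial_source (MdTop U) (set_cat U) underlying_set I A X' g' \<longrightarrow>
         X' = X \<and> (\<forall>i\<in>I. g' i = g i))"
    using lift init unique by blast
qed

section \<open>Smallness of fibres and hom-sets\<close>

context universe
begin

text \<open>A multipointed d-space on \<open>E\<close> is determined by its open sets, states and
  paths, all of which live in power sets built from \<open>E\<close> and the interval.\<close>

lemma small_fibre:
  assumes "small U E"
  shows "small U {X. multipointed_dspace X \<and> topspace (space X) = E}"
proof (rule small_ordLeq)
  show "small U (Pow (Pow E) \<times> Pow E \<times> Pow ({0..1::real} \<rightarrow>\<^sub>E E))"
    by (intro small_Sigma small_Pow small_PiE assms small_subset[OF small_real] subset_UNIV)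
  show "|{X. multipointed_dspace X \<and> topspace (space X) = E}|
      \<le>o |Pow (Pow E) \<times> Pow E \<times> Pow ({0..1::real} \<rightarrow>\<^sub>E E)|"
  proof (rule card_of_ordLeqI_inj[of "\<lambda>X. ({V. openin (space X) V}, states X, dpaths X)"])
    show "inj_on (\<lambda>X. ({V. openin (space X) V}, states X, dpaths X))
        {X. multipointed_dspace X \<and> topspace (space X) = E}"
      by (rule inj_onI, rule mdspace.equality) (auto simp: topology_eq set_eq_iff)
    show "(\<lambda>X. ({V. openin (space X) V}, states X, dpaths X)) `
        {X. multipointed_dspace X \<and> topspace (space X) = E}
        \<subseteq> Pow (Pow E) \<times> Pow E \<times> Pow ({0..1} \<rightarrow>\<^sub>E E)"
    proof (rule image_subsetI)
      fix X
      assume "X \<in> {X. multipointed_dspace X \<and> topspace (space X) = E}"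
      then have X: "multipointed_dspace X" and E: "topspace (space X) = E"
        by auto
      have "dpaths X \<subseteq> {0..1} \<rightarrow>\<^sub>E E"
        using multipointed_dspaceD(3,6)[OF X] unfolding E by (auto simp: PiE_def state_path_def)
      moreover have "{V. openin (space X) V} \<subseteq> Pow E"
        using openin_subset[of "space X"] unfolding E by blast
      ultimately show "({V. openin (space X) V}, states X, dpaths X)
          \<in> Pow (Pow E) \<times> Pow E \<times> Pow ({0..1} \<rightarrow>\<^sub>E E)"
        using multipointed_dspaceD(2)[OF X] unfolding E by simp
    qed
  qed
qed

lemma fibre_small_MdTop: "fibre_small U (MdTop U) (set_cat U) underlying_set"
  unfolding fibre_small_def
  by (auto intro: small_subset[OF small_fibre])

lemma locally_small_MdTop: "locally_small U (MdTop U)"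
  unfolding locally_small_def
proof (intro ballI)
  fix X Y
  assume "X \<in> Ob (MdTop U)" "Y \<in> Ob (MdTop U)"
  then have "small U (topspace (space X) \<rightarrow>\<^sub>E topspace (space Y))"
    by (intro small_PiE) simp_all
  then show "small U (Hom (MdTop U) X Y)"
  proof (rule small_subset)
    show "Hom (MdTop U) X Y \<subseteq> topspace (space X) \<rightarrow>\<^sub>E topspace (space Y)"
      by (simp add: subset_iff mdspace_homD(5))
  qed
qed

end

section \<open>Colimits\<close>

definition colimit_step ::
  "('j, 'k) cat \<Rightarrow> ('j, 'k, 'v mdspace, 'v \<Rightarrow> 'v) functr \<Rightarrow> ('j \<times> 'v) rel" where
  "colimit_step J D =
     {((i, x), (j, HMap D i j f x)) | i j f x.
        i \<in> Ob J \<and> j \<in> Ob J \<and> f \<in> Hom J i j \<and> x \<in> topspace (space (OMap D i))}"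

text \<open>The equivalence generated by the transition maps. It is reflexive on the whole type, but
  only classes of points of the disjoint union are formed.\<close>

definition colimit_rel ::
  "('j, 'k) cat \<Rightarrow> ('j, 'k, 'v mdspace, 'v \<Rightarrow> 'v) functr \<Rightarrow> ('j \<times> 'v) rel" where
  "colimit_rel J D = (colimit_step J D \<union> (colimit_step J D)\<inverse>)\<^sup>*"

lemma colimit_rel_sym: "(p, q) \<in> colimit_rel J D \<Longrightarrow> (q, p) \<in> colimit_rel J D"
  unfolding colimit_rel_def by (rule symD[OF sym_rtrancl]) (auto simp: sym_def)

lemma colimit_rel_trans:
  "\<lbrakk>(p, q) \<in> colimit_rel J D; (q, r) \<in> colimit_rel J D\<rbrakk> \<Longrightarrow> (p, r) \<in> colimit_rel J D"
  unfolding colimit_rel_def by (rule rtrancl_trans)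

lemma colimit_rel_step:
  "\<lbrakk>i \<in> Ob J; j \<in> Ob J; f \<in> Hom J i j; x \<in> topspace (space (OMap D i))\<rbrakk>
    \<Longrightarrow> ((i, x), (j, HMap D i j f x)) \<in> colimit_rel J D"
  unfolding colimit_rel_def by (rule r_into_rtrancl, rule UnI1) (auto simp: colimit_step_def)

lemma colimit_rel_invariant:
  assumes "(p, q) \<in> colimit_rel J D"
    and "\<And>i j f x. \<lbrakk>i \<in> Ob J; j \<in> Ob J; f \<in> Hom J i j; x \<in> topspace (space (OMap D i))\<rbrakk>
      \<Longrightarrow> v (j, HMap D i j f x) = v (i, x)"
  shows "v p = v q"
  using assms(1) unfolding colimit_rel_def
proof induction
  case (step q r)
  from step(2) have "v q = v r"
    using assms(2) by (auto simp: colimit_step_def)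
  then show ?case
    using step by simp
qed simp

context universe
begin

text \<open>The vertex consists of the classes of the disjoint union. The second conjunct, that
  points are identified only through zigzags, is recorded because gluing in directed diagrams rests
  on it. The morphism type of \<open>J\<close> is free, so that posets with morphisms in
  \<open>unit\<close> are covered as well as small categories on \<open>'v\<close>.\<close>

lemma colimit_exists:
  fixes J :: "('j, 'k) cat" and D :: "('j, 'k, 'v mdspace, 'v \<Rightarrow> 'v) functr"
  assumes J: "small U (Ob J)" and D: "cat_functor J (MdTop U) D"
  shows "\<exists>X c. is_colimit J (MdTop U) D X c \<and>
    (\<forall>i\<in>Ob J. \<forall>j\<in>Ob J. \<forall>x\<in>topspace (space (OMap D i)). \<forall>y\<in>topspace (space (OMap D j)).
       c i x = c j y \<longrightarrow> ((i, x), (j, y)) \<in> colimit_rel J D)"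
proof -
  interpret D: cat_functor J "MdTop U" D
    by fact
  let ?T = "\<lambda>j. topspace (space (OMap D j))"
  define S where "S = Sigma (Ob J) ?T"
  define cls where "cls p = colimit_rel J D `` {p}" for p
  have DOb: "multipointed_dspace (OMap D j)" "small U (?T j)" if "j \<in> Ob J" for j
    using D.OMap_in_Ob[OF that] by auto
  have DHom: "HMap D i j f \<in> mdspace_hom (OMap D i) (OMap D j)"
    if "i \<in> Ob J" "j \<in> Ob J" "f \<in> Hom J i j" for i j f
    using D.HMap_in_Hom[OF that] by simp
  have "small U S"
    unfolding S_def by (intro small_Sigma J DOb)
  then have smallQ: "small U (cls ` S)"
    by (rule small_image)
  \<comment> \<open>The classes are sets of pairs; as there is only a small set of them, they can be
    named by elements of \<open>'v\<close>.\<close>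
  then obtain \<iota> :: "('j \<times> 'v) set \<Rightarrow> 'v" where \<iota>: "inj_on \<iota> (cls ` S)"
    by (rule small_embedding)
  define E where "E = \<iota> ` cls ` S"
  define c where "c j = (\<lambda>x \<in> ?T j. \<iota> (cls (j, x)))" for j
  have c_eq: "((i, x), (j, y)) \<in> colimit_rel J D"
    if "i \<in> Ob J" "j \<in> Ob J" "x \<in> ?T i" "y \<in> ?T j" "c i x = c j y" for i j x y
  proof -
    have "cls (i, x) = cls (j, y)"
      using inj_onD[OF \<iota>, of "cls (i, x)" "cls (j, y)"] that by (simp add: c_def S_def)
    moreover have "(j, y) \<in> cls (j, y)"
      by (simp add: cls_def colimit_rel_def)
    ultimately have "(j, y) \<in> cls (i, x)"
      by simp
    then show ?thesis
      by (simp add: cls_def)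
  qed
  have cls_eq: "cls p = cls q" if "(p, q) \<in> colimit_rel J D" for p q
    using colimit_rel_trans[OF that] colimit_rel_trans[OF colimit_rel_sym[OF that]]
    unfolding cls_def by blast
  have c_PiE: "c j \<in> ?T j \<rightarrow>\<^sub>E E" if "j \<in> Ob J" for j
    using that by (auto simp: c_def E_def S_def)
  define X where "X = final_mdspace E (Ob J) (OMap D) c"
  have topX: "topspace (space X) = E"
    unfolding X_def by (rule topspace_final_mdspace) (use DOb c_PiE in auto)
  have "multipointed_dspace X"
    unfolding X_def by (rule multipointed_final) (use DOb c_PiE in auto)
  then have XOb: "X \<in> Ob (MdTop U)"
    using small_image[OF smallQ, of \<iota>] by (simp add: topX E_def)
  have cHom: "c j \<in> mdspace_hom (OMap D j) X" if "j \<in> Ob J" for j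
    unfolding X_def by (rule final_mdspace_hom) (use DOb c_PiE that in auto)
  have c_compat: "compose (?T i) (c j) (HMap D i j f) = c i"
    if ij: "i \<in> Ob J" "j \<in> Ob J" "f \<in> Hom J i j" for i j f
  proof (rule ext)
    fix x
    have "cls (j, HMap D i j f x) = cls (i, x)" if x: "x \<in> ?T i"
      by (rule cls_eq[OF colimit_rel_step[where D = D, OF ij x], symmetric])
    then show "compose (?T i) (c j) (HMap D i j f) x = c i x"
      using mdspace_homD(6)[OF DHom[OF ij]] by (simp add: compose_def c_def)
  qed
  have cocone: "is_cocone J (MdTop U) D X c"
    unfolding is_cocone_def using XOb cHom c_compat by simp
  have "\<exists>!h. h \<in> Hom (MdTop U) X Y \<and> (\<forall>j \<in> Ob J. Cmp (MdTop U) (OMap D j) X Y h (c j) = d j)"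
    if "is_cocone J (MdTop U) D Y d" for Y d
  proof -
    have Y: "multipointed_dspace Y" and d: "\<And>j. j \<in> Ob J \<Longrightarrow> d j \<in> mdspace_hom (OMap D j) Y"
      and d_compat: "\<And>i j f. \<lbrakk>i \<in> Ob J; j \<in> Ob J; f \<in> Hom J i j\<rbrakk>
        \<Longrightarrow> compose (?T i) (d j) (HMap D i j f) = d i"
      using that by (auto simp: is_cocone_def)
    let ?v = "\<lambda>p. d (fst p) (snd p)"
    have inv: "?v p = ?v q" if "(p, q) \<in> colimit_rel J D" for p q
      using that
    proof (rule colimit_rel_invariant)
      fix i j f x
      assume *: "i \<in> Ob J" "j \<in> Ob J" "f \<in> Hom J i j" "x \<in> ?T i"
      show "?v (j, HMap D i j f x) = ?v (i, x)"
        using fun_cong[OF d_compat[OF *(1-3)], of x] *(4) by (simp add: compose_def)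
    qed
    \<comment> \<open>The cocone is evaluated at a chosen representative of the class named
      \<open>e\<close>; by \<open>inv\<close> the choice does not matter.\<close>
    define h where "h = (\<lambda>e\<in>E. ?v (SOME p. p \<in> S \<and> \<iota> (cls p) = e))"
    have hc: "h (c j x) = d j x" if j: "j \<in> Ob J" and x: "x \<in> ?T j" for j x
    proof -
      let ?p = "SOME p. p \<in> S \<and> \<iota> (cls p) = c j x"
      have "\<exists>p. p \<in> S \<and> \<iota> (cls p) = c j x"
        using j x by (intro exI[of _ "(j, x)"]) (simp add: S_def c_def)
      then have p: "?p \<in> S \<and> \<iota> (cls ?p) = c j x"
        by (rule someI_ex)
      then have "cls ?p = cls (j, x)"
        using inj_onD[OF \<iota>, of "cls ?p" "cls (j, x)"] j x by (simp add: c_def S_def)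
      moreover have "(j, x) \<in> cls (j, x)"
        by (simp add: cls_def colimit_rel_def)
      ultimately have "(j, x) \<in> cls ?p"
        by (simp only:)
      then have "(?p, (j, x)) \<in> colimit_rel J D"
        by (simp add: cls_def)
      from inv[OF this] have "?v ?p = d j x"
        by simp
      moreover have "c j x \<in> E"
        using c_PiE[OF j] x by auto
      ultimately show ?thesis
        by (simp add: h_def)
    qed
    have compose_hc: "compose (?T j) h (c j) = d j" if "j \<in> Ob J" for j
      using hc[OF that] mdspace_homD(1)[OF d[OF that]]
      by (intro ext) (auto simp: compose_def extensional_def)
    have surj: "\<exists>j x. j \<in> Ob J \<and> x \<in> ?T j \<and> e = c j x" if "e \<in> E" for e
      using that by (auto simp: E_def S_def c_def)
    have hPiE: "h \<in> E \<rightarrow>\<^sub>E topspace (space Y)"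
    proof (rule PiE_I)
      fix e
      assume "e \<in> E"
      from surj[OF this] obtain j x where e: "j \<in> Ob J" "x \<in> ?T j" "e = c j x"
        by blast
      then show "h e \<in> topspace (space Y)"
        using hc[OF e(1,2)] mdspace_homD(6)[OF d[OF e(1)] e(2)] by simp
    qed (simp add: h_def)
    have "h \<in> mdspace_hom X Y"
      unfolding X_def
      by (rule hom_from_final_mdspace) (use DOb c_PiE Y hPiE compose_hc d in auto)
    moreover have "h' = h"
      if h': "h' \<in> mdspace_hom X Y" "\<And>j. j \<in> Ob J \<Longrightarrow> compose (?T j) h' (c j) = d j" for h'
    proof (rule PiE_ext)
      show "h' \<in> E \<rightarrow>\<^sub>E topspace (space Y)"
        using mdspace_homD(5)[OF h'(1)] by (simp add: topX)
      fix e
      assume "e \<in> E"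
      from surj[OF this] obtain j x where e: "j \<in> Ob J" "x \<in> ?T j" "e = c j x"
        by blast
      have "h' (c j x) = d j x"
        using fun_cong[OF h'(2)[OF e(1)], of x] e(2) by (simp add: compose_eq)
      then show "h' e = h e"
        unfolding e(3) hc[OF e(1,2)] .
    qed (rule hPiE)
    ultimately have "h \<in> mdspace_hom X Y \<and> (\<forall>j\<in>Ob J. compose (?T j) h (c j) = d j)"
      "\<And>h'. h' \<in> mdspace_hom X Y \<and> (\<forall>j\<in>Ob J. compose (?T j) h' (c j) = d j) \<Longrightarrow> h' = h"
      using compose_hc by blast+
    then show ?thesis
      unfolding MdTop_simps by (rule ex1I)
  qed
  then have "is_colimit J (MdTop U) D X c"
    using cocone by (simp add: is_colimit_def)
  then show ?thesis
    using c_eq by blast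
qed

lemma cocomplete_MdTop: "cocomplete U (MdTop U)"
  unfolding cocomplete_def
proof (intro allI impI, elim conjE)
  fix J :: "('v, 'v) cat" and D
  assume "small_category U J" and D: "cat_functor J (MdTop U) D"
  then have "small U (Ob J)"
    by (simp add: small_category_def)
  from colimit_exists[OF this D] show "\<exists>X c. is_colimit J (MdTop U) D X c"
    by (elim exE conjE) (intro exI)
qed

end

section \<open>Directed colimits\<close>

lemma poset_cat_simps [simp]:
  "Ob (poset_cat I R) = I"
  "Hom (poset_cat I R) i j = (if (i, j) \<in> R then {()} else {})"
  "Cmp (poset_cat I R) i j k g f = ()"
  "Idn (poset_cat I R) i = ()"
  by (simp_all add: poset_cat_def)

text \<open>Presentability quantifies over all colimits, so \<open>X\<close> and \<open>c\<close>
  are arbitrary and not the constructed ones. Points, topology, states and paths of \<open>X\<close>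
  have to be recovered from the universal property.\<close>

locale directed_colimit = universe U
  for U :: "'v itself" +
  fixes I :: "'v set" and R :: "'v rel" and D :: "('v, unit, 'v mdspace, 'v \<Rightarrow> 'v) functr"
    and X :: "'v mdspace" and c :: "'v \<Rightarrow> 'v \<Rightarrow> 'v"
  assumes directed: "directed_poset U (pres_card U) I R"
    and diagram: "cat_functor (poset_cat I R) (MdTop U) D"
    and colimit: "is_colimit (poset_cat I R) (MdTop U) D X c"
begin

abbreviation T :: "'v \<Rightarrow> 'v set" where "T i \<equiv> topspace (space (OMap D i))"

abbreviation m :: "'v \<Rightarrow> 'v \<Rightarrow> 'v \<Rightarrow> 'v" where "m i j \<equiv> HMap D i j ()"

lemma R_in: "(i, j) \<in> R \<Longrightarrow> i \<in> I" "(i, j) \<in> R \<Longrightarrow> j \<in> I"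
  using directed by (auto simp: directed_poset_def dest: partial_order_onD(4))

lemma R_refl: "i \<in> I \<Longrightarrow> (i, i) \<in> R"
  using directed by (auto simp: directed_poset_def dest: partial_order_onD(1) refl_onD)

lemma R_trans: "\<lbrakk>(i, j) \<in> R; (j, k) \<in> R\<rbrakk> \<Longrightarrow> (i, k) \<in> R"
proof (rule transD)
  show "trans R"
    using directed unfolding directed_poset_def by (elim conjE) (rule partial_order_onD(2))
qed

lemma upper_bound:
  assumes "S \<subseteq> I" "few S"
  obtains u where "u \<in> I" "\<forall>s\<in>S. (s, u) \<in> R"
proof -
  have "\<forall>S\<subseteq>I. few S \<longrightarrow> (\<exists>u\<in>I. \<forall>s\<in>S. (s, u) \<in> R)"
    using directed by (simp add: directed_poset_def ordLess_pres_card)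
  from this[rule_format, OF assms] show ?thesis
    by (elim bexE) (rule that)
qed

lemma upper_bound2:
  assumes "i \<in> I" "j \<in> I"
  obtains k where "(i, k) \<in> R" "(j, k) \<in> R"
proof -
  have "{i, j} \<subseteq> I" "few {i, j}"
    using assms by (simp_all add: few_finite)
  then obtain u where "u \<in> I" "\<forall>s\<in>{i, j}. (s, u) \<in> R"
    by (rule upper_bound)
  then show ?thesis
    by (intro that[of u]) simp_all
qed

lemma diagram_mdspace: "i \<in> I \<Longrightarrow> multipointed_dspace (OMap D i)"
  using cat_functor.OMap_in_Ob[OF diagram, of i] by simp

lemma m_hom: "(i, j) \<in> R \<Longrightarrow> m i j \<in> mdspace_hom (OMap D i) (OMap D j)"
  using cat_functor.HMap_in_Hom[OF diagram, of i j "()"] R_in[of i j] by simp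

lemma m_in: "\<lbrakk>(i, j) \<in> R; x \<in> T i\<rbrakk> \<Longrightarrow> m i j x \<in> T j"
  by (rule mdspace_homD(6)[OF m_hom])

lemma m_trans:
  assumes "(i, j) \<in> R" "(j, k) \<in> R" "x \<in> T i"
  shows "m j k (m i j x) = m i k x"
  using cat_functor.HMap_Cmp[OF diagram, of i j k "()" "()"] assms R_in[OF assms(1)] R_in[OF assms(2)]
  by (simp add: compose_eq)

lemma m_id: "\<lbrakk>i \<in> I; x \<in> T i\<rbrakk> \<Longrightarrow> m i i x = x"
  using cat_functor.HMap_Idn[OF diagram, of i] by simp

lemma cocone: "is_cocone (poset_cat I R) (MdTop U) D X c"
  using colimit by (simp add: is_colimit_def)

lemma X_mdspace: "multipointed_dspace X" "small U (topspace (space X))"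
  using cocone by (simp_all add: is_cocone_def)

lemma c_hom: "i \<in> I \<Longrightarrow> c i \<in> mdspace_hom (OMap D i) X"
  using cocone by (simp add: is_cocone_def)

lemma c_in: "\<lbrakk>i \<in> I; x \<in> T i\<rbrakk> \<Longrightarrow> c i x \<in> topspace (space X)"
  by (rule mdspace_homD(6)[OF c_hom])

lemma c_compose_m:
  assumes "(i, j) \<in> R"
  shows "compose (T i) (c j) (m i j) = c i"
  using cocone assms R_in[OF assms] by (simp add: is_cocone_def)

lemma c_m: "\<lbrakk>(i, j) \<in> R; x \<in> T i\<rbrakk> \<Longrightarrow> c j (m i j x) = c i x"
  using fun_cong[OF c_compose_m, of i j x] by (simp add: compose_eq)

lemma universal:
  assumes "is_cocone (poset_cat I R) (MdTop U) D Y d"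
  shows "\<exists>!h. h \<in> mdspace_hom X Y \<and> (\<forall>j\<in>I. compose (T j) h (c j) = d j)"
  using colimit assms unfolding is_colimit_def by simp

text \<open>An upper bound of the few individual stages serves all of \<open>S\<close>, because
  \<open>P\<close> persists. Every passage from single points, paths or simplices to all of them at
  once goes through this principle.\<close>

lemma eventually_all:
  assumes "few S" "i \<in> I" "\<And>s. s \<in> S \<Longrightarrow> \<exists>j. (i, j) \<in> R \<and> P s j"
    and mono: "\<And>s j k. \<lbrakk>s \<in> S; (i, j) \<in> R; (j, k) \<in> R; P s j\<rbrakk> \<Longrightarrow> P s k"
  shows "\<exists>j. (i, j) \<in> R \<and> (\<forall>s\<in>S. P s j)"
proof -
  obtain J where J: "\<And>s. s \<in> S \<Longrightarrow> (i, J s) \<in> R" "\<And>s. s \<in> S \<Longrightarrow> P s (J s)"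
    using assms(3) by metis
  \<comment> \<open>Including \<open>i\<close> keeps the bound above \<open>i\<close> even when
    \<open>S\<close> is empty.\<close>
  have "insert i (J ` S) \<subseteq> I"
    using R_in(2)[OF J(1)] assms(2) by auto
  moreover have "few (insert i (J ` S))"
    using few_Un[OF few_finite[of "{i}"] few_image[OF assms(1), of J]] by simp
  ultimately obtain u where "u \<in> I" and u: "\<forall>s\<in>insert i (J ` S). (s, u) \<in> R"
    by (rule upper_bound)
  show ?thesis
  proof (intro exI conjI ballI)
    show "(i, u) \<in> R"
      using u by simp
    show "P s u" if "s \<in> S" for s
      by (rule mono[OF that J(1)[OF that] _ J(2)[OF that]]) (use u that in simp)
  qed
qed

text \<open>The legs of \<open>X\<close> factor those of the constructed colimit, where equal points
  are joined by a zigzag. Directedness collapses the zigzag to a single stage.\<close>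

lemma glue:
  assumes i: "i \<in> I" and j: "j \<in> I" and x: "x \<in> T i" and y: "y \<in> T j" and eq: "c i x = c j y"
  obtains k where "(i, k) \<in> R" "(j, k) \<in> R" "m i k x = m j k y"
proof -
  have "small U (Ob (poset_cat I R))"
    using directed by (simp add: directed_poset_def)
  from colimit_exists[OF this diagram] obtain L l
    where L: "is_colimit (poset_cat I R) (MdTop U) D L l"
      and l: "\<forall>i\<in>I. \<forall>j\<in>I. \<forall>x\<in>T i. \<forall>y\<in>T j.
        l i x = l j y \<longrightarrow> ((i, x), (j, y)) \<in> colimit_rel (poset_cat I R) D"
    unfolding poset_cat_simps by (elim exE conjE)
  have "is_cocone (poset_cat I R) (MdTop U) D L l"
    using L by (simp add: is_colimit_def)
  from ex1_implies_ex[OF universal[OF this]] obtain h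
    where h: "\<forall>j\<in>I. compose (T j) h (c j) = l j"
    by (elim exE conjE)
  have "l i x = l j y"
    using fun_cong[OF bspec[OF h i], of x] fun_cong[OF bspec[OF h j], of y] x y eq
    by (simp add: compose_eq)
  then have "((i, x), (j, y)) \<in> colimit_rel (poset_cat I R) D"
    using l i j x y by blast
  \<comment> \<open>The invariant along the zigzag: the current point agrees with \<open>x\<close>
    at some stage above both. A forward step moves to a bound of that stage and the new index; a
    backward step keeps the stage.\<close>
  then have "(\<lambda>(b, z). b \<in> I \<and> z \<in> T b \<and> (\<exists>k. (i, k) \<in> R \<and> (b, k) \<in> R \<and> m i k x = m b k z)) (j, y)"
    unfolding colimit_rel_def
  proof (induction "(j, y)" arbitrary: j y rule: rtrancl_induct)
    case base
    then show ?case
      using i x R_refl by auto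
  next
    case (step q j' y')
    obtain b z where q: "q = (b, z)"
      by (cases q)
    from step.hyps(3)[OF q] obtain k where b: "b \<in> I" "z \<in> T b"
      and k: "(i, k) \<in> R" "(b, k) \<in> R" "m i k x = m b k z"
      by auto
    from step.hyps(2) consider "(b, j') \<in> R" "y' = m b j' z"
      | "(j', b) \<in> R" "y' \<in> T j'" "z = m j' b y'"
      by (auto simp: q colimit_step_def split: if_splits)
    then show ?case
    proof cases
      case 1
      obtain k' where k': "(k, k') \<in> R" "(j', k') \<in> R"
        using upper_bound2[OF R_in(2)[OF k(1)] R_in(2)[OF 1(1)]] .
      have "m i k' x = m j' k' y'"
        using m_trans[OF k(1) k'(1) x] m_trans[OF k(2) k'(1) b(2)] m_trans[OF 1(1) k'(2) b(2)] k(3)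
        by (simp add: 1(2))
      then show ?thesis
        using R_in(2)[OF 1(1)] m_in[OF 1(1) b(2)] R_trans[OF k(1) k'(1)] k'(2) by (auto simp: 1(2))
    next
      case 2
      have "m i k x = m j' k y'"
        using m_trans[OF 2(1) k(2) 2(2)] k(3) by (simp add: 2(3))
      then show ?thesis
        using R_in(1)[OF 2(1)] 2(2) k(1) R_trans[OF 2(1) k(2)] by auto
    qed
  qed
  then show ?thesis
    using that by auto
qed

text \<open>
  The final structure on the union of the images of the legs is the vertex of a cocone, so it is
  a retract of \<open>X\<close>, and by uniqueness it is \<open>X\<close> itself.
\<close>

lemma hom_to_final:
  defines "E \<equiv> (\<Union>i\<in>I. c i ` T i)"
  shows "topspace (space X) = E" "(\<lambda>x\<in>E. x) \<in> mdspace_hom X (final_mdspace E I (OMap D) c)"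
proof -
  let ?F = "final_mdspace E I (OMap D) c"
  have c_E: "c i \<in> T i \<rightarrow>\<^sub>E E" if "i \<in> I" for i
    using mdspace_homD(1)[OF c_hom[OF that]] that by (auto simp: E_def PiE_def)
  have F: "multipointed_dspace ?F" "topspace (space ?F) = E"
    by (rule multipointed_final topspace_final_mdspace; use diagram_mdspace c_E in simp)+
  have EX: "E \<subseteq> topspace (space X)"
    using c_in by (auto simp: E_def)
  have "is_cocone (poset_cat I R) (MdTop U) D ?F c"
    unfolding is_cocone_def MdTop_simps poset_cat_simps
  proof (intro conjI ballI F)
    show "small U (topspace (space ?F))"
      using small_subset[OF X_mdspace(2) EX] by (simp add: F)
    show "c j \<in> mdspace_hom (OMap D j) ?F" if "j \<in> I" for j
      by (rule final_mdspace_hom) (use diagram_mdspace c_E that in auto)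
    show "compose (T i) (c j) (HMap D i j f) = c i" if "f \<in> (if (i, j) \<in> R then {()} else {})" for i j f
      using that c_compose_m by (simp split: if_splits)
  qed
  from ex1_implies_ex[OF universal[OF this]] obtain h
    where h: "h \<in> mdspace_hom X ?F" and h_c: "\<forall>j\<in>I. compose (T j) h (c j) = c j"
    by (elim exE conjE)
  have "(\<lambda>x\<in>E. x) \<in> mdspace_hom ?F X"
  proof (rule hom_from_final_mdspace)
    show "compose (T j) (\<lambda>x\<in>E. x) (c j) \<in> mdspace_hom (OMap D j) X" if "j \<in> I" for j
      unfolding compose_id_left[OF c_E[OF that]] by (rule c_hom[OF that])
    show "(\<lambda>x\<in>E. x) \<in> E \<rightarrow>\<^sub>E topspace (space X)"
      using EX by auto
  qed (use diagram_mdspace c_E X_mdspace in auto)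
  from mdspace_hom_compose[OF X_mdspace(1) h this]
  have r: "compose (topspace (space X)) (\<lambda>x\<in>E. x) h \<in> mdspace_hom X X" .
  have "compose (T j) (compose (topspace (space X)) (\<lambda>x\<in>E. x) h) (c j) = c j" if j: "j \<in> I" for j
  proof -
    have "compose (T j) (compose (topspace (space X)) (\<lambda>x\<in>E. x) h) (c j)
        = compose (T j) (\<lambda>x\<in>E. x) (compose (T j) h (c j))"
      by (rule compose_assoc_PiE[OF mdspace_homD(5)[OF c_hom[OF j]]])
    then show ?thesis
      by (simp add: bspec[OF h_c j] compose_id_left[OF c_E[OF j]])
  qed
  moreover have "compose (T j) (\<lambda>x\<in>topspace (space X). x) (c j) = c j" if j: "j \<in> I" for j
    by (rule compose_id_left[OF mdspace_homD(5)[OF c_hom[OF j]]])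
  ultimately have id: "compose (topspace (space X)) (\<lambda>x\<in>E. x) h = (\<lambda>x\<in>topspace (space X). x)"
    using universal[OF cocone] r mdspace_hom_id[OF X_mdspace(1)] by blast
  have hx: "h x \<in> E \<and> h x = x" if x: "x \<in> topspace (space X)" for x
  proof -
    have "h x \<in> E"
      using mdspace_homD(6)[OF h x] by (simp add: F)
    then show ?thesis
      using fun_cong[OF id, of x] x by (simp add: compose_eq)
  qed
  then show topX: "topspace (space X) = E"
    using EX by force
  have "h = (\<lambda>x\<in>E. x)"
    using hx mdspace_homD(1)[OF h] by (intro ext) (auto simp: topX extensional_def)
  then show "(\<lambda>x\<in>E. x) \<in> mdspace_hom X ?F"
    using h by simp
qed

lemma c_surj:
  assumes "x \<in> topspace (space X)"
  obtains i y where "i \<in> I" "y \<in> T i" "c i y = x"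
  using assms unfolding hom_to_final(1) by blast

text \<open>Continuity of this identity makes sets open in the final topology open in
  \<open>X\<close>; its effect on states and paths shows that those of \<open>X\<close> come from
  the stages.\<close>

lemma hom_to_final':
  "(\<lambda>x\<in>topspace (space X). x) \<in> mdspace_hom X (final_mdspace (topspace (space X)) I (OMap D) c)"
  using hom_to_final by simp

lemma openin_colimit:
  assumes V: "V \<subseteq> topspace (space X)"
    and op: "\<And>i. i \<in> I \<Longrightarrow> openin (space (OMap D i)) {y \<in> T i. c i y \<in> V}"
  shows "openin (space X) V"
proof -
  have "openin (space (final_mdspace (topspace (space X)) I (OMap D) c)) V"
    using assms by (simp add: final_mdspace_def openin_final_topology)
  from openin_continuous_map_preimage[OF mdspace_homD(2)[OF hom_to_final'] this]
  have "openin (space X) {x \<in> topspace (space X). (\<lambda>x\<in>topspace (space X). x) x \<in> V}" .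
  moreover have "{x \<in> topspace (space X). (\<lambda>x\<in>topspace (space X). x) x \<in> V} = V"
    using V by auto
  ultimately show ?thesis
    by simp
qed

lemma states_colimit:
  assumes "x \<in> states X"
  obtains i y where "i \<in> I" "y \<in> states (OMap D i)" "c i y = x"
proof -
  have "x \<in> topspace (space X)"
    using assms multipointed_dspaceD(2)[OF X_mdspace(1)] by blast
  then have "x \<in> states (final_mdspace (topspace (space X)) I (OMap D) c)"
    using mdspace_homD(3)[OF hom_to_final' assms] by simp
  then show ?thesis
    using that by (auto simp: final_mdspace_def)
qed

lemma compose_c_m:
  assumes "(i, j) \<in> R" "\<phi> \<in> dpaths (OMap D i)"
  shows "compose {0..1} (c j) (compose {0..1} (m i j) \<phi>) = compose {0..1} (c i) \<phi>"
proof (rule compose_eqI)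
  fix t :: real
  assume t: "t \<in> {0..1}"
  have "\<phi> t \<in> T i"
    using multipointed_dspaceD(6)[OF diagram_mdspace[OF R_in(1)[OF assms(1)]] assms(2)] t by (rule funcset_mem)
  then show "c j (compose {0..1} (m i j) \<phi> t) = c i (\<phi> t)"
    using t c_m[OF assms(1)] by (simp add: compose_eq)
qed

text \<open>If two images are composable, the matching endpoints are equal in the colimit, hence
  already at a later stage by \<open>glue\<close>. There the paths themselves can be
  concatenated.\<close>

lemma path_closure_image_dpaths:
  assumes "\<phi> \<in> path_closure (image_dpaths I (OMap D) c)"
  shows "\<exists>i \<phi>'. i \<in> I \<and> \<phi>' \<in> dpaths (OMap D i) \<and> \<phi> = compose {0..1} (c i) \<phi>'"
  using assms
proof induction
  case (base \<phi>)
  then show ?case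
    by (auto simp: image_dpaths_def)
next
  case (concat \<phi>1 \<phi>2)
  from concat.IH obtain i \<phi>1' j \<phi>2'
    where i: "i \<in> I" "\<phi>1' \<in> dpaths (OMap D i)" "\<phi>1 = compose {0..1} (c i) \<phi>1'"
      and j: "j \<in> I" "\<phi>2' \<in> dpaths (OMap D j)" "\<phi>2 = compose {0..1} (c j) \<phi>2'"
    by (elim exE conjE)
  have "\<phi>1' 1 \<in> T i" "\<phi>2' 0 \<in> T j"
    using funcset_mem[OF multipointed_dspaceD(6)[OF diagram_mdspace[OF i(1)] i(2)], of 1]
      funcset_mem[OF multipointed_dspaceD(6)[OF diagram_mdspace[OF j(1)] j(2)], of 0]
    by simp_all
  moreover have "c i (\<phi>1' 1) = c j (\<phi>2' 0)"
    using concat.hyps(3) i(3) j(3) by (simp add: compose_eq)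
  ultimately obtain k where k: "(i, k) \<in> R" "(j, k) \<in> R" "m i k (\<phi>1' 1) = m j k (\<phi>2' 0)"
    by (rule glue[OF i(1) j(1)])
  let ?\<phi> = "path_concat (compose {0..1} (m i k) \<phi>1') (compose {0..1} (m j k) \<phi>2')"
  have "?\<phi> \<in> dpaths (OMap D k)"
    by (rule multipointed_dspaceD(4)[OF diagram_mdspace[OF R_in(2)[OF k(1)]]
          mdspace_homD(4)[OF m_hom[OF k(1)] i(2)] mdspace_homD(4)[OF m_hom[OF k(2)] j(2)]])
      (simp add: compose_eq k(3))
  moreover have "compose {0..1} (c k) ?\<phi> = path_concat \<phi>1 \<phi>2"
    by (simp only: compose_path_concat compose_c_m[OF k(1) i(2)] compose_c_m[OF k(2) j(2)] i(3) j(3))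
  ultimately show ?case
    using R_in(2)[OF k(1)] by metis
next
  case (reparam \<phi> \<psi>)
  from reparam.IH obtain i \<phi>'
    where i: "i \<in> I" "\<phi>' \<in> dpaths (OMap D i)" "\<phi> = compose {0..1} (c i) \<phi>'"
    by (elim exE conjE)
  have "compose {0..1} \<phi>' \<psi> \<in> dpaths (OMap D i)"
    by (rule multipointed_dspaceD(5)[OF diagram_mdspace[OF i(1)] i(2) reparam.hyps(2)])
  moreover have "compose {0..1} \<phi> \<psi> = compose {0..1} (c i) (compose {0..1} \<phi>' \<psi>)"
    by (simp only: i(3) compose_reparam[OF reparam.hyps(2)])
  ultimately show ?case
    using i(1) by (intro exI conjI)
qed

lemma dpaths_colimit:
  assumes \<phi>: "\<phi> \<in> dpaths X"
  obtains i \<phi>' where "i \<in> I" "\<phi>' \<in> dpaths (OMap D i)" "\<phi> = compose {0..1} (c i) \<phi>'"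
proof -
  have "compose {0..1} (\<lambda>x\<in>topspace (space X). x) \<phi> = \<phi>"
    by (rule compose_restrict_path[where S = "topspace (space X)"])
      (use multipointed_dspaceD(3,6)[OF X_mdspace(1) \<phi>] in \<open>auto simp: state_path_def\<close>)
  then have "\<phi> \<in> dpaths (final_mdspace (topspace (space X)) I (OMap D) c)"
    using mdspace_homD(4)[OF hom_to_final' \<phi>] by simp
  then have "\<phi> \<in> path_closure (image_dpaths I (OMap D) c)"
    by (simp add: final_mdspace_def)
  from path_closure_image_dpaths[OF this] show ?thesis
    by (elim exE conjE) (rule that)
qed

subsection \<open>Lifting maps to a stage of the diagram\<close>

text \<open>Each value has a preimage at its own stage, and few stages have an upper bound. Only
  points are lifted; compatibility with the structure is arranged later by moving further along the
  diagram.\<close>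

lemma function_lift:
  assumes S: "few S" and g: "g \<in> S \<rightarrow> topspace (space X)"
  obtains i g' where "i \<in> I" "g' \<in> S \<rightarrow> T i" "\<And>x. x \<in> S \<Longrightarrow> c i (g' x) = g x"
proof -
  have "\<exists>j y. j \<in> I \<and> y \<in> T j \<and> c j y = g x" if "x \<in> S" for x
    using c_surj[OF funcset_mem[OF g that]] by blast
  then obtain j y where jy: "\<And>x. x \<in> S \<Longrightarrow> j x \<in> I" "\<And>x. x \<in> S \<Longrightarrow> y x \<in> T (j x)"
    "\<And>x. x \<in> S \<Longrightarrow> c (j x) (y x) = g x"
    by metis
  have "j ` S \<subseteq> I"
    using jy(1) by blast
  then obtain u where u: "u \<in> I" "\<forall>s\<in>j ` S. (s, u) \<in> R"
    by (rule upper_bound[OF _ few_image[OF S]])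
  have ju: "(j x, u) \<in> R" if "x \<in> S" for x
    using u(2) that by blast
  show ?thesis
  proof (rule that[OF u(1)])
    show "(\<lambda>x. m (j x) u (y x)) \<in> S \<rightarrow> T u"
      by (rule funcsetI) (rule m_in[OF ju jy(2)])
    show "c u (m (j x) u (y x)) = g x" if "x \<in> S" for x
      using c_m[OF ju[OF that] jy(2)[OF that]] jy(3)[OF that] by simp
  qed
qed

lemma function_glue:
  assumes S: "few S" and i: "i \<in> I" and p: "p \<in> S \<rightarrow> T i" and q: "q \<in> S \<rightarrow> T i"
    and eq: "\<And>x. x \<in> S \<Longrightarrow> c i (p x) = c i (q x)"
  shows "\<exists>j. (i, j) \<in> R \<and> (\<forall>x\<in>S. m i j (p x) = m i j (q x))"
proof (rule eventually_all[OF S i, of "\<lambda>x j. m i j (p x) = m i j (q x)"])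
  show "\<exists>j. (i, j) \<in> R \<and> m i j (p x) = m i j (q x)" if x: "x \<in> S" for x
    using glue[OF i i funcset_mem[OF p x] funcset_mem[OF q x] eq[OF x]] by blast
  show "m i k (p x) = m i k (q x)"
    if "x \<in> S" "(i, j) \<in> R" "(j, k) \<in> R" "m i j (p x) = m i j (q x)" for x j k
    using m_trans[OF that(2,3) funcset_mem[OF p that(1)]] m_trans[OF that(2,3) funcset_mem[OF q that(1)]]
      that(4) by simp
qed

text \<open>
  A simplex of the colimit is already continuous at some stage. Otherwise, since there are few
  subsets \<open>W\<close> of the simplex, one non-open \<open>W\<close> is the preimage of an open set at every stage.
  The largest such open sets \<open>N j\<close> are compatible enough to define an open subset of the colimit
  with preimage \<open>W\<close>.
\<close>

lemma simplex_lift: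
  assumes i: "i \<in> I" and f: "f \<in> standard_simplex n \<rightarrow> T i"
    and cont: "continuous_map (simplex_top n) (space X) (\<lambda>x. c i (f x))"
  shows "\<exists>j. (i, j) \<in> R \<and> continuous_map (simplex_top n) (space (OMap D j)) (\<lambda>x. m i j (f x))"
proof (rule ccontr)
  assume not_cont: "\<not> ?thesis"
  have mf: "m i j (f x) \<in> T j" if "(i, j) \<in> R" "x \<in> standard_simplex n" for j x
    by (rule m_in[OF that(1) funcset_mem[OF f that(2)]])
  have mmf: "m j k (m i j (f x)) = m i k (f x)"
    if "(i, j) \<in> R" "(j, k) \<in> R" "x \<in> standard_simplex n" for j k x
    by (rule m_trans[OF that(1,2) funcset_mem[OF f that(3)]])
  define pre where "pre j V = {x \<in> standard_simplex n. m i j (f x) \<in> V}" for j V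
  \<comment> \<open>\<open>bad W j\<close> says that \<open>W\<close> is the preimage of an open set
    of stage \<open>j\<close>. For a non-open \<open>W\<close> this is a witness against continuity
    at \<open>j\<close>.\<close>
  define bad where "bad W j \<longleftrightarrow> (\<exists>V. openin (space (OMap D j)) V \<and> pre j V = W)" for W j
  \<comment> \<open>Open sets of a later stage pull back without changing their preimage in the
    simplex. So a set that is not bad at one stage is not bad at any later one, as
    \<open>eventually_all\<close> requires.\<close>
  have pull: "openin (space (OMap D j)) {z \<in> T j. m j k z \<in> V} \<and> pre j {z \<in> T j. m j k z \<in> V} = pre k V"
    if "(i, j) \<in> R" "(j, k) \<in> R" "openin (space (OMap D k)) V" for j k V
  proof
    show "openin (space (OMap D j)) {z \<in> T j. m j k z \<in> V}"
      by (rule openin_continuous_map_preimage[OF mdspace_homD(2)[OF m_hom[OF that(2)]] that(3)])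
    show "pre j {z \<in> T j. m j k z \<in> V} = pre k V"
      unfolding pre_def using mf[OF that(1)] mmf[OF that(1,2)] by auto
  qed
  have "\<exists>W. \<not> openin (simplex_top n) W \<and> (\<forall>j. (i, j) \<in> R \<longrightarrow> bad W j)"
  proof (rule ccontr)
    assume none: "\<not> ?thesis"
    let ?S = "{W. \<not> openin (simplex_top n) W}"
    have "few ?S"
      by (rule few_subset[OF few_Pow_nat_real subset_UNIV])
    then have "\<exists>j. (i, j) \<in> R \<and> (\<forall>W\<in>?S. \<not> bad W j)"
    proof (rule eventually_all[OF _ i])
      show "\<exists>j. (i, j) \<in> R \<and> \<not> bad W j" if "W \<in> ?S" for W
        using none that by blast
      show "\<not> bad W k" if jk: "(i, j) \<in> R" "(j, k) \<in> R" "\<not> bad W j" for W j k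
      proof
        assume "bad W k"
        then obtain V where "openin (space (OMap D k)) V" "pre k V = W"
          by (auto simp: bad_def)
        then have "bad W j"
          unfolding bad_def using pull[OF jk(1,2)] by blast
        then show False
          using jk(3) by contradiction
      qed
    qed
    then obtain j where j: "(i, j) \<in> R" "\<forall>W\<in>?S. \<not> bad W j"
      by (elim exE conjE)
    have "continuous_map (simplex_top n) (space (OMap D j)) (\<lambda>x. m i j (f x))"
      unfolding continuous_map_def
    proof (intro conjI allI impI)
      show "(\<lambda>x. m i j (f x)) \<in> topspace (simplex_top n) \<rightarrow> T j"
        using mf[OF j(1)] by simp
      fix V
      assume "openin (space (OMap D j)) V"
      then have "bad (pre j V) j"
        by (auto simp: bad_def)
      then have "openin (simplex_top n) (pre j V)"
        using j(2) by blast
      then show "openin (simplex_top n) {x \<in> topspace (simplex_top n). m i j (f x) \<in> V}"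
        by (simp add: pre_def)
    qed
    then show False
      using not_cont j(1) by blast
  qed
  then obtain W where W: "\<not> openin (simplex_top n) W" and bad: "\<And>j. (i, j) \<in> R \<Longrightarrow> bad W j"
    by blast
  define Vs where "Vs j = {V. openin (space (OMap D j)) V \<and> pre j V = W}" for j
  define N where "N j = \<Union>(Vs j)" for j
  have N_open: "openin (space (OMap D j)) (N j)" for j
    unfolding N_def by (rule openin_Union) (simp add: Vs_def)
  have N_pre: "x \<in> W \<longleftrightarrow> x \<in> standard_simplex n \<and> m i j (f x) \<in> N j" if j: "(i, j) \<in> R" for x j
  proof -
    obtain V where V: "V \<in> Vs j"
      using bad[OF j] by (auto simp: bad_def Vs_def)
    have "x \<in> W \<longleftrightarrow> x \<in> standard_simplex n \<and> m i j (f x) \<in> V'" if "V' \<in> Vs j" for V'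
      using that by (auto simp: Vs_def pre_def)
    then show ?thesis
      unfolding N_def using V by blast
  qed
  \<comment> \<open>This is where it matters that \<open>N j\<close> is the largest choice: the
    pullback of a candidate at \<open>k\<close> is a candidate at \<open>j\<close>.\<close>
  have N_mono: "z \<in> N j" if jk: "(i, j) \<in> R" "(j, k) \<in> R" and z: "z \<in> T j" "m j k z \<in> N k" for j k z
  proof -
    obtain V where V: "openin (space (OMap D k)) V" "pre k V = W" "m j k z \<in> V"
      using z(2) by (auto simp: N_def Vs_def)
    have "{z \<in> T j. m j k z \<in> V} \<in> Vs j"
      using pull[OF jk V(1)] V(2) by (simp add: Vs_def)
    then show ?thesis
      unfolding N_def using z(1) V(3) by blast
  qed
  \<comment> \<open>All representatives above \<open>i\<close> are required to lie in
    \<open>N\<close>. By \<open>N_mono\<close>, a representative outside \<open>N\<close> stays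
    outside at later stages, so one failure can be compared with any other representative.\<close>
  define Q where "Q = {y \<in> topspace (space X). \<forall>j. (i, j) \<in> R \<longrightarrow> (\<forall>z\<in>T j. c j z = y \<longrightarrow> z \<in> N j)}"
  have Q_N: "z \<in> N j" if "(i, j) \<in> R" "z \<in> T j" "c j z \<in> Q" for j z
    using that by (simp add: Q_def)
  have "openin (space X) Q"
  proof (rule openin_colimit)
    show "Q \<subseteq> topspace (space X)"
      by (auto simp: Q_def)
    fix j
    assume j: "j \<in> I"
    show "openin (space (OMap D j)) {z \<in> T j. c j z \<in> Q}"
    proof (rule delta_generated_openI[OF multipointed_dspaceD(1)[OF diagram_mdspace[OF j]]])
      fix l s
      assume s: "continuous_map (simplex_top l) (space (OMap D j)) s"
      have sT: "s p \<in> T j" if "p \<in> standard_simplex l" for p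
        using continuous_map_funspace[OF s] that by (auto simp: Pi_iff)
      \<comment> \<open>At such a stage \<open>k\<close>, membership in \<open>Q\<close> is decided
        by \<open>N k\<close>: a point of \<open>Q\<close> has all its representatives in
        \<open>N\<close>, while for a point outside \<open>Q\<close> a failing representative is
        glued to \<open>s p\<close>. As a simplex has few points, one \<open>k\<close> serves all
        \<open>p\<close>.\<close>
      have "\<exists>k. (j, k) \<in> R \<and> (i, k) \<in> R \<and> (c j (s p) \<in> Q \<or> m j k (s p) \<notin> N k)"
        if p: "p \<in> standard_simplex l" for p
      proof (cases "c j (s p) \<in> Q")
        case True
        then show ?thesis
          using upper_bound2[OF i j] by blast
      next
        case False
        then obtain j' z where j': "(i, j') \<in> R" and z: "z \<in> T j'" "c j' z = c j (s p)" "z \<notin> N j'"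
          using c_in[OF j sT[OF p]] by (auto simp: Q_def)
        obtain k where k: "(j', k) \<in> R" "(j, k) \<in> R" "m j' k z = m j k (s p)"
          by (rule glue[OF R_in(2)[OF j'] j z(1) sT[OF p] z(2)])
        have "m j k (s p) \<notin> N k"
          using N_mono[OF j' k(1) z(1)] z(3) k(3) by auto
        then show ?thesis
          using k(2) R_trans[OF j' k(1)] by blast
      qed
      then have "\<exists>k. (j, k) \<in> R \<and>
          (\<forall>p\<in>standard_simplex l. (i, k) \<in> R \<and> (c j (s p) \<in> Q \<or> m j k (s p) \<notin> N k))"
      proof (rule eventually_all[OF few_nat_real[of "standard_simplex l"] j])
        fix p k k'
        assume p: "p \<in> standard_simplex l" and k: "(j, k) \<in> R" "(k, k') \<in> R"
          and P: "(i, k) \<in> R \<and> (c j (s p) \<in> Q \<or> m j k (s p) \<notin> N k)"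
        have "m j k (s p) \<in> N k" if "m j k' (s p) \<in> N k'"
          using N_mono[of k k' "m j k (s p)"] m_trans[OF k sT[OF p]] that P k(2) m_in[OF k(1) sT[OF p]]
          by simp
        then show "(i, k') \<in> R \<and> (c j (s p) \<in> Q \<or> m j k' (s p) \<notin> N k')"
          using P R_trans[of i k k'] k(2) by blast
      qed
      then obtain k where k: "(j, k) \<in> R"
        and kp: "\<forall>p\<in>standard_simplex l. (i, k) \<in> R \<and> (c j (s p) \<in> Q \<or> m j k (s p) \<notin> N k)"
        by (elim exE conjE)
      \<comment> \<open>The relation of \<open>i\<close> to \<open>k\<close> was carried inside the
        property of each point, so a point is needed to extract it.\<close>
      obtain p0 where "p0 \<in> standard_simplex l"
        using nonempty_standard_simplex by blast
      then have ik: "(i, k) \<in> R"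
        using kp by blast
      have "s p \<in> {z \<in> T j. c j z \<in> Q} \<longleftrightarrow> m j k (s p) \<in> N k" if p: "p \<in> standard_simplex l" for p
        using bspec[OF kp p] sT[OF p] Q_N[OF ik m_in[OF k sT[OF p]]] c_m[OF k sT[OF p]] by auto
      then have "{p \<in> standard_simplex l. s p \<in> {z \<in> T j. c j z \<in> Q}}
          = {p \<in> standard_simplex l. m j k (s p) \<in> N k}"
        by blast
      moreover have "openin (simplex_top l) {p \<in> topspace (simplex_top l). (m j k \<circ> s) p \<in> N k}"
        by (rule openin_continuous_map_preimage[OF
              continuous_map_compose[OF s mdspace_homD(2)[OF m_hom[OF k]]] N_open])
      ultimately show "openin (simplex_top l) {p \<in> standard_simplex l. s p \<in> {z \<in> T j. c j z \<in> Q}}"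
        by simp
    qed blast
  qed
  from openin_continuous_map_preimage[OF cont this]
  have "openin (simplex_top n) {x \<in> standard_simplex n. c i (f x) \<in> Q}"
    by simp
  \<comment> \<open>From right to left, any representative of \<open>c i (f x)\<close> is glued to
    \<open>f x\<close> at some \<open>k\<close>, where \<open>N_pre\<close> puts the common value
    into \<open>N k\<close>; \<open>N_mono\<close> brings this back.\<close>
  moreover have "c i (f x) \<in> Q \<longleftrightarrow> x \<in> W" if x: "x \<in> standard_simplex n" for x
  proof
    have fx: "f x \<in> T i"
      by (rule funcset_mem[OF f x])
    show "x \<in> W" if "c i (f x) \<in> Q"
      using Q_N[OF R_refl[OF i] fx that] N_pre[OF R_refl[OF i], of x] m_id[OF i fx] x by simp
    show "c i (f x) \<in> Q" if xW: "x \<in> W"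
      unfolding Q_def
    proof (intro CollectI conjI allI impI ballI c_in[OF i fx])
      fix j z
      assume j: "(i, j) \<in> R" and z: "z \<in> T j" "c j z = c i (f x)"
      obtain k where k: "(j, k) \<in> R" "(i, k) \<in> R" "m j k z = m i k (f x)"
        by (rule glue[OF R_in(2)[OF j] i z(1) fx z(2)])
      show "z \<in> N j"
        using N_mono[OF j k(1) z(1)] N_pre[OF k(2), of x] xW k(3) by simp
    qed
  qed
  moreover have "W \<subseteq> standard_simplex n"
    using N_pre[OF R_refl[OF i]] by blast
  ultimately have "openin (simplex_top n) W"
    by (smt (verit, best) Collect_cong Collect_mem_eq subsetD)
  then show False
    using W by contradiction
qed

end

section \<open>Lifting and gluing morphisms from objects with few points\<close>

context directed_colimit
begin

text \<open>A lift \<open>g0\<close> of the underlying function is chosen at a stage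
  \<open>i\<close>. Becoming a morphism further along means one condition per state, path and
  simplex of \<open>K\<close>; each holds from some stage on and there are few of them, so a common
  stage \<open>u\<close> exists.\<close>

lemma hom_lift:
  assumes K: "multipointed_dspace K" and few: "few (topspace (space K))" and g: "g \<in> mdspace_hom K X"
  shows "\<exists>i g'. i \<in> I \<and> g' \<in> mdspace_hom K (OMap D i) \<and> compose (topspace (space K)) (c i) g' = g"
proof -
  let ?K = "topspace (space K)"
  have "g \<in> ?K \<rightarrow> topspace (space X)"
    using mdspace_homD(6)[OF g] by (rule funcsetI)
  then obtain i g0 where i: "i \<in> I" and g0: "g0 \<in> ?K \<rightarrow> T i" and c_g0: "\<And>x. x \<in> ?K \<Longrightarrow> c i (g0 x) = g x"
    by (rule function_lift[OF few]) blast
  have mg0: "m i j (g0 x) \<in> T j" if "(i, j) \<in> R" "x \<in> ?K" for j x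
    by (rule m_in[OF that(1) funcset_mem[OF g0 that(2)]])
  have mmg0: "m j k (m i j (g0 x)) = m i k (g0 x)" if "(i, j) \<in> R" "(j, k) \<in> R" "x \<in> ?K" for j k x
    by (rule m_trans[OF that(1,2) funcset_mem[OF g0 that(3)]])
  have \<phi>_in: "\<phi> t \<in> ?K" if "\<phi> \<in> dpaths K" "t \<in> {0..1}" for \<phi> t
    by (rule funcset_mem[OF multipointed_dspaceD(6)[OF K that(1)] that(2)])

  define st where "st x j \<longleftrightarrow> m i j (g0 x) \<in> states (OMap D j)" for x j
  have st_mono: "st x k" if "x \<in> states K" "(i, j) \<in> R" "(j, k) \<in> R" "st x j" for x j k
    using mdspace_homD(3)[OF m_hom[OF that(3)], of "m i j (g0 x)"] that(4)
      mmg0[OF that(2,3)] multipointed_dspaceD(2)[OF K] that(1) by (auto simp: st_def)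
  have "\<exists>j. (i, j) \<in> R \<and> (\<forall>x\<in>states K. st x j)"
  proof (rule eventually_all[OF few_subset[OF few multipointed_dspaceD(2)[OF K]] i])
    fix x
    assume x: "x \<in> states K"
    then have xK: "x \<in> ?K"
      using multipointed_dspaceD(2)[OF K] by blast
    obtain k y where k: "k \<in> I" and y: "y \<in> states (OMap D k)" "c k y = g x"
      using states_colimit[OF mdspace_homD(3)[OF g x]] .
    have "y \<in> T k"
      using multipointed_dspaceD(2)[OF diagram_mdspace[OF k]] y(1) by blast
    then obtain l where l: "(i, l) \<in> R" "(k, l) \<in> R" "m i l (g0 x) = m k l y"
      using glue[OF i k funcset_mem[OF g0 xK], of y] c_g0[OF xK] y(2) by auto
    then show "\<exists>j. (i, j) \<in> R \<and> st x j"
      using mdspace_homD(3)[OF m_hom[OF l(2)] y(1)] by (auto simp: st_def)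
  qed (rule st_mono)
  then obtain j1 where j1: "(i, j1) \<in> R" "\<forall>x\<in>states K. st x j1"
    by (elim exE conjE)

  define pa where "pa \<phi> j \<longleftrightarrow> compose {0..1} (\<lambda>x. m i j (g0 x)) \<phi> \<in> dpaths (OMap D j)" for \<phi> j
  have pa_mono: "pa \<phi> k" if "\<phi> \<in> dpaths K" "(i, j) \<in> R" "(j, k) \<in> R" "pa \<phi> j" for \<phi> j k
  proof -
    have "compose {0..1} (m j k) (compose {0..1} (\<lambda>x. m i j (g0 x)) \<phi>) = compose {0..1} (\<lambda>x. m i k (g0 x)) \<phi>"
      by (rule compose_eqI) (simp add: compose_eq mmg0[OF that(2,3) \<phi>_in[OF that(1)]])
    then show ?thesis
      using mdspace_homD(4)[OF m_hom[OF that(3)] that(4)[unfolded pa_def]] by (simp add: pa_def)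
  qed
  have "\<exists>j. (i, j) \<in> R \<and> (\<forall>\<phi>\<in>dpaths K. pa \<phi> j)"
  proof (rule eventually_all[OF _ i])
    have "dpaths K \<subseteq> {0..1} \<rightarrow>\<^sub>E ?K"
      using multipointed_dspaceD(3,6)[OF K] by (auto simp: PiE_def state_path_def)
    then show "few (dpaths K)"
      by (rule few_subset[OF few_PiE[OF continuum_real few]])
  next
    fix \<phi>
    assume \<phi>: "\<phi> \<in> dpaths K"
    obtain k \<phi>' where k: "k \<in> I" and \<phi>': "\<phi>' \<in> dpaths (OMap D k)"
      and eq: "compose {0..1} g \<phi> = compose {0..1} (c k) \<phi>'"
      using dpaths_colimit[OF mdspace_homD(4)[OF g \<phi>]] .
    have \<phi>'_in: "\<phi>' t \<in> T k" if "t \<in> {0..1}" for t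
      by (rule funcset_mem[OF multipointed_dspaceD(6)[OF diagram_mdspace[OF k] \<phi>'] that])
    obtain l where l: "(i, l) \<in> R" "(k, l) \<in> R"
      using upper_bound2[OF i k] .
    \<comment> \<open>The composite of \<open>g0\<close> with \<open>\<phi>\<close> need not be the
      lift \<open>\<phi>'\<close> supplied by the colimit. They agree pointwise in \<open>X\<close>,
      hence at some later stage on the whole interval, which has few points.\<close>
    have "\<exists>n. (l, n) \<in> R \<and> (\<forall>t\<in>{0..1}. m l n (m i l (g0 (\<phi> t))) = m l n (m k l (\<phi>' t)))"
    proof (rule function_glue[OF continuum_few[OF continuum_real] R_in(2)[OF l(1)]])
      show "(\<lambda>t. m i l (g0 (\<phi> t))) \<in> {0..1} \<rightarrow> T l"
        by (rule funcsetI) (rule mg0[OF l(1) \<phi>_in[OF \<phi>]])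
      show "(\<lambda>t. m k l (\<phi>' t)) \<in> {0..1} \<rightarrow> T l"
        by (rule funcsetI) (rule m_in[OF l(2) \<phi>'_in])
      show "c l (m i l (g0 (\<phi> t))) = c l (m k l (\<phi>' t))" if t: "t \<in> {0..1}" for t
        using fun_cong[OF eq, of t] c_m[OF l(1) funcset_mem[OF g0 \<phi>_in[OF \<phi> t]]]
          c_m[OF l(2) \<phi>'_in[OF t]] c_g0[OF \<phi>_in[OF \<phi> t]]
        unfolding compose_eq[OF t] by simp
    qed
    then obtain n where n: "(l, n) \<in> R"
      and ln: "\<forall>t\<in>{0..1}. m l n (m i l (g0 (\<phi> t))) = m l n (m k l (\<phi>' t))"
      by (elim exE conjE)
    have "compose {0..1} (\<lambda>x. m i n (g0 x)) \<phi> = compose {0..1} (m k n) \<phi>'"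
    proof (rule compose_eqI)
      fix t :: real
      assume t: "t \<in> {0..1}"
      show "m i n (g0 (\<phi> t)) = m k n (\<phi>' t)"
        using bspec[OF ln t] unfolding mmg0[OF l(1) n \<phi>_in[OF \<phi> t]] m_trans[OF l(2) n \<phi>'_in[OF t]] .
    qed
    then have "pa \<phi> n"
      using mdspace_homD(4)[OF m_hom[OF R_trans[OF l(2) n]] \<phi>'] by (simp add: pa_def)
    then show "\<exists>j. (i, j) \<in> R \<and> pa \<phi> j"
      using R_trans[OF l(1) n] by (intro exI conjI)
  qed (rule pa_mono)
  then obtain j2 where j2: "(i, j2) \<in> R" "\<forall>\<phi>\<in>dpaths K. pa \<phi> j2"
    by (elim exE conjE)

  define si where "si s j \<longleftrightarrow>
    continuous_map (simplex_top (fst s)) (space (OMap D j)) (\<lambda>x. m i j (g0 (snd s x)))" for s j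
  \<comment> \<open>Simplices are normalised to be undefined outside their domain, so that
    \<open>few_PiE\<close> can count them; an arbitrary simplex is restricted before use.\<close>
  define Si where "Si = {s. snd s \<in> standard_simplex (fst s) \<rightarrow>\<^sub>E ?K \<and>
    continuous_map (simplex_top (fst s)) (space K) (snd s)}"
  have si_mono: "si s k" if s: "s \<in> Si" and jk: "(i, j) \<in> R" "(j, k) \<in> R" "si s j" for s j k
    unfolding si_def
  proof (rule continuous_map_eq)
    show "continuous_map (simplex_top (fst s)) (space (OMap D k)) (m j k \<circ> (\<lambda>x. m i j (g0 (snd s x))))"
      by (rule continuous_map_compose[OF jk(3)[unfolded si_def] mdspace_homD(2)[OF m_hom[OF jk(2)]]])
    show "(m j k \<circ> (\<lambda>x. m i j (g0 (snd s x)))) x = m i k (g0 (snd s x))"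
      if "x \<in> topspace (simplex_top (fst s))" for x
    proof -
      have "snd s x \<in> ?K"
        using s that by (auto simp: Si_def)
      then show ?thesis
        using mmg0[OF jk(1,2)] by simp
    qed
  qed
  have "\<exists>j. (i, j) \<in> R \<and> (\<forall>s\<in>Si. si s j)"
  proof (rule eventually_all[OF _ i])
    have "few (SIGMA n : UNIV. standard_simplex n \<rightarrow>\<^sub>E ?K)"
      by (rule few_Sigma[OF few_nat few_PiE[OF card_of_mono1[OF subset_UNIV] few]])
    then show "few Si"
      by (rule few_subset) (auto simp: Si_def)
  next
    fix s
    assume s: "s \<in> Si"
    have in_K: "snd s x \<in> ?K" if "x \<in> standard_simplex (fst s)" for x
      using s that by (auto simp: Si_def)
    have "\<exists>j. (i, j) \<in> R \<and>
        continuous_map (simplex_top (fst s)) (space (OMap D j)) (\<lambda>x. m i j (g0 (snd s x)))"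
    proof (rule simplex_lift[OF i])
      show "(\<lambda>x. g0 (snd s x)) \<in> standard_simplex (fst s) \<rightarrow> T i"
        by (rule funcsetI) (rule funcset_mem[OF g0 in_K])
      have "continuous_map (simplex_top (fst s)) (space X) (g \<circ> snd s)"
        using s by (intro continuous_map_compose[OF _ mdspace_homD(2)[OF g]]) (simp add: Si_def)
      then show "continuous_map (simplex_top (fst s)) (space X) (\<lambda>x. c i (g0 (snd s x)))"
        by (rule continuous_map_eq) (simp add: c_g0 in_K)
    qed
    then show "\<exists>j. (i, j) \<in> R \<and> si s j"
      by (simp only: si_def)
  qed (rule si_mono)
  then obtain j3 where j3: "(i, j3) \<in> R" "\<forall>s\<in>Si. si s j3"
    by (elim exE conjE)

  obtain j4 where j4: "(j1, j4) \<in> R" "(j2, j4) \<in> R"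
    using upper_bound2[OF R_in(2)[OF j1(1)] R_in(2)[OF j2(1)]] .
  obtain u where u: "(j4, u) \<in> R" "(j3, u) \<in> R"
    using upper_bound2[OF R_in(2)[OF j4(1)] R_in(2)[OF j3(1)]] .
  have u1: "(j1, u) \<in> R" "(j2, u) \<in> R"
    using R_trans[OF _ u(1)] j4 by blast+
  have iu: "(i, u) \<in> R"
    by (rule R_trans[OF j3(1) u(2)])
  define g' where "g' = (\<lambda>x\<in>?K. m i u (g0 x))"
  have "g' \<in> mdspace_hom K (OMap D u)"
  proof (rule mdspace_homI)
    show "continuous_map (space K) (space (OMap D u)) g'"
    proof (rule continuous_map_from_delta_generated[OF multipointed_dspaceD(1)[OF K]])
      show "g' \<in> ?K \<rightarrow> T u"
        using mg0[OF iu] by (simp add: g'_def)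
      fix n \<sigma>
      assume \<sigma>: "continuous_map (simplex_top n) (space K) \<sigma>"
      have \<sigma>_in: "\<sigma> x \<in> ?K" if "x \<in> standard_simplex n" for x
        using continuous_map_funspace[OF \<sigma>] that by (auto simp: Pi_iff)
      have "continuous_map (simplex_top n) (space K) (restrict \<sigma> (standard_simplex n))"
        by (rule continuous_map_eq[OF \<sigma>]) simp
      then have "(n, restrict \<sigma> (standard_simplex n)) \<in> Si"
        by (simp add: Si_def \<sigma>_in)
      from si_mono[OF this j3(1) u(2) bspec[OF j3(2) this]]
      show "continuous_map (simplex_top n) (space (OMap D u)) (\<lambda>x. g' (\<sigma> x))"
        unfolding si_def fst_conv snd_conv
        by (rule continuous_map_eq) (simp add: g'_def \<sigma>_in)
    qed
    show "g' ` states K \<subseteq> states (OMap D u)"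
    proof (rule image_subsetI)
      fix x
      assume x: "x \<in> states K"
      then have "x \<in> ?K"
        using multipointed_dspaceD(2)[OF K] by blast
      then show "g' x \<in> states (OMap D u)"
        using st_mono[OF x j1(1) u1(1) bspec[OF j1(2) x]] by (simp add: g'_def st_def)
    qed
    fix \<phi>
    assume \<phi>: "\<phi> \<in> dpaths K"
    have "compose {0..1} g' \<phi> = compose {0..1} (\<lambda>x. m i u (g0 x)) \<phi>"
      by (rule compose_eqI) (simp add: g'_def \<phi>_in[OF \<phi>])
    then show "compose {0..1} g' \<phi> \<in> dpaths (OMap D u)"
      using pa_mono[OF \<phi> j2(1) u1(2) bspec[OF j2(2) \<phi>]] by (simp add: pa_def)
  qed (simp add: g'_def)
  moreover have "compose ?K (c u) g' = g"
  proof (rule ext)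
    fix x
    show "compose ?K (c u) g' x = g x"
    proof (cases "x \<in> ?K")
      case True
      then show ?thesis
        using c_m[OF iu funcset_mem[OF g0 True]] c_g0[OF True] by (simp add: compose_eq g'_def)
    next
      case False
      then show ?thesis
        using mdspace_homD(1)[OF g] by (simp add: compose_def extensional_def)
    qed
  qed
  ultimately show ?thesis
    using R_in(2)[OF iu] by (intro exI conjI)
qed

lemma hom_glue:
  assumes K: "multipointed_dspace K" and few: "few (topspace (space K))" and i: "i \<in> I"
    and g: "g \<in> mdspace_hom K (OMap D i)" and g': "g' \<in> mdspace_hom K (OMap D i)"
    and eq: "compose (topspace (space K)) (c i) g = compose (topspace (space K)) (c i) g'"
  shows "\<exists>j. (i, j) \<in> R \<and>
    compose (topspace (space K)) (m i j) g = compose (topspace (space K)) (m i j) g'"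
proof -
  let ?K = "topspace (space K)"
  have "\<exists>j. (i, j) \<in> R \<and> (\<forall>x\<in>?K. m i j (g x) = m i j (g' x))"
  proof (rule function_glue[OF few i])
    show "g \<in> ?K \<rightarrow> T i" "g' \<in> ?K \<rightarrow> T i"
      using mdspace_homD(6)[OF g] mdspace_homD(6)[OF g'] by (simp_all add: Pi_iff)
    show "c i (g x) = c i (g' x)" if "x \<in> ?K" for x
      using fun_cong[OF eq, of x] that by (simp add: compose_eq)
  qed
  then obtain j where "(i, j) \<in> R" "\<forall>x\<in>?K. m i j (g x) = m i j (g' x)"
    by (elim exE conjE)
  then show ?thesis
    by (intro exI[of _ j] conjI compose_eqI) simp_all
qed

subsection \<open>Presentability\<close>

text \<open>The usual criterion for directed colimits of sets. Equal values from different stages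
  are moved to a common stage, so gluing is only asked for within one stage.\<close>

lemma set_colimitI:
  fixes F :: "('v, unit, 'b set, 'b \<Rightarrow> 'b) functr"
  assumes cocone: "is_cocone (poset_cat I R) (set_cat U) F Y d"
    and F: "\<And>i j x. \<lbrakk>(i, j) \<in> R; x \<in> OMap F i\<rbrakk> \<Longrightarrow> HMap F i j () x \<in> OMap F j"
    and surj: "\<And>y. y \<in> Y \<Longrightarrow> \<exists>i x. i \<in> I \<and> x \<in> OMap F i \<and> d i x = y"
    and glue: "\<And>i x x'. \<lbrakk>i \<in> I; x \<in> OMap F i; x' \<in> OMap F i; d i x = d i x'\<rbrakk>
      \<Longrightarrow> \<exists>j. (i, j) \<in> R \<and> HMap F i j () x = HMap F i j () x'"
  shows "is_colimit (poset_cat I R) (set_cat U) F Y d"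
  unfolding is_colimit_def
proof (intro conjI allI impI cocone)
  have compat: "e j (HMap F i j () x) = e i x"
    if "is_cocone (poset_cat I R) (set_cat U) F Z e" "(i, j) \<in> R" "x \<in> OMap F i" for Z e i j x
  proof -
    have "compose (OMap F i) (e j) (HMap F i j ()) = e i"
      using that(1,2) R_in[OF that(2)] by (simp add: is_cocone_def)
    from fun_cong[OF this, of x] that(3) show ?thesis
      by (simp add: compose_eq)
  qed
  have d_in: "d i \<in> OMap F i \<rightarrow>\<^sub>E Y" if "i \<in> I" for i
    using cocone that by (simp add: is_cocone_def)
  fix Z e
  assume e: "is_cocone (poset_cat I R) (set_cat U) F Z e"
  have e_in: "e i \<in> OMap F i \<rightarrow>\<^sub>E Z" if "i \<in> I" for i
    using e that by (simp add: is_cocone_def)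
  have well: "e i x = e j y"
    if i: "i \<in> I" "x \<in> OMap F i" and j: "j \<in> I" "y \<in> OMap F j" and eq: "d i x = d j y" for i j x y
  proof -
    obtain k where k: "(i, k) \<in> R" "(j, k) \<in> R"
      using upper_bound2[OF i(1) j(1)] .
    have "d k (HMap F i k () x) = d k (HMap F j k () y)"
      using compat[OF cocone k(1) i(2)] compat[OF cocone k(2) j(2)] eq by simp
    from glue[OF R_in(2)[OF k(1)] F[OF k(1) i(2)] F[OF k(2) j(2)] this]
    obtain l where l: "(k, l) \<in> R" "HMap F k l () (HMap F i k () x) = HMap F k l () (HMap F j k () y)"
      by (elim exE conjE)
    show ?thesis
      using compat[OF e l(1) F[OF k(1) i(2)]] compat[OF e l(1) F[OF k(2) j(2)]]
        compat[OF e k(1) i(2)] compat[OF e k(2) j(2)] l(2) by simp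
  qed
  have "\<exists>z\<in>Z. \<forall>i\<in>I. \<forall>x\<in>OMap F i. d i x = y \<longrightarrow> e i x = z" if y: "y \<in> Y" for y
  proof -
    obtain i x where ix: "i \<in> I" "x \<in> OMap F i" "d i x = y"
      using surj[OF y] by (elim exE conjE)
    have "e i x \<in> Z"
      using e_in[OF ix(1)] ix(2) by (rule PiE_mem)
    then show ?thesis
    proof (rule bexI[rotated], intro ballI impI)
      fix j x'
      assume "j \<in> I" "x' \<in> OMap F j" "d j x' = y"
      then show "e j x' = e i x"
        by (intro well ix(1,2)) (simp_all add: ix(3))
    qed
  qed
  then obtain h where h: "\<And>y. y \<in> Y \<Longrightarrow> h y \<in> Z"
    "\<And>y i x. \<lbrakk>y \<in> Y; i \<in> I; x \<in> OMap F i; d i x = y\<rbrakk> \<Longrightarrow> e i x = h y"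
    by metis
  show "\<exists>!h. h \<in> Hom (set_cat U) Y Z \<and>
      (\<forall>j\<in>Ob (poset_cat I R). Cmp (set_cat U) (OMap F j) Y Z h (d j) = e j)"
    unfolding set_cat_simps poset_cat_simps
  proof (rule ex1I[of _ "restrict h Y"], intro conjI ballI)
    show "restrict h Y \<in> Y \<rightarrow>\<^sub>E Z"
      using h(1) by simp
    show "compose (OMap F j) (restrict h Y) (d j) = e j" if j: "j \<in> I" for j
    proof (rule PiE_ext[OF compose_PiE[OF d_in[OF j]] e_in[OF j]])
      show "restrict h Y \<in> Y \<rightarrow>\<^sub>E Z"
        using h(1) by simp
      fix x
      assume x: "x \<in> OMap F j"
      have "d j x \<in> Y"
        using d_in[OF j] x by (rule PiE_mem)
      then show "compose (OMap F j) (restrict h Y) (d j) x = e j x"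
        using h(2)[OF _ j x refl] x by (simp add: compose_eq)
    qed
    fix h'
    assume h': "h' \<in> Y \<rightarrow>\<^sub>E Z \<and> (\<forall>j\<in>I. compose (OMap F j) h' (d j) = e j)"
    show "h' = restrict h Y"
    proof (rule PiE_ext)
      show "h' \<in> Y \<rightarrow>\<^sub>E Z" "restrict h Y \<in> Y \<rightarrow>\<^sub>E Z"
        using h' h(1) by simp_all
      fix y
      assume y: "y \<in> Y"
      then obtain i x where ix: "i \<in> I" "x \<in> OMap F i" "d i x = y"
        using surj[OF y] by (elim exE conjE)
      have "compose (OMap F i) h' (d i) = e i"
        using h' ix(1) by blast
      from fun_cong[OF this, of x] show "h' y = restrict h Y y"
        using h(2)[OF y ix] ix(2,3) y by (simp add: compose_eq)
    qed
  qed
qed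

text \<open>\<open>hom_lift\<close> gives joint surjectivity of the legs and \<open>hom_glue\<close>
  the gluing condition; the rest unwraps \<open>Inr\<close>.\<close>

lemma hom_functor_colimit:
  assumes K: "multipointed_dspace K" and few: "few (topspace (space K))"
  shows "is_colimit (poset_cat I R) (set_cat U) (functor_comp (hom_functor U (MdTop U) K) D)
    (OMap (hom_functor U (MdTop U) K) X) (\<lambda>i. HMap (hom_functor U (MdTop U) K) (OMap D i) X (c i))"
proof -
  let ?K = "topspace (space K)"
  let ?H = "hom_functor U (MdTop U) K"
  let ?F = "functor_comp ?H D"
  have OH [simp]: "OMap ?H Y = Inr ` mdspace_hom K Y" for Y
    by (simp add: hom_functor_def)
  have HH: "HMap ?H Y Z g (Inr h) = Inr (compose ?K g h)" if "h \<in> mdspace_hom K Y" for Y Z g h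
    using that by (simp add: hom_functor_def)
  have OF [simp]: "OMap ?F i = Inr ` mdspace_hom K (OMap D i)" for i
    by (simp add: functor_comp_def)
  have HF: "HMap ?F i j f = HMap ?H (OMap D i) (OMap D j) (HMap D i j f)" for i j f
    by (simp add: functor_comp_def)
  have HPiE: "HMap ?H Y Z g \<in> OMap ?H Y \<rightarrow>\<^sub>E OMap ?H Z" if g: "g \<in> mdspace_hom Y Z" for Y Z g
  proof (rule PiE_I)
    fix p
    assume "p \<in> OMap ?H Y"
    then obtain h where h: "h \<in> mdspace_hom K Y" "p = Inr h"
      by auto
    show "HMap ?H Y Z g p \<in> OMap ?H Z"
      using mdspace_hom_compose[OF K h(1) g] by (simp add: h(2) HH[OF h(1)])
  next
    fix p
    assume "p \<notin> OMap ?H Y"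
    then show "HMap ?H Y Z g p = undefined"
      by (simp add: hom_functor_def)
  qed
  have smallK: "small U ?K"
    by (rule few_small[OF few])
  show ?thesis
  proof (rule set_colimitI)
    show "is_cocone (poset_cat I R) (set_cat U) ?F (OMap ?H X) (\<lambda>i. HMap ?H (OMap D i) X (c i))"
      unfolding is_cocone_def set_cat_simps poset_cat_simps
    proof (intro conjI ballI)
      have "small U (mdspace_hom K X)"
        using locally_small_MdTop K smallK X_mdspace by (simp add: locally_small_def)
      then show "small U (OMap ?H X)"
        by (simp add: small_image)
      show "HMap ?H (OMap D j) X (c j) \<in> OMap ?F j \<rightarrow>\<^sub>E OMap ?H X" if "j \<in> I" for j
        using HPiE[OF c_hom[OF that]] by simp
      fix i j f
      assume "i \<in> I" "j \<in> I" "f \<in> (if (i, j) \<in> R then {()} else {})"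
      then have ij: "(i, j) \<in> R"
        by (simp split: if_splits)
      show "compose (OMap ?F i) (HMap ?H (OMap D j) X (c j)) (HMap ?F i j f) = HMap ?H (OMap D i) X (c i)"
      proof (rule ext)
        fix p
        show "compose (OMap ?F i) (HMap ?H (OMap D j) X (c j)) (HMap ?F i j f) p = HMap ?H (OMap D i) X (c i) p"
        proof (cases "p \<in> OMap ?F i")
          case True
          then obtain h where h: "h \<in> mdspace_hom K (OMap D i)" "p = Inr h"
            by auto
          have "compose ?K (c j) (compose ?K (m i j) h) = compose ?K (c i) h"
            using compose_assoc_PiE[OF mdspace_homD(5)[OF h(1)], of "c j" "m i j"]
              c_compose_m[OF ij] by simp
          then show ?thesis
            using True mdspace_hom_compose[OF K h(1) m_hom[OF ij]]
            by (simp add: compose_def[of "Inr ` _"] HF h(2) HH[OF h(1)] HH)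
        next
          case False
          then show ?thesis
            unfolding OF by (simp add: compose_def hom_functor_def)
        qed
      qed
    qed
    show "HMap ?F i j () p \<in> OMap ?F j" if "(i, j) \<in> R" "p \<in> OMap ?F i" for i j p
      using PiE_mem[OF HPiE[OF m_hom[OF that(1)]], of p] that(2) by (simp add: HF)
    show "\<exists>i p. i \<in> I \<and> p \<in> OMap ?F i \<and> HMap ?H (OMap D i) X (c i) p = q"
      if "q \<in> OMap ?H X" for q
    proof -
      obtain g where g: "g \<in> mdspace_hom K X" "q = Inr g"
        using \<open>q \<in> OMap ?H X\<close> by auto
      obtain i g' where g': "i \<in> I" "g' \<in> mdspace_hom K (OMap D i)" "compose ?K (c i) g' = g"
        using hom_lift[OF K few g(1)] by (elim exE conjE)
      then show ?thesis
        by (intro exI[of _ i] exI[of _ "Inr g'"]) (simp add: HH g(2))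
    qed
    fix i p p'
    assume i: "i \<in> I" and p: "p \<in> OMap ?F i" "p' \<in> OMap ?F i"
      and eq: "HMap ?H (OMap D i) X (c i) p = HMap ?H (OMap D i) X (c i) p'"
    obtain h where h: "h \<in> mdspace_hom K (OMap D i)" "p = Inr h"
      using p(1) by auto
    obtain h' where h': "h' \<in> mdspace_hom K (OMap D i)" "p' = Inr h'"
      using p(2) by auto
    have "compose ?K (c i) h = compose ?K (c i) h'"
      using eq by (simp add: h(2) h'(2) HH[OF h(1)] HH[OF h'(1)])
    from hom_glue[OF K few i h(1) h'(1) this] obtain j
      where "(i, j) \<in> R" "compose ?K (m i j) h = compose ?K (m i j) h'"
      by (elim exE conjE)
    then show "\<exists>j. (i, j) \<in> R \<and> HMap ?F i j () p = HMap ?F i j () p'"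
      by (intro exI[of _ j]) (simp add: HF h(2) h'(2) HH[OF h(1)] HH[OF h'(1)])
  qed
qed

end

context universe
begin

lemma presentable_few:
  assumes "multipointed_dspace K" "few (topspace (space K))"
  shows "presentable U (pres_card U) (MdTop U) K"
  unfolding presentable_def
proof (intro conjI allI impI, goal_cases)
  case 1
  show ?case
    using assms few_small by simp
next
  case (2 I R D X c)
  then interpret directed_colimit U I R D X c
    by (intro directed_colimit.intro directed_colimit_axioms.intro universe_axioms) simp_all
  show ?case
    by (rule hom_functor_colimit[OF assms])
qed

end

subsection \<open>Small subobjects\<close>

text \<open>
  Every subset \<open>A\<close> of \<open>X\<close> with few points is moved to a subset \<open>B A\<close> of the field of the cardinal of
  presentability by \<open>a A\<close>, with inverse \<open>e A\<close>, so that all subobjects taken together range over a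
  small set. The poset \<open>P\<close> of these subsets is moved to the universe by \<open>enc\<close>.
\<close>

locale small_subobjects = universe U
  for U :: "'v itself" +
  fixes X :: "'v mdspace" and a :: "'v set \<Rightarrow> 'v \<Rightarrow> 'v" and enc :: "'v set \<Rightarrow> 'v"
  assumes X: "multipointed_dspace X" and smallX: "small U (topspace (space X))"
    and a_inj: "\<And>A. few A \<Longrightarrow> inj_on (a A) A"
    and a_Field: "\<And>A. few A \<Longrightarrow> a A ` A \<subseteq> Field (pres_card U)"
    and enc_inj: "inj_on enc {A. A \<subseteq> topspace (space X) \<and> few A}"
begin

definition P :: "'v set set" where "P = {A. A \<subseteq> topspace (space X) \<and> few A}"

definition B :: "'v set \<Rightarrow> 'v set" where "B A = a A ` A"

definition e :: "'v set \<Rightarrow> 'v \<Rightarrow> 'v" where "e A = (\<lambda>b\<in>B A. inv_into A (a A) b)"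

text \<open>The initial structure along the single map \<open>e A\<close>, which makes this a full
  subobject of \<open>X\<close>.\<close>

definition sub :: "'v set \<Rightarrow> 'v mdspace" where
  "sub A = initial_mdspace (B A) {()} (\<lambda>_. X) (\<lambda>_. e A)"

text \<open>The inclusion of \<open>A\<close> into \<open>A'\<close>, seen through the
  codes.\<close>

definition step :: "'v set \<Rightarrow> 'v set \<Rightarrow> 'v \<Rightarrow> 'v" where
  "step A A' = (\<lambda>b\<in>B A. a A' (e A b))"

definition dec :: "'v \<Rightarrow> 'v set" where "dec = inv_into P enc"

definition I :: "'v set" where "I = enc ` P"

definition R :: "'v rel" where "R = {(i, j). i \<in> I \<and> j \<in> I \<and> dec i \<subseteq> dec j}"

definition D :: "('v, unit, 'v mdspace, 'v \<Rightarrow> 'v) functr" where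
  "D = \<lparr>OMap = (\<lambda>i. sub (dec i)), HMap = (\<lambda>i j _. step (dec i) (dec j))\<rparr>"

lemma dec_enc: "A \<in> P \<Longrightarrow> dec (enc A) = A"
  using enc_inj by (simp add: dec_def P_def)

lemma enc_in: "A \<in> P \<Longrightarrow> enc A \<in> I"
  by (simp add: I_def)

lemma dec_in: "i \<in> I \<Longrightarrow> dec i \<in> P"
  by (auto simp: I_def dec_enc)

lemma enc_dec: "i \<in> I \<Longrightarrow> enc (dec i) = i"
  by (auto simp: I_def dec_enc)

lemma singleton_P: "x \<in> topspace (space X) \<Longrightarrow> {x} \<in> P"
  by (simp add: P_def few_finite)

lemma P_few: "A \<in> P \<Longrightarrow> few A" and P_subset: "A \<in> P \<Longrightarrow> A \<subseteq> topspace (space X)"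
  by (simp_all add: P_def)

lemma a_in: "x \<in> A \<Longrightarrow> a A x \<in> B A"
  by (simp add: B_def)

lemma e_a: "\<lbrakk>A \<in> P; x \<in> A\<rbrakk> \<Longrightarrow> e A (a A x) = x"
  by (simp add: e_def a_in inv_into_f_f a_inj P_few)

lemma a_e: "\<lbrakk>A \<in> P; b \<in> B A\<rbrakk> \<Longrightarrow> a A (e A b) = b"
  by (auto simp: B_def e_a)

lemma e_in: "\<lbrakk>A \<in> P; b \<in> B A\<rbrakk> \<Longrightarrow> e A b \<in> A"
  by (auto simp: B_def e_a)

lemma e_PiE: "A \<in> P \<Longrightarrow> e A \<in> B A \<rightarrow>\<^sub>E topspace (space X)"
proof (rule PiE_I)
  show "e A b \<in> topspace (space X)" if "A \<in> P" "b \<in> B A" for b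
    using e_in[OF that] P_subset[OF that(1)] by blast
qed (simp add: e_def)

lemma topspace_sub [simp]: "topspace (space (sub A)) = B A"
  by (simp add: sub_def)

lemma multipointed_sub: "A \<in> P \<Longrightarrow> multipointed_dspace (sub A)"
  unfolding sub_def by (rule multipointed_initial) (use X e_PiE in auto)

lemma e_hom: "A \<in> P \<Longrightarrow> e A \<in> mdspace_hom (sub A) X"
  unfolding sub_def by (rule initial_mdspace_hom) (use X e_PiE in auto)

lemma few_B: "A \<in> P \<Longrightarrow> few (B A)"
  unfolding B_def by (rule few_image[OF P_few])

lemma e_step:
  assumes "A \<in> P" "A' \<in> P" "A \<subseteq> A'"
  shows "compose (B A) (e A') (step A A') = e A"
proof (rule ext)
  fix b
  show "compose (B A) (e A') (step A A') b = e A b"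
  proof (cases "b \<in> B A")
    case True
    then show ?thesis
      using e_a[OF assms(2)] e_in[OF assms(1) True] assms(3) by (simp add: compose_eq step_def subset_iff)
  next
    case False
    then show ?thesis
      by (simp add: compose_def e_def)
  qed
qed

lemma step_PiE:
  assumes "A \<in> P" "A \<subseteq> A'"
  shows "step A A' \<in> B A \<rightarrow>\<^sub>E B A'"
  using a_in e_in[OF assms(1)] assms(2) by (auto simp: step_def)

lemma step_hom:
  assumes "A \<in> P" "A' \<in> P" "A \<subseteq> A'"
  shows "step A A' \<in> mdspace_hom (sub A) (sub A')"
proof -
  have "step A A' \<in> mdspace_hom (sub A) (initial_mdspace (B A') {()} (\<lambda>_. X) (\<lambda>_. e A'))"
    by (rule hom_into_initial_mdspace)
      (use X e_PiE[OF assms(2)] multipointed_sub[OF assms(1)] step_PiE[OF assms(1,3)]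
        e_step[OF assms] e_hom[OF assms(1)] in simp_all)
  then show ?thesis
    by (simp only: sub_def)
qed

lemma step_id: "A \<in> P \<Longrightarrow> step A A = (\<lambda>b\<in>B A. b)"
  by (rule ext) (simp add: step_def a_e)

lemma step_step:
  assumes "A \<in> P" "A' \<in> P" "A \<subseteq> A'"
  shows "compose (B A) (step A' A'') (step A A') = step A A''"
proof (rule ext)
  fix b
  show "compose (B A) (step A' A'') (step A A') b = step A A'' b"
  proof (cases "b \<in> B A")
    case True
    have "e A b \<in> A'"
      using e_in[OF assms(1) True] assms(3) by blast
    then show ?thesis
      using True by (simp add: compose_eq step_def a_in e_a[OF assms(2)])
  next
    case False
    then show ?thesis
      by (simp add: compose_def step_def)
  qed
qed

text \<open>A union of few sets with few points has few points, so it is itself an element of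
  \<open>P\<close> and an upper bound.\<close>

lemma directed: "directed_poset U (pres_card U) I R"
  unfolding directed_poset_def ordLess_pres_card
proof (intro conjI allI impI)
  have "small U P"
    by (rule small_subset[OF small_Pow[OF smallX]]) (auto simp: P_def)
  then show "small U I"
    unfolding I_def by (rule small_image)
  show "partial_order_on I R"
    unfolding partial_order_on_def preorder_on_def
  proof (intro conjI)
    show "R \<subseteq> I \<times> I" "refl_on I R"
      by (auto simp: R_def refl_on_def)
    show "trans R"
      by (rule transI) (auto simp: R_def)
    show "antisym R"
    proof (rule antisymI)
      fix i j
      assume "(i, j) \<in> R" "(j, i) \<in> R"
      then have ij: "i \<in> I" "j \<in> I" "dec i = dec j"
        by (auto simp: R_def)
      show "i = j"
        using arg_cong[OF ij(3), of enc] unfolding enc_dec[OF ij(1)] enc_dec[OF ij(2)] .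
    qed
  qed
  fix S
  assume S: "S \<subseteq> I" "few S"
  let ?A = "\<Union>s\<in>S. dec s"
  have "few ?A"
    by (rule few_UN[OF S(2)], rule P_few, rule dec_in, rule subsetD[OF S(1)])
  moreover have "?A \<subseteq> topspace (space X)"
    by (rule UN_least, rule P_subset, rule dec_in, rule subsetD[OF S(1)])
  ultimately have A: "?A \<in> P"
    by (simp add: P_def)
  show "\<exists>u\<in>I. \<forall>s\<in>S. (s, u) \<in> R"
  proof (rule bexI[OF _ enc_in[OF A]], rule ballI)
    fix s
    assume "s \<in> S"
    then show "(s, enc ?A) \<in> R"
      using S(1) enc_in[OF A] dec_enc[OF A] by (auto simp: R_def)
  qed
qed

lemma diagram: "cat_functor (poset_cat I R) (MdTop U) D"
proof (intro cat_functor.intro category_MdTop cat_functor_axioms.intro)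
  show "category (poset_cat I R)"
    by unfold_locales (auto simp: R_def split: if_splits)
  show "OMap D i \<in> Ob (MdTop U)" if "i \<in> Ob (poset_cat I R)" for i
    using that multipointed_sub[OF dec_in] few_small[OF few_B[OF dec_in]] by (simp add: D_def)
  show "HMap D i j f \<in> Hom (MdTop U) (OMap D i) (OMap D j)"
    if "f \<in> Hom (poset_cat I R) i j" for i j f
    using that step_hom dec_in by (simp add: D_def R_def split: if_splits)
  show "HMap D i i (Idn (poset_cat I R) i) = Idn (MdTop U) (OMap D i)"
    if "i \<in> Ob (poset_cat I R)" for i
    using that step_id[OF dec_in] by (simp add: D_def)
  show "HMap D i k (Cmp (poset_cat I R) i j k g f)
      = Cmp (MdTop U) (OMap D i) (OMap D j) (OMap D k) (HMap D j k g) (HMap D i j f)"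
    if "f \<in> Hom (poset_cat I R) i j" for i j k f g
    using that step_step[OF dec_in dec_in] by (simp add: D_def R_def split: if_splits)
qed

text \<open>Singletons determine the underlying function of the comparison map. Continuity and the
  effect on paths are checked by factoring a simplex or path through the subobject on its own
  image.\<close>

lemma colimit: "is_colimit (poset_cat I R) (MdTop U) D X (\<lambda>i. e (dec i))"
  unfolding is_colimit_def
proof (intro conjI allI impI)
  show "is_cocone (poset_cat I R) (MdTop U) D X (\<lambda>i. e (dec i))"
    unfolding is_cocone_def MdTop_simps poset_cat_simps
  proof (intro conjI ballI X smallX)
    show "e (dec i) \<in> mdspace_hom (OMap D i) X" if "i \<in> I" for i
      using e_hom[OF dec_in[OF that]] by (simp add: D_def)
    show "compose (topspace (space (OMap D i))) (e (dec j)) (HMap D i j f) = e (dec i)"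
      if "f \<in> (if (i, j) \<in> R then {()} else {})" for i j f
      using that e_step dec_in by (simp add: D_def R_def split: if_splits)
  qed
  fix Y d
  assume cocone: "is_cocone (poset_cat I R) (MdTop U) D Y d"
  have d_hom: "d (enc A) \<in> mdspace_hom (sub A) Y" if "A \<in> P" for A
  proof -
    have "\<forall>j\<in>I. d j \<in> mdspace_hom (sub (dec j)) Y"
      using cocone by (simp add: is_cocone_def D_def)
    from bspec[OF this enc_in[OF that]] show ?thesis
      by (simp add: dec_enc that)
  qed
  have Y: "multipointed_dspace Y"
    using cocone by (simp add: is_cocone_def)
  have d_step: "d (enc A') (step A A' b) = d (enc A) b"
    if A: "A \<in> P" "A' \<in> P" "A \<subseteq> A'" and b: "b \<in> B A" for A A' b
  proof -
    have "(enc A, enc A') \<in> R"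
      using A by (simp add: R_def enc_in dec_enc)
    moreover have "\<forall>i\<in>I. \<forall>j\<in>I. (i, j) \<in> R \<longrightarrow>
        compose (B (dec i)) (d j) (step (dec i) (dec j)) = d i"
      using cocone by (simp add: is_cocone_def D_def)
    ultimately have "compose (B (dec (enc A))) (d (enc A')) (step (dec (enc A)) (dec (enc A'))) = d (enc A)"
      using enc_in[OF A(1)] enc_in[OF A(2)] by blast
    then have "compose (B A) (d (enc A')) (step A A') = d (enc A)"
      by (simp only: dec_enc[OF A(1)] dec_enc[OF A(2)])
    from fun_cong[OF this, of b] b show ?thesis
      by (simp add: compose_eq)
  qed
  define h where "h = (\<lambda>x\<in>topspace (space X). d (enc {x}) (a {x} x))"
  have h_eq: "h x = d (enc A) (a A x)" if A: "A \<in> P" and x: "x \<in> A" for A x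
  proof -
    have xX: "x \<in> topspace (space X)"
      using P_subset[OF A] x by blast
    \<comment> \<open>The code of \<open>x\<close> in the singleton goes to its code in
      \<open>A\<close>, so compatibility of \<open>d\<close> makes the value at \<open>x\<close>
      independent of \<open>A\<close>.\<close>
    have "step {x} A (a {x} x) = a A x"
      by (simp add: step_def a_in e_a singleton_P[OF xX])
    then show ?thesis
      using d_step[OF singleton_P[OF xX] A, of "a {x} x"] x xX by (simp add: h_def a_in)
  qed
  have h_e: "compose (B A) h (e A) = d (enc A)" if A: "A \<in> P" for A
  proof (rule ext)
    fix b
    show "compose (B A) h (e A) b = d (enc A) b"
    proof (cases "b \<in> B A")
      case True
      then show ?thesis
        by (simp add: compose_eq h_eq[OF A e_in[OF A True]] a_e[OF A True])
    next
      case False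
      then show ?thesis
        using mdspace_homD(1)[OF d_hom[OF A]] by (simp add: compose_def extensional_def)
    qed
  qed
  have sub_simplex: "continuous_map (simplex_top n) (space (sub A)) \<sigma>"
    if A: "A \<in> P" and "\<sigma> \<in> standard_simplex n \<rightarrow> B A"
      "continuous_map (simplex_top n) (space X) (\<lambda>x. e A (\<sigma> x))" for n A \<sigma>
    unfolding sub_def
    by (rule continuous_map_simplex_initial) (use X e_PiE[OF A] that in auto)
  have h_hom: "h \<in> mdspace_hom X Y"
  proof (rule mdspace_homI)
    show "continuous_map (space X) (space Y) h"
    proof (rule continuous_map_from_delta_generated[OF multipointed_dspaceD(1)[OF X]])
      show "h \<in> topspace (space X) \<rightarrow> topspace (space Y)"
      proof (rule funcsetI)
        fix x
        assume x: "x \<in> topspace (space X)"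
        show "h x \<in> topspace (space Y)"
          using mdspace_homD(6)[OF d_hom[OF singleton_P[OF x]], of "a {x} x"] x
          by (simp add: h_def a_in)
      qed
      fix n \<sigma>
      assume \<sigma>: "continuous_map (simplex_top n) (space X) \<sigma>"
      let ?A = "\<sigma> ` standard_simplex n"
      have "?A \<subseteq> topspace (space X)"
        using continuous_map_image_subset_topspace[OF \<sigma>] by simp
      then have A: "?A \<in> P"
        by (simp add: P_def few_image[OF few_nat_real])
      have "continuous_map (simplex_top n) (space (sub ?A)) (\<lambda>x. a ?A (\<sigma> x))"
      proof (rule sub_simplex[OF A])
        show "(\<lambda>x. a ?A (\<sigma> x)) \<in> standard_simplex n \<rightarrow> B ?A"
          by (rule funcsetI) (simp add: a_in)
        show "continuous_map (simplex_top n) (space X) (\<lambda>x. e ?A (a ?A (\<sigma> x)))"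
          by (rule continuous_map_eq[OF \<sigma>]) (simp add: e_a[OF A])
      qed
      from continuous_map_compose[OF this mdspace_homD(2)[OF d_hom[OF A]]]
      show "continuous_map (simplex_top n) (space Y) (\<lambda>x. h (\<sigma> x))"
        by (rule continuous_map_eq) (simp add: h_eq[OF A])
    qed
    show "h ` states X \<subseteq> states Y"
    proof (rule image_subsetI)
      fix x
      assume x: "x \<in> states X"
      then have xX: "x \<in> topspace (space X)"
        using multipointed_dspaceD(2)[OF X] by blast
      have "a {x} x \<in> states (sub {x})"
        using x by (simp add: sub_def states_initial_mdspace a_in e_a[OF singleton_P[OF xX]])
      then show "h x \<in> states Y"
        using mdspace_homD(3)[OF d_hom[OF singleton_P[OF xX]]] xX by (simp add: h_def)
    qed
    fix \<phi>
    assume \<phi>: "\<phi> \<in> dpaths X"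
    let ?A = "\<phi> ` {0..1}"
    have sp: "state_path (space X) (states X) \<phi>"
      by (rule multipointed_dspaceD(3)[OF X \<phi>])
    have "?A \<subseteq> topspace (space X)"
      using multipointed_dspaceD(6)[OF X \<phi>] by (simp add: image_subset_iff_funcset)
    then have A: "?A \<in> P"
      by (simp add: P_def few_image[OF continuum_few[OF continuum_real]])
    let ?\<phi> = "compose {0..1} (a ?A) \<phi>"
    have e\<phi>: "e ?A (?\<phi> t) = \<phi> t" if "t \<in> {0..1}" for t
      using that by (simp add: compose_eq e_a[OF A])
    have "?\<phi> \<in> dpaths (sub ?A)"
    proof -
      have x1: "x 1 \<in> {0..1}" if "x \<in> standard_simplex 1" for x
        using that by (simp add: standard_simplex_def)
      \<comment> \<open>The path is viewed as a 1-simplex because the topology of the subobject is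
        given by its simplices.\<close>
      have "continuous_map (simplex_top 1) (space (sub ?A)) (\<lambda>x. ?\<phi> (x 1))"
      proof (rule sub_simplex[OF A])
        show "(\<lambda>x. ?\<phi> (x 1)) \<in> standard_simplex 1 \<rightarrow> B ?A"
        proof (rule funcsetI)
          fix x :: "nat \<Rightarrow> real"
          assume "x \<in> standard_simplex 1"
          then have x1': "x 1 \<in> {0..1}"
            by (rule x1)
          show "?\<phi> (x 1) \<in> B ?A"
            unfolding compose_eq[OF x1'] by (intro a_in imageI x1')
        qed
        have "continuous_map (simplex_top 1) (space X) (\<lambda>x. \<phi> (x 1))"
          using sp by (simp add: state_path_def pathin_iff_simplex)
        then show "continuous_map (simplex_top 1) (space X) (\<lambda>x. e ?A (?\<phi> (x 1)))"
          by (rule continuous_map_eq) (simp only: topspace_simplex_top e\<phi>[OF x1])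
      qed
      then have path: "pathin (space (sub ?A)) ?\<phi>"
        by (simp only: pathin_iff_simplex)
      have states: "?\<phi> t \<in> states (sub ?A)" if "t \<in> {0..1}" "\<phi> t \<in> states X" for t
      proof -
        have "?\<phi> t \<in> B ?A"
          unfolding compose_eq[OF that(1)] by (intro a_in imageI that)
        then show ?thesis
          using that(2) e\<phi>[OF that(1)] by (simp add: sub_def states_initial_mdspace)
      qed
      have "compose {0..1} (e ?A) ?\<phi> = compose {0..1} (\<lambda>x. x) \<phi>"
        by (rule compose_eqI) (rule e\<phi>)
      also have "\<dots> = \<phi>"
        by (rule compose_restrict_path[where S = UNIV]) (use sp in \<open>simp_all add: state_path_def\<close>)
      finally have comp: "compose {0..1} (e ?A) ?\<phi> = \<phi>" .
      have "\<phi> 0 \<in> states X" "\<phi> 1 \<in> states X"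
        using sp by (simp_all add: state_path_def)
      then have "state_path (space (sub ?A)) (states (sub ?A)) ?\<phi>"
        unfolding state_path_def by (intro conjI path states compose_extensional) simp_all
      then show ?thesis
        using comp \<phi> unfolding sub_def dpaths_initial_mdspace by simp
    qed
    from mdspace_homD(4)[OF d_hom[OF A] this]
    have "compose {0..1} (d (enc ?A)) ?\<phi> \<in> dpaths Y" .
    moreover have "compose {0..1} (d (enc ?A)) ?\<phi> = compose {0..1} h \<phi>"
      by (rule compose_eqI) (simp add: compose_eq h_eq[OF A])
    ultimately show "compose {0..1} h \<phi> \<in> dpaths Y"
      by simp
  qed (simp add: h_def)
  have unique: "h' = h"
    if h': "h' \<in> mdspace_hom X Y" "\<forall>j\<in>I. compose (topspace (space (OMap D j))) h' (e (dec j)) = d j"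
    for h'
  proof (rule ext)
    fix x
    show "h' x = h x"
    proof (cases "x \<in> topspace (space X)")
      case True
      have "compose (B {x}) h' (e {x}) = d (enc {x})"
        using bspec[OF h'(2) enc_in[OF singleton_P[OF True]]]
        by (simp add: D_def dec_enc[OF singleton_P[OF True]])
      from fun_cong[OF this, of "a {x} x"] show ?thesis
        using True by (simp add: compose_eq a_in h_def e_a[OF singleton_P[OF True]])
    next
      case False
      then show ?thesis
        using mdspace_homD(1)[OF h'(1)] by (simp add: h_def extensional_def)
    qed
  qed
  have "\<forall>j\<in>I. compose (topspace (space (OMap D j))) h (e (dec j)) = d j"
    using h_e[OF dec_in] by (simp add: D_def enc_dec)
  then show "\<exists>!h. h \<in> Hom (MdTop U) X Y \<and> (\<forall>j\<in>Ob (poset_cat I R).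
      Cmp (MdTop U) (OMap D j) X Y h (e (dec j)) = d j)"
    unfolding MdTop_simps poset_cat_simps
    by (intro ex1I[of _ h] conjI h_hom) (assumption, elim conjE, rule unique)
qed

end

section \<open>A small set of generators and local presentability\<close>

context universe
begin

text \<open>Carriers are confined to one fixed small set; all subsets of \<open>'v\<close> with few
  points would form a proper class.\<close>

definition generators :: "'v mdspace set" where
  "generators = {K. multipointed_dspace K \<and> topspace (space K) \<subseteq> Field (pres_card U) \<and>
     few (topspace (space K))}"

lemma small_generators: "small U generators"
proof (rule small_subset)
  have F: "small U (Field (pres_card U))"
    using regular_cardinal_pres_card by (simp add: regular_cardinal_def)
  show "small U (\<Union>E\<in>Pow (Field (pres_card U)). {X. multipointed_dspace X \<and> topspace (space X) = E})"
    by (rule small_UN[OF small_Pow[OF F]], rule small_fibre, rule small_subset[OF F], erule PowD)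
  show "generators
      \<subseteq> (\<Union>E\<in>Pow (Field (pres_card U)). {X. multipointed_dspace X \<and> topspace (space X) = E})"
    by (auto simp: generators_def)
qed

lemma directed_colimit_of_generators:
  assumes X: "X \<in> Ob (MdTop U)"
  shows "\<exists>I R D c. directed_poset U (pres_card U) I R \<and> cat_functor (poset_cat I R) (MdTop U) D \<and>
    (\<forall>i\<in>I. OMap D i \<in> generators) \<and> is_colimit (poset_cat I R) (MdTop U) D X c"
proof -
  have "\<forall>A :: 'v set. \<exists>f :: 'v \<Rightarrow> 'v. few A \<longrightarrow> inj_on f A \<and> f ` A \<subseteq> Field (pres_card U)"
  proof (rule allI)
    fix A :: "'v set"
    show "\<exists>f :: 'v \<Rightarrow> 'v. few A \<longrightarrow> inj_on f A \<and> f ` A \<subseteq> Field (pres_card U)"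
    proof (cases "few A")
      case True
      then obtain f where "inj_on f A" "f ` A \<subseteq> Field (pres_card U)"
        by (rule few_embedding)
      then show ?thesis
        by (intro exI[of _ f] impI conjI)
    qed simp
  qed
  from choice[OF this] obtain a :: "'v set \<Rightarrow> 'v \<Rightarrow> 'v"
    where a: "\<forall>A. few A \<longrightarrow> inj_on (a A) A \<and> a A ` A \<subseteq> Field (pres_card U)"
    by (elim exE)
  have "small U {A. A \<subseteq> topspace (space X) \<and> few A}"
    by (rule small_subset[OF small_Pow[of "topspace (space X)"]]) (use X in auto)
  then obtain enc :: "'v set \<Rightarrow> 'v" where enc: "inj_on enc {A. A \<subseteq> topspace (space X) \<and> few A}"
    by (rule small_embedding)
  interpret small_subobjects U X a enc
    by (intro small_subobjects.intro small_subobjects_axioms.intro universe_axioms)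
      (use X a enc in simp_all)
  have "OMap D i \<in> generators" if "i \<in> I" for i
    using multipointed_sub[OF dec_in[OF that]] few_B[OF dec_in[OF that]]
      a_Field[OF P_few[OF dec_in[OF that]]]
    by (simp add: D_def generators_def B_def)
  then show ?thesis
    using directed diagram colimit by (intro exI conjI ballI)
qed

lemma locally_presentable_MdTop: "locally_presentable U (MdTop U)"
  unfolding locally_presentable_def
proof (intro conjI category_MdTop locally_small_MdTop cocomplete_MdTop
    exI[of _ "pres_card U"] regular_cardinal_pres_card exI[of _ generators] small_generators ballI)
  show "presentable U (pres_card U) (MdTop U) K" if "K \<in> generators" for K
    using that by (intro presentable_few) (simp_all add: generators_def)
qed (rule directed_colimit_of_generators)

end

text \<open>The index type of the sources is a free type variable, which expresses that they may be
  of any size.\<close>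

theorem theorem3p4:
  assumes "strongly_inaccessible |UNIV :: 'v set|"
  shows "concrete_over (MdTop TYPE('v)) (set_cat TYPE('v)) underlying_set \<and>
         topological TYPE('i) (MdTop TYPE('v)) (set_cat TYPE('v)) underlying_set \<and>
         fibre_small TYPE('v) (MdTop TYPE('v)) (set_cat TYPE('v)) underlying_set \<and>
         locally_presentable TYPE('v) (MdTop TYPE('v))"
proof -
  interpret universe "TYPE('v)"
    by (rule universe.intro) (rule assms)
  show ?thesis
    by (intro conjI concrete_over_MdTop topological_MdTop fibre_small_MdTop locally_presentable_MdTop)
qed

end
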